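(* Disjoint Paths (with $k$ part of the input) is polynomial-time solvable on cobipartite graphs.
   Context: A graph is cobipartite if its complement is bipartite, equivalently if its vertex set can be partitioned into two (possibly empty) cliques. Disjoint Paths: given a graph $G$ and pairwise disjoint terminal pairs $(s_1,t_1),\dots,(s_k,t_k)$ (all $2k$ vertices distinct), decide whether $G$ has pairwise vertex-disjoint paths $P^1,\dots,P^k$ with $P^i$ an $s_i$–$t_i$ path. *)

theory Defs
  imports Main
begin

text \<open>A (finite simple) graph on the vertex set {0..<n} is given by an edge
relation E, which must be symmetric and irreflexive on {0..<n}; only the
values E u v with u, v < n matter.\<close>

definition simple_graph :: "nat \<Rightarrow> (nat \<Rightarrow> nat \<Rightarrow> bool) \<Rightarrow> bool" where
  "simple_graph n E \<longleftrightarrow> (\<forall>u<n. \<forall>v<n. E u v \<longleftrightarrow> E v u) \<and> (\<forall>u<n. \<not> E u u)"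

definition is_clique :: "(nat \<Rightarrow> nat \<Rightarrow> bool) \<Rightarrow> nat set \<Rightarrow> bool" where
  "is_clique E X \<longleftrightarrow> (\<forall>u\<in>X. \<forall>v\<in>X. u \<noteq> v \<longrightarrow> E u v)"

definition cobipartite :: "nat \<Rightarrow> (nat \<Rightarrow> nat \<Rightarrow> bool) \<Rightarrow> bool" where
  "cobipartite n E \<longleftrightarrow> (\<exists>A\<subseteq>{0..<n}. is_clique E A \<and> is_clique E ({0..<n} - A))"

definition is_path :: "nat \<Rightarrow> (nat \<Rightarrow> nat \<Rightarrow> bool) \<Rightarrow> nat list \<Rightarrow> nat \<Rightarrow> nat \<Rightarrow> bool" where
  "is_path n E p s t \<longleftrightarrow> p \<noteq> [] \<and> hd p = s \<and> last p = t \<and> distinct p \<and>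
     set p \<subseteq> {0..<n} \<and> (\<forall>i. Suc i < length p \<longrightarrow> E (p ! i) (p ! Suc i))"

definition valid_instance :: "nat \<Rightarrow> (nat \<Rightarrow> nat \<Rightarrow> bool) \<Rightarrow> (nat \<times> nat) list \<Rightarrow> bool" where
  "valid_instance n E ts \<longleftrightarrow> simple_graph n E \<and>
     (\<forall>(s,t)\<in>set ts. s < n \<and> t < n) \<and> distinct (concat (map (\<lambda>(s,t). [s,t]) ts))"

definition disjoint_paths :: "nat \<Rightarrow> (nat \<Rightarrow> nat \<Rightarrow> bool) \<Rightarrow> (nat \<times> nat) list \<Rightarrow> bool" where
  "disjoint_paths n E ts \<longleftrightarrow> (\<exists>P :: nat \<Rightarrow> nat list.
     (\<forall>i<length ts. is_path n E (P i) (fst (ts ! i)) (snd (ts ! i))) \<and>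
     (\<forall>i<length ts. \<forall>j<length ts. i \<noteq> j \<longrightarrow> set (P i) \<inter> set (P j) = {}))"

datatype sym = Blank | Zero | One | Sep
datatype move = MoveL | MoveR | Stay

text \<open>A TM is a number of states Q and a transition function; state 0 is the
start state, 1 accepts and 2 rejects (both halting).  Well-formedness demands
finitely many states: the transition function maps states below Q to states below Q.\<close>
type_synonym tm = "nat \<times> (nat \<Rightarrow> sym \<Rightarrow> nat \<times> sym \<times> move)"

definition tm_wf :: "tm \<Rightarrow> bool" where
  "tm_wf M \<longleftrightarrow> 3 \<le> fst M \<and> (\<forall>q<fst M. \<forall>a. fst (snd M q a) < fst M)"

text \<open>Configuration: (state, cells left of the head in reverse order,
cells from the head rightwards); unwritten cells are blank.\<close>
type_synonym config = "nat \<times> sym list \<times> sym list"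

definition tm_step :: "tm \<Rightarrow> config \<Rightarrow> config" where
  "tm_step M c = (case c of (q, ls, rs) \<Rightarrow>
     if q = 1 \<or> q = 2 then c else
     (let a = (case rs of [] \<Rightarrow> Blank | x # _ \<Rightarrow> x) in
      case snd M q a of (q', w, m) \<Rightarrow>
        (case m of
           Stay \<Rightarrow> (q', ls, w # tl rs)
         | MoveR \<Rightarrow> (q', w # ls, tl rs)
         | MoveL \<Rightarrow> (case ls of [] \<Rightarrow> (q', [], w # tl rs)
                               | l # ls' \<Rightarrow> (q', ls', l # w # tl rs)))))"

definition tm_run :: "tm \<Rightarrow> nat \<Rightarrow> sym list \<Rightarrow> config" where
  "tm_run M t x = (tm_step M ^^ t) (0, [], x)"

definition decides_within :: "tm \<Rightarrow> nat \<Rightarrow> sym list \<Rightarrow> bool \<Rightarrow> bool" where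
  "decides_within M T x ans \<longleftrightarrow> fst (tm_run M T x) = (if ans then 1 else 2)"

definition unary :: "nat \<Rightarrow> sym list" where
  "unary m = replicate m One @ [Sep]"

definition encode_instance :: "nat \<Rightarrow> (nat \<Rightarrow> nat \<Rightarrow> bool) \<Rightarrow> (nat \<times> nat) list \<Rightarrow> sym list" where
  "encode_instance n E ts =
     unary n @
     concat (map (\<lambda>u. map (\<lambda>v. if E u v then One else Zero) [0..<n]) [0..<n]) @ [Sep] @
     concat (map (\<lambda>(s,t). unary s @ unary t) ts)"

end

theory Submission
  imports Defs
begin

text \<open>A path between adjacent terminals may be taken to be the edge between them. A shortest path
between nonadjacent terminals \<open>s\<close> and \<open>t\<close> of a cobipartite graph passes through a common neighbour
of \<open>s\<close> and \<open>t\<close> or along an edge between the two cliques, and the latter can serve any nonadjacent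
pair. So the disjoint paths exist iff a certain graph, in which \<open>s\<close> represents the pair, has a
matching with as many edges as there are nonadjacent pairs.

Maximum matchings are computed without blossoms. For every set \<open>s\<close> of at most five vertices one
keeps a matching that avoids \<open>s\<close>, and one improves these matchings by adding an edge or by
exchanging two of them along a component of their symmetric difference. When this stops, their
sizes \<open>f s\<close> satisfy an exchange inequality, which suffices to recover the argument of the
Gallai-Edmonds theorem: the neighbours of the vertices \<open>v\<close> with \<open>f {v} = f {}\<close> certify that
\<open>f {}\<close> is the size of a maximum matching.

Polynomial time is established for a class of functions on tree-encoded data that is closed under
composition, case distinction and iteration with polynomially bounded intermediate results.
They are computed by programs with four stacks, which a Turing machine keeps on its tape one after
the other.\<close>

section \<open>Finite-state machines over arbitrary state types\<close>

text \<open>The bound of five vertices comes from the proof of optimality. There, a class of an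
  equivalence relation must be shown to contain at most one vertex that the matching
  \<open>X\<close> misses or matches into the neighbour set \<open>A\<close>. For two such vertices
  their at most two partners in \<open>A\<close> have to be avoided as well, and transitivity
  compares three vertices over such a set of partners, which makes 2 + 3. The bound does not depend
  on the input, so polynomially many matchings are kept, and as the sum of their sizes only grows,
  polynomially many rounds suffice. The only combinatorial fact about matchings behind the exchange
  inequality is that a component of a symmetric difference which starts at a vertex missed by one
  matching is a path, and so has at most one end missed by the other.

  On the machine side the obstacle is that iterating a polynomial-time function may produce
  exponentially large data. Hence every iteration comes with a bound on the sizes of its
  intermediate values, and these bounds follow the algorithm up to its main loop.\<close>

definition gstep :: "('s \<Rightarrow> sym \<Rightarrow> 's \<times> sym \<times> move) \<Rightarrow> 's \<times> sym list \<times> sym list \<Rightarrow> 's \<times> sym list \<times> sym list" where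
  "gstep d c = (case c of (q, ls, rs) \<Rightarrow>
     (let a = (case rs of [] \<Rightarrow> Blank | x # _ \<Rightarrow> x) in
      case d q a of (q', w, m) \<Rightarrow>
        (case m of
           Stay \<Rightarrow> (q', ls, w # tl rs)
         | MoveR \<Rightarrow> (q', w # ls, tl rs)
         | MoveL \<Rightarrow> (case ls of [] \<Rightarrow> (q', [], w # tl rs)
                               | l # ls' \<Rightarrow> (q', ls', l # w # tl rs)))))"

lemma fst_gstep: "fst (gstep d (q, ls, rs)) = fst (d q (case rs of [] \<Rightarrow> Blank | x # _ \<Rightarrow> x))"
  by (auto simp: gstep_def Let_def split: prod.splits move.splits list.splits)

text \<open>The end of the list \<open>rs\<close> reads as blank, so explicit trailing blanks do not
  change the behaviour. This allows the simulation to start on a tape with as many explicit blanks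
  as it will use up.\<close>

lemma gstep_pad:
  "\<exists>j'. gstep d (q, ls, rs @ replicate j Blank) =
     (fst (gstep d (q, ls, rs)), fst (snd (gstep d (q, ls, rs))), snd (snd (gstep d (q, ls, rs))) @ replicate j' Blank)"
proof (cases rs)
  case Nil
  then show ?thesis
  proof (cases j)
    case 0
    then show ?thesis using Nil by (intro exI[of _ 0]) simp
  next
    case (Suc j')
    then show ?thesis using Nil
      by (intro exI[of _ j']) (auto simp: gstep_def Let_def split: prod.splits move.splits list.splits)
  qed
next
  case (Cons a list)
  then show ?thesis
    by (intro exI[of _ j]) (auto simp: gstep_def Let_def split: prod.splits move.splits list.splits)
qed

lemma gsteps_pad:
  "\<exists>j'. (gstep d ^^ t) (q, ls, rs @ replicate j Blank) =
     (fst ((gstep d ^^ t) (q, ls, rs)), fst (snd ((gstep d ^^ t) (q, ls, rs))),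
      snd (snd ((gstep d ^^ t) (q, ls, rs))) @ replicate j' Blank)"
proof (induction t)
  case 0
  then show ?case by auto
next
  case (Suc t)
  obtain q1 l1 r1 where *: "(gstep d ^^ t) (q, ls, rs) = (q1, l1, r1)" by (metis prod_cases3)
  from Suc obtain j' where "(gstep d ^^ t) (q, ls, rs @ replicate j Blank) = (q1, l1, r1 @ replicate j' Blank)"
    by (auto simp: *)
  then show ?case using gstep_pad[of d q1 l1 r1 j'] by (simp add: *)
qed

lemma finite_machine_to_tm:
  fixes S :: "'s set"
  assumes fin: "finite S" and closed: "\<And>q a. q \<in> S \<Longrightarrow> fst (d q a) \<in> S"
    and S: "s0 \<in> S" "acc \<in> S" "rej \<in> S" and neq: "s0 \<noteq> acc" "s0 \<noteq> rej" "acc \<noteq> rej"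
    and halt: "\<And>a. fst (d acc a) = acc" "\<And>a. fst (d rej a) = rej"
  obtains M where "tm_wf M"
    "\<And>t x ans. fst ((gstep d ^^ t) (s0, [], x)) = (if ans then acc else rej) \<Longrightarrow> decides_within M t x ans"
proof -
  have fin': "finite (S - {s0, acc, rej})" using fin by simp
  obtain h0 where h0: "bij_betw h0 (S - {s0, acc, rej}) {0..<card (S - {s0, acc, rej})}"
    using ex_bij_betw_finite_nat[OF fin'] by blast
  define h where "h s = (if s = s0 then 0 else if s = acc then 1 else if s = rej then 2 else 3 + h0 s)" for s
  define n where "n = 3 + card (S - {s0, acc, rej})"
  have inj: "inj_on h S"
  proof (rule inj_onI)
    fix x y assume xy: "x \<in> S" "y \<in> S" "h x = h y"
    show "x = y"
    proof (cases "x \<in> {s0, acc, rej} \<or> y \<in> {s0, acc, rej}")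
      case True
      then show ?thesis using xy(3) neq by (auto simp: h_def split: if_splits)
    next
      case False
      then have "h0 x = h0 y" using xy(3) by (auto simp: h_def)
      then show ?thesis using h0 False xy unfolding bij_betw_def inj_on_def by blast
    qed
  qed
  have bound: "h s < n" if "s \<in> S" for s
  proof (cases "s \<in> {s0, acc, rej}")
    case True
    then show ?thesis using neq by (auto simp: h_def n_def)
  next
    case False
    then have "h0 s < card (S - {s0, acc, rej})" using h0 that unfolding bij_betw_def by fastforce
    then show ?thesis using False by (auto simp: h_def n_def)
  qed
  \<comment> \<open>Numbers that code no state get the default \<open>s0\<close>, so that
    \<open>g\<close> always yields an element of \<open>S\<close>.\<close>
  define g where "g q = (if q \<in> h ` S then the_inv_into S h q else s0)" for q
  have gS: "g q \<in> S" for q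
    using the_inv_into_into[OF inj, of q S] S by (auto simp: g_def)
  have gh: "g (h s) = s" if "s \<in> S" for s
    using that the_inv_into_f_f[OF inj that] by (simp add: g_def)
  define M where "M = (n, \<lambda>q a. case d (g q) a of (s, w, m) \<Rightarrow> (h s, w, m))"
  have wf: "tm_wf M"
    using bound closed[OF gS] by (auto simp: tm_wf_def M_def n_def split: prod.splits)
      (metis fst_conv)
  have step: "tm_step M (h s, ls, rs) = (h (fst (gstep d (s, ls, rs))), snd (gstep d (s, ls, rs)))"
    if "s \<in> S" "s \<noteq> acc" "s \<noteq> rej" for s ls rs
  proof -
    have "h s \<noteq> 1" "h s \<noteq> 2" using that by (auto simp: h_def)
    then show ?thesis using gh[OF that(1)]
      by (auto simp: tm_step_def gstep_def M_def Let_def split: prod.splits move.splits list.splits)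
  qed
  have inS: "fst ((gstep d ^^ t) (s0, [], x)) \<in> S" for t x
  proof (induction t)
    case (Suc t)
    obtain q1 l1 r1 where *: "(gstep d ^^ t) (s0, [], x) = (q1, l1, r1)" by (metis prod_cases3)
    then show ?case using Suc closed by (simp add: fst_gstep)
  qed (use S in auto)
  \<comment> \<open>\<open>tm_step\<close> freezes a halted configuration whereas
    \<open>gstep\<close> may go on moving the head, so after halting only the states are
    compared.\<close>
  have sim: "fst (tm_run M t x) = h (fst ((gstep d ^^ t) (s0, [], x))) \<and>
    (fst ((gstep d ^^ t) (s0, [], x)) \<notin> {acc, rej} \<longrightarrow> snd (tm_run M t x) = snd ((gstep d ^^ t) (s0, [], x)))"
    for t x
  proof (induction t)
    case 0
    then show ?case by (simp add: tm_run_def h_def)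
  next
    case (Suc t)
    obtain q1 l1 r1 where *: "(gstep d ^^ t) (s0, [], x) = (q1, l1, r1)" by (metis prod_cases3)
    obtain q2 l2 r2 where **: "tm_run M t x = (q2, l2, r2)" by (metis prod_cases3)
    have q2: "q2 = h q1" using Suc * ** by simp
    have R: "tm_run M (Suc t) x = tm_step M (q2, l2, r2)" using ** by (simp add: tm_run_def)
    have q1S: "q1 \<in> S" using inS[of t x] * by simp
    show ?case
    proof (cases "q1 \<in> {acc, rej}")
      case True
      then have "fst (gstep d (q1, l1, r1)) = q1" using halt by (auto simp: fst_gstep)
      moreover have "tm_step M (q2, l2, r2) = (q2, l2, r2)"
        using True q2 neq by (auto simp: tm_step_def h_def)
      ultimately show ?thesis using True * R q2 by simp
    next
      case False
      then have "l2 = l1" "r2 = r1" using Suc * ** by auto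
      then show ?thesis using step[OF q1S, of l1 r1] False * R q2 by simp
    qed
  qed
  have "decides_within M t x ans"
    if "fst ((gstep d ^^ t) (s0, [], x)) = (if ans then acc else rej)" for t x ans
    using sim[of t x] that neq by (auto simp: decides_within_def h_def)
  with wf show ?thesis using that by blast
qed

section \<open>Programs over four stacks\<close>

datatype com = Skip | Push nat sym | Seq com com | Case nat "sym \<Rightarrow> com" | Loop nat "sym \<Rightarrow> com"

fun peek :: "sym list \<Rightarrow> sym" where
  "peek [] = Blank"
| "peek (a # _) = a"

inductive exec :: "com \<Rightarrow> sym list list \<Rightarrow> nat \<Rightarrow> sym list list \<Rightarrow> bool" where
  Skip: "exec Skip s 1 s"
| Push: "exec (Push i a) s 1 (s[i := a # s ! i])"
| Seq: "exec c s n s' \<Longrightarrow> exec d s' m s'' \<Longrightarrow> exec (Seq c d) s (n + m + 1) s''"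
| Case: "exec (f (peek (s ! i))) (s[i := tl (s ! i)]) n s' \<Longrightarrow> exec (Case i f) s (n + 1) s'"
| LoopE: "s ! i = [] \<Longrightarrow> exec (Loop i f) s 1 s"
| LoopS: "s ! i = a # r \<Longrightarrow> exec (f a) (s[i := r]) n s' \<Longrightarrow> exec (Loop i f) s' m s'' \<Longrightarrow>
    exec (Loop i f) s (n + m + 1) s''"

text \<open>A pushed blank would be taken for a delimiter on the tape, hence its exclusion.\<close>

primrec wfc :: "com \<Rightarrow> bool" where
  "wfc Skip \<longleftrightarrow> True"
| "wfc (Push i a) \<longleftrightarrow> i < 4 \<and> a \<noteq> Blank"
| "wfc (Seq c d) \<longleftrightarrow> wfc c \<and> wfc d"
| "wfc (Case i f) \<longleftrightarrow> i < 4 \<and> (\<forall>a. wfc (f a))"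
| "wfc (Loop i f) \<longleftrightarrow> i < 4 \<and> (\<forall>a. wfc (f a))"

text \<open>The stacks are kept on the tape as \<open>Blank s\<^sub>0 Blank s\<^sub>1 Blank s\<^sub>2 Blank s\<^sub>3 Blank\<close>, tops to the left, with the
head resting on the first cell between two instructions. The control state is the list of
commands still to be executed, together with a phase of the current tape operation: \<open>WalkP\<close> and
\<open>WalkD\<close> skip over blanks to the right until the stack addressed by a push or a pop is reached,
\<open>Ins\<close> and \<open>Del\<close> shift the rest of the tape by one cell, and \<open>Back\<close> returns to the first cell.
The numbers count the blanks still to be passed.\<close>

datatype ctl = Acc | Rej | Chk | Run "com list" | WalkP nat nat sym "com list" | Ins nat sym "com list"
  | Back nat "com list" | WalkD nat "com list" | GoEnd nat sym "com list" | Del nat sym sym "com list"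

text \<open>A popping command stays in the control list during the tape operation: its index sets
  the counters of the later phases, and only at the end does it turn the popped symbol into a
  continuation.\<close>

fun idx :: "com list \<Rightarrow> nat" where
  "idx (Case i f # K) = i"
| "idx (Loop i f # K) = i"
| "idx _ = 0"

fun after :: "com list \<Rightarrow> sym \<Rightarrow> com list" where
  "after (Case i f # K) a = f a # K"
| "after (Loop i f # K) a = (if a = Blank then K else f a # Loop i f # K)"
| "after K a = K"

text \<open>The counters come from the five blanks around the four stacks. From stack
  \<open>i\<close> to the end there are \<open>4 - i\<close> delimiters. An insertion ends on the
  cell of the former last delimiter, with four blanks up to and including the head cell. A pop from
  an empty stack \<open>i\<close> ends on its own delimiter, a successful pop on the blank before
  the stack; up to and including the head cell these are \<open>i + 2\<close> and
  \<open>i + 1\<close> blanks.\<close>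

fun delta :: "ctl \<Rightarrow> sym \<Rightarrow> ctl \<times> sym \<times> move" where
  "delta Acc x = (Acc, x, Stay)"
| "delta Rej x = (Rej, x, Stay)"
| "delta Chk x = ((if x = One then Acc else Rej), x, Stay)"
| "delta (Run []) x = (Chk, x, MoveR)"
| "delta (Run (Skip # K)) x = (Run K, x, Stay)"
| "delta (Run (Seq c d # K)) x = (Run (c # d # K), x, Stay)"
| "delta (Run (Push i a # K)) x = (WalkP i (4 - i) a K, x, MoveR)"
| "delta (Run (Case i f # K)) x = (WalkD i (Case i f # K), x, MoveR)"
| "delta (Run (Loop i f # K)) x = (WalkD i (Loop i f # K), x, MoveR)"
| "delta (WalkP j m a K) x =
    (if j = 0 then (Ins m a K, x, Stay) else (WalkP (if x = Blank then j - 1 else j) m a K, x, MoveR))"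
| "delta (Ins m c K) x =
    (if x = Blank \<and> m \<le> 1 then (Back 4 K, c, Stay) else (Ins (if x = Blank then m - 1 else m) x K, c, MoveR))"
| "delta (Back j K) x =
    (if x = Blank then if j \<le> 1 then (Run K, x, Stay) else (Back (j - 1) K, x, MoveL) else (Back j K, x, MoveL))"
| "delta (WalkD j K) x =
    (if j = 0 then if x = Blank then (Back (idx K + 2) (after K Blank), x, Stay) else (GoEnd (4 - idx K) x K, x, MoveR)
     else (WalkD (if x = Blank then j - 1 else j) K, x, MoveR))"
| "delta (GoEnd m a K) x =
    (if x = Blank then if m \<le> 1 then (Del (4 - idx K) Blank a K, x, Stay) else (GoEnd (m - 1) a K, x, MoveR)
     else (GoEnd m a K, x, MoveR))"
| "delta (Del m c a K) x =
    (if x = Blank then if m = 0 then (Back (idx K + 1) (after K a), x, Stay) else (Del (m - 1) Blank a K, c, MoveL)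
     else (Del m x a K, c, MoveL))"

subsection \<open>Finiteness of the control\<close>

text \<open>The control lists that arise from \<open>c # K\<close> before control returns to
  \<open>K\<close>. The recursion is structural, with a loop placed below its own body, so the set
  is finite although loops may run arbitrarily long.\<close>

primrec conts :: "com \<Rightarrow> com list \<Rightarrow> com list set" where
  "conts Skip K = {Skip # K}"
| "conts (Push i a) K = {Push i a # K}"
| "conts (Seq c d) K = {Seq c d # K} \<union> conts c (d # K) \<union> conts d K"
| "conts (Case i f) K = {Case i f # K} \<union> (\<Union>a. conts (f a) K)"
| "conts (Loop i f) K = {Loop i f # K} \<union> (\<Union>a. conts (f a) (Loop i f # K))"

lemma UNIV_sym: "(UNIV :: sym set) = {Blank, Zero, One, Sep}"
  using sym.exhaust by auto

lemma finite_sym: "finite (A :: sym set)"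
  by (rule finite_subset[OF subset_UNIV]) (simp add: UNIV_sym)

lemma finite_conts: "finite (conts c K)"
  by (induction c arbitrary: K) (auto simp: finite_sym)

lemma conts_self: "c # K \<in> conts c K"
  by (cases c) auto

fun succs :: "com list \<Rightarrow> com list set" where
  "succs [] = {}"
| "succs (Skip # K) = {K}"
| "succs (Push i a # K) = {K}"
| "succs (Seq c d # K) = {c # d # K}"
| "succs (Case i f # K) = {f a # K | a. True}"
| "succs (Loop i f # K) = insert K {f a # Loop i f # K | a. True}"

lemma conts_closed: "L \<in> conts c K \<Longrightarrow> succs L \<subseteq> insert K (conts c K)"
proof (induction c arbitrary: K)
  case (Seq c d)
  then consider "L = Seq c d # K" | "L \<in> conts c (d # K)" | "L \<in> conts d K" by auto
  then show ?case
  proof cases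
    case 1
    then show ?thesis using conts_self by auto
  next
    case 2
    then show ?thesis using Seq.IH(1)[OF 2] conts_self[of d K] by auto
  next
    case 3
    then show ?thesis using Seq.IH(2)[OF 3] by auto
  qed
next
  case (Case i f)
  then consider "L = Case i f # K" | a where "L \<in> conts (f a) K" by auto
  then show ?case
  proof cases
    case 1
    then show ?thesis using conts_self by auto
  next
    case 2
    then show ?thesis using Case.IH[OF _ 2] by auto
  qed
next
  case (Loop i f)
  then consider "L = Loop i f # K" | a where "L \<in> conts (f a) (Loop i f # K)" by auto
  then show ?case
  proof cases
    case 1
    then show ?thesis using conts_self by auto
  next
    case 2
    then show ?thesis using Loop.IH[OF _ 2] by auto
  qed
qed auto

text \<open>Only the first command addresses a stack, so the bound on its index is all that the
  counters need.\<close>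

fun hd_ok :: "com list \<Rightarrow> bool" where
  "hd_ok (c # K) = wfc c"
| "hd_ok [] = True"

lemma conts_hd_ok: "wfc c \<Longrightarrow> L \<in> conts c K \<Longrightarrow> hd_ok L"
  by (induction c arbitrary: K) auto

text \<open>No counter exceeds 5, the value of \<open>idx K + 2\<close> for the last stack.\<close>

definition ctls :: "com list set \<Rightarrow> ctl set" where
  "ctls C = {Acc, Rej, Chk} \<union> Run ` C \<union> (\<lambda>(j, m, a, K). WalkP j m a K) ` ({..5} \<times> {..5} \<times> UNIV \<times> C)
    \<union> (\<lambda>(m, a, K). Ins m a K) ` ({..5} \<times> UNIV \<times> C) \<union> (\<lambda>(j, K). Back j K) ` ({..5} \<times> C)
    \<union> (\<lambda>(j, K). WalkD j K) ` ({..5} \<times> C) \<union> (\<lambda>(m, a, K). GoEnd m a K) ` ({..5} \<times> UNIV \<times> C)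
    \<union> (\<lambda>(m, c, a, K). Del m c a K) ` ({..5} \<times> UNIV \<times> UNIV \<times> C)"

lemma finite_ctls: "finite C \<Longrightarrow> finite (ctls C)"
  unfolding ctls_def by (intro finite_UnI finite_imageI finite_SigmaI) (auto simp: finite_sym)

lemma in_ctls:
  "Acc \<in> ctls C" "Rej \<in> ctls C" "Chk \<in> ctls C" "Run K \<in> ctls C \<longleftrightarrow> K \<in> C"
  "WalkP j m a K \<in> ctls C \<longleftrightarrow> j \<le> 5 \<and> m \<le> 5 \<and> K \<in> C"
  "Ins m a K \<in> ctls C \<longleftrightarrow> m \<le> 5 \<and> K \<in> C"
  "Back j K \<in> ctls C \<longleftrightarrow> j \<le> 5 \<and> K \<in> C"
  "WalkD j K \<in> ctls C \<longleftrightarrow> j \<le> 5 \<and> K \<in> C"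
  "GoEnd m a K \<in> ctls C \<longleftrightarrow> m \<le> 5 \<and> K \<in> C"
  "Del m c a K \<in> ctls C \<longleftrightarrow> m \<le> 5 \<and> K \<in> C"
  by (auto simp: ctls_def image_iff)

lemma delta_closed:
  assumes C: "\<And>K. K \<in> C \<Longrightarrow> succs K \<subseteq> C" and ok: "\<And>K. K \<in> C \<Longrightarrow> hd_ok K"
    and q: "q \<in> ctls C"
  shows "fst (delta q x) \<in> ctls C"
proof -
  have idx: "idx K \<le> 3" if "K \<in> C" for K
    using ok[OF that] by (cases K rule: idx.cases) auto
  have aft: "after K a \<in> C" if "K \<in> C" for K a
    using C[OF that] that by (cases "(K, a)" rule: after.cases) (auto split: if_splits)
  show ?thesis
  proof (cases q)
    case (Run K)
    then have K: "K \<in> C" using q by (simp add: in_ctls)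
    then show ?thesis using Run ok[OF K] C[OF K] by (cases K rule: succs.cases) (auto simp: in_ctls)
  next
    case (WalkD j K)
    then have K: "K \<in> C" "j \<le> 5" using q by (simp_all add: in_ctls)
    then show ?thesis using WalkD idx[OF K(1)] aft[OF K(1)] by (auto simp: in_ctls)
  next
    case (GoEnd m a K)
    then have K: "K \<in> C" "m \<le> 5" using q by (simp_all add: in_ctls)
    then show ?thesis using GoEnd idx[OF K(1)] aft[OF K(1)] by (auto simp: in_ctls)
  next
    case (Del m c a K)
    then have K: "K \<in> C" "m \<le> 5" using q by (simp_all add: in_ctls)
    then show ?thesis using Del idx[OF K(1)] aft[OF K(1)] by (auto simp: in_ctls)
  qed (use q in \<open>auto simp: in_ctls\<close>)
qed

subsection \<open>Correctness of the tape operations\<close>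

definition lay :: "sym list list \<Rightarrow> sym list" where
  "lay ss = concat (map (\<lambda>s. s @ [Blank]) ss)"

lemma lay_simps [simp]: "lay [] = []" "lay (s # ss) = s @ Blank # lay ss" "lay (xs @ ys) = lay xs @ lay ys"
  by (simp_all add: lay_def)

definition okl :: "sym list list \<Rightarrow> bool" where
  "okl ss \<longleftrightarrow> (\<forall>s\<in>set ss. Blank \<notin> set s)"

lemma okl_simps [simp]: "okl []" "okl (s # ss) \<longleftrightarrow> Blank \<notin> set s \<and> okl ss" "okl (xs @ ys) \<longleftrightarrow> okl xs \<and> okl ys"
  by (auto simp: okl_def)

lemma count_lay: "okl ss \<Longrightarrow> count_list (lay ss) Blank = length ss"
  by (induction ss) (auto simp: count_list_0_iff)

section \<open>Single phases of the tape operations\<close>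

definition steps :: "nat \<Rightarrow> ctl \<times> sym list \<times> sym list \<Rightarrow> ctl \<times> sym list \<times> sym list \<Rightarrow> bool" where
  "steps n c c' \<longleftrightarrow> (gstep delta ^^ n) c = c'"

lemma steps_refl: "steps 0 c c"
  by (simp add: steps_def)

lemma steps_trans: "steps n c c' \<Longrightarrow> steps m c' c'' \<Longrightarrow> steps (n + m) c c''"
  by (simp add: steps_def funpow_add add.commute[of n m])

lemma steps_Suc: "steps n (gstep delta c) c' \<Longrightarrow> steps (Suc n) c c'"
  by (simp add: steps_def funpow_Suc_right del: funpow.simps)

lemma steps_1I: "gstep delta c = c' \<Longrightarrow> steps (Suc 0) c c'"
  by (simp add: steps_def)

lemmas gs = gstep_def Let_def

text \<open>Pushes and pops walk in the same way; \<open>W\<close> stands for either family of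
  states.\<close>

lemma walk:
  assumes W: "\<And>j x. delta (W (Suc j)) x = (W (if x = Blank then j else Suc j), x, MoveR)"
  shows "okl us \<Longrightarrow> steps (length (lay us)) (W (length us), ls, lay us @ r) (W 0, rev (lay us) @ ls, r)"
proof (induction us arbitrary: ls)
  case (Cons s us)
  have 1: "Blank \<notin> set s \<Longrightarrow> steps (length s) (W (Suc j), ls, s @ r) (W (Suc j), rev s @ ls, r)" for s j ls r
    by (induction s arbitrary: ls) (auto simp: steps_refl gs W intro!: steps_Suc)
  have 2: "steps (Suc 0) (W (Suc (length us)), rev s @ ls, Blank # lay us @ r)
      (W (length us), Blank # rev s @ ls, lay us @ r)"
    by (rule steps_1I) (simp add: gs W)
  show ?case using steps_trans[OF steps_trans[OF 1 2] Cons.IH] Cons.prems by simp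
qed (simp add: steps_refl)

lemma walkP: "okl us \<Longrightarrow>
  steps (length (lay us)) (WalkP (length us) m a K, ls, lay us @ r) (WalkP 0 m a K, rev (lay us) @ ls, r)"
  by (rule walk[where W = "\<lambda>j. WalkP j m a K"]) simp_all

lemma walkD: "okl us \<Longrightarrow>
  steps (length (lay us)) (WalkD (length us) K, ls, lay us @ r) (WalkD 0 K, rev (lay us) @ ls, r)"
  by (rule walk[where W = "\<lambda>j. WalkD j K"]) simp_all

lemma goEnd: "Z \<noteq> [] \<Longrightarrow> last Z = Blank \<Longrightarrow>
  steps (length Z) (GoEnd (count_list Z Blank) a K, ls, Z @ r) (Del (4 - idx K) Blank a K, rev (butlast Z) @ ls, Blank # r)"
proof (induction Z arbitrary: ls)
  case (Cons x Z)
  show ?case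
  proof (cases "Z = []")
    case True
    then show ?thesis using Cons.prems by (auto intro!: steps_1I simp: gs)
  next
    case False
    then have "last Z = Blank" using Cons.prems by simp
    then have "Blank \<in> set Z" using False last_in_set by metis
    then have c: "count_list Z Blank \<ge> 1" using count_list_0_iff[of Z Blank] by linarith
    show ?thesis using Cons.IH[OF False \<open>last Z = Blank\<close>, of "x # ls"] False c
      by (auto intro!: steps_Suc simp: gs)
  qed
qed simp

lemma ins: "Z \<noteq> [] \<Longrightarrow> last Z = Blank \<Longrightarrow>
  steps (length Z) (Ins (count_list Z Blank) c K, ls, Z @ r)
    (Back 4 K, rev (butlast (c # butlast Z)) @ ls, last (c # butlast Z) # r)"
proof (induction Z arbitrary: ls c)
  case (Cons x Z)
  show ?case
  proof (cases "Z = []")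
    case True
    then show ?thesis using Cons.prems by (auto intro!: steps_1I simp: gs)
  next
    case False
    then have "last Z = Blank" using Cons.prems by simp
    then have "Blank \<in> set Z" using False last_in_set by metis
    then have cn: "count_list Z Blank \<ge> 1" using count_list_0_iff[of Z Blank] by linarith
    show ?thesis using Cons.IH[OF False \<open>last Z = Blank\<close>, of x "c # ls"] False cn
      by (auto intro!: steps_Suc simp: gs)
  qed
qed simp

text \<open>Induction from the right follows the head, which starts on the last cell. The additional
  1 in the counter is the blank in the first cell.\<close>

lemma back_run: "steps (Suc (length Y))
  (Back (Suc (count_list Y Blank)) K, rev (butlast (Blank # Y)), last (Blank # Y) # r) (Run K, [], Blank # Y @ r)"
proof (induction Y arbitrary: r rule: rev_induct)
  case Nil
  then show ?case by (auto intro!: steps_1I simp: gs)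
next
  case (snoc y Y)
  obtain u z where u: "Blank # Y = u @ [z]" by (metis append_butlast_last_id list.distinct(1))
  then have "Blank # Y @ [y] = (u @ [z]) @ [y]" by simp
  then have "butlast (Blank # Y @ [y]) = u @ [z]" "last (Blank # Y @ [y]) = y"
    by (simp_all only: butlast_snoc last_snoc)
  moreover have "butlast (Blank # Y) = u" "last (Blank # Y) = z"
    using u by (simp_all only: butlast_snoc last_snoc)
  ultimately have 1: "gstep delta (Back (Suc (count_list (Y @ [y]) Blank)) K, rev (butlast (Blank # Y @ [y])), last (Blank # Y @ [y]) # r)
     = (Back (Suc (count_list Y Blank)) K, rev (butlast (Blank # Y)), last (Blank # Y) # y # r)"
    by (simp only:) (simp add: gs)
  show ?case using steps_Suc[OF snoc[of "y # r", folded 1]] by (simp del: butlast.simps last.simps)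
qed

lemma del_run: "Z \<noteq> [] \<Longrightarrow>
  steps (length Z) (Del (count_list Z Blank) c a K, rev (butlast Z) @ l # ls, last Z # r)
    (Del 0 (hd Z) a K, ls, l # tl Z @ c # r)"
proof (induction Z arbitrary: r c rule: rev_induct)
  case (snoc y Y)
  show ?case
  proof (cases "Y = []")
    case True
    then show ?thesis by (auto intro!: steps_1I simp: gs)
  next
    case False
    then obtain u z where u: "Y = u @ [z]" by (metis append_butlast_last_id)
    have 1: "gstep delta (Del (count_list (Y @ [y]) Blank) c a K, rev (butlast (Y @ [y])) @ l # ls, last (Y @ [y]) # r)
     = (Del (count_list Y Blank) y a K, rev (butlast Y) @ l # ls, last Y # c # r)"
      unfolding u by (simp add: gs butlast_append)
    show ?thesis using snoc(1)[OF False, of y "c # r"] 1 False by (auto intro!: steps_Suc)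
  qed
qed simp

text \<open>The resting configuration. \<open>N\<close> counts the spare blanks written out behind
  the stacks: a push consumes one and a successful pop returns one.\<close>

definition home :: "com list \<Rightarrow> sym list list \<Rightarrow> nat \<Rightarrow> ctl \<times> sym list \<times> sym list" where
  "home K ss N = (Run K, [], Blank # lay ss @ replicate N Blank)"

lemma back_home:
  assumes "Z = Blank # Y" "j = count_list Z Blank" "Z = u @ [x]"
  shows "steps (length Z) (Back j K, rev u, x # r) (Run K, [], Z @ r)"
proof -
  have "u = butlast (Blank # Y)" "x = last (Blank # Y)" using assms by (metis butlast_snoc, metis last_snoc)
  then show ?thesis using back_run[of Y K r] assms by simp
qed

lemma lay_Nil: "lay ss = [] \<longleftrightarrow> ss = []"
  by (cases ss) auto

lemma last_lay: "ss \<noteq> [] \<Longrightarrow> last (lay ss) = Blank"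
  by (induction ss) (auto simp: lay_Nil)

lemma ins_home:
  assumes ok: "okl us" "okl (s # vs)" and len: "length us + length (s # vs) = 4" and c: "c \<noteq> Blank"
  shows "\<exists>t \<le> 2 * length (lay (us @ s # vs)) + 4.
    steps t (Ins (length (s # vs)) c K, rev (lay us) @ [Blank], lay (s # vs) @ Blank # r)
      (Run K, [], Blank # lay (us @ (c # s) # vs) @ r)"
proof -
  let ?Z = "lay (s # vs)"
  have L: "last ?Z = Blank" "?Z \<noteq> []" by (rule last_lay) simp_all
  let ?W = "c # butlast ?Z"
  have 1: "steps (length ?Z) (Ins (length (s # vs)) c K, rev (lay us) @ [Blank], ?Z @ Blank # r)
    (Back 4 K, rev (butlast ?W) @ rev (lay us) @ [Blank], last ?W # Blank # r)"
    using ins[OF L(2,1), of c K "rev (lay us) @ [Blank]" "Blank # r"] count_lay[OF ok(2)] by simp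
  let ?U = "Blank # lay us @ ?W"
  \<comment> \<open>The shifted text overwrites the final delimiter, and the first spare blank takes
    over its role.\<close>
  have Z: "butlast ?Z @ [Blank] = ?Z" using L append_butlast_last_id by metis
  have "count_list (butlast ?Z @ [Blank]) Blank = length (s # vs)" unfolding Z using count_lay[OF ok(2)] by simp
  then have cn: "count_list ?U Blank = 4" using count_lay[OF ok(1)] len c by simp
  have U: "?U = (Blank # lay us @ butlast ?W) @ [last ?W]"
    using append_butlast_last_id[of ?W] by simp
  have 2: "steps (length ?U) (Back 4 K, rev (Blank # lay us @ butlast ?W), last ?W # Blank # r)
    (Run K, [], ?U @ Blank # r)"
    by (rule back_home[OF refl cn[symmetric] U])
  have e1: "rev (Blank # lay us @ butlast ?W) = rev (butlast ?W) @ rev (lay us) @ [Blank]" by simp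
  have "?U @ Blank # r = Blank # lay us @ c # (butlast ?Z @ [Blank]) @ r" by simp
  also have "\<dots> = Blank # lay (us @ (c # s) # vs) @ r" unfolding Z by simp
  finally have e2: "?U @ Blank # r = Blank # lay (us @ (c # s) # vs) @ r" .
  have "length ?Z + length ?U \<le> 2 * length (lay (us @ s # vs)) + 4" by simp
  then show ?thesis using steps_trans[OF 1 2[unfolded e1 e2]] by blast
qed

section \<open>Push and pop on the tape\<close>

lemma push_step:
  assumes ok: "okl ss" and len: "length ss = 4" and i: "i < 4" and a: "a \<noteq> Blank"
  shows "\<exists>t \<le> 3 * length (lay ss) + 6. steps t (home (Push i a # K) ss (Suc N)) (home K (ss[i := a # ss ! i]) N)"
proof -
  let ?us = "take i ss" and ?s = "ss ! i" and ?vs = "drop (Suc i) ss"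
  have ss: "ss = ?us @ ?s # ?vs" using id_take_nth_drop[of i ss] len i by simp
  then have okp: "okl ?us" "okl (?s # ?vs)" using ok by (metis okl_simps(3))+
  have lus: "length ?us = i" using len i by simp
  have l4: "length (?s # ?vs) = 4 - i" using len i by simp
  have 1: "steps (Suc 0) (home (Push i a # K) ss (Suc N)) (WalkP i (4 - i) a K, [Blank], lay ss @ replicate (Suc N) Blank)"
    by (rule steps_1I) (simp add: home_def gs)
  have lay: "lay ss @ replicate (Suc N) Blank = lay ?us @ lay (?s # ?vs) @ Blank # replicate N Blank"
    by (subst ss) simp
  have 2: "steps (length (lay ?us)) (WalkP i (4 - i) a K, [Blank], lay ss @ replicate (Suc N) Blank)
    (WalkP 0 (4 - i) a K, rev (lay ?us) @ [Blank], lay (?s # ?vs) @ Blank # replicate N Blank)"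
    using walkP[OF okp(1), of "4 - i" a K "[Blank]" "lay (?s # ?vs) @ Blank # replicate N Blank"] lus lay by simp
  have 3: "steps (Suc 0) (WalkP 0 (4 - i) a K, rev (lay ?us) @ [Blank], lay (?s # ?vs) @ Blank # replicate N Blank)
    (Ins (4 - i) a K, rev (lay ?us) @ [Blank], lay (?s # ?vs) @ Blank # replicate N Blank)"
    by (rule steps_1I) (cases ?s; simp add: gs)
  have "length ?us + length (?s # ?vs) = 4" using lus l4 i by simp
  from ins_home[OF okp this a, of K "replicate N Blank"] l4 ss obtain t where
    t: "t \<le> 2 * length (lay ss) + 4" and
    4: "steps t (Ins (4 - i) a K, rev (lay ?us) @ [Blank], lay (?s # ?vs) @ Blank # replicate N Blank)
     (Run K, [], Blank # lay (?us @ (a # ?s) # ?vs) @ replicate N Blank)" by metis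
  have upd: "ss[i := a # ss ! i] = ?us @ (a # ?s) # ?vs" using len i by (simp add: upd_conv_take_nth_drop)
  have "length (lay ?us) \<le> length (lay ss)" by (subst (2) ss) simp
  then have "Suc 0 + length (lay ?us) + Suc 0 + t \<le> 3 * length (lay ss) + 6" using t by simp
  moreover have "steps (Suc 0 + length (lay ?us) + Suc 0 + t) (home (Push i a # K) ss (Suc N)) (home K (ss[i := a # ss ! i]) N)"
    using steps_trans[OF steps_trans[OF steps_trans[OF 1 2] 3] 4] upd by (simp add: home_def)
  ultimately show ?thesis by blast
qed

lemma pop_step:
  assumes ok: "okl ss" and len: "length ss = 4" and i: "i < 4" and idx: "idx K = i"
    and R: "delta (Run K) Blank = (WalkD i K, Blank, MoveR)"
  shows "\<exists>t \<le> 6 * length (lay ss) + 12. \<exists>N' \<ge> N. steps t (home K ss N) (home (after K (peek (ss ! i))) (ss[i := tl (ss ! i)]) N')"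
proof -
  let ?us = "take i ss" and ?s = "ss ! i" and ?vs = "drop (Suc i) ss"
  have ss: "ss = ?us @ ?s # ?vs" using id_take_nth_drop[of i ss] len i by simp
  then have okp: "okl ?us" "okl (?s # ?vs)" using ok by (metis okl_simps(3))+
  have lus: "length ?us = i" using len i by simp
  have l4: "length (?s # ?vs) = 4 - i" using len i by simp
  have 1: "steps (Suc 0) (home K ss N) (WalkD i K, [Blank], lay ss @ replicate N Blank)"
    using R by (intro steps_1I) (simp add: home_def gs)
  have lay: "lay ss @ replicate N Blank = lay ?us @ lay (?s # ?vs) @ replicate N Blank"
    by (subst ss) simp
  have 2: "steps (length (lay ?us)) (WalkD i K, [Blank], lay ss @ replicate N Blank)
    (WalkD 0 K, rev (lay ?us) @ [Blank], lay (?s # ?vs) @ replicate N Blank)"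
    using walkD[OF okp(1), of K "[Blank]" "lay (?s # ?vs) @ replicate N Blank"] lus lay by simp
  have ll: "length (lay ss) = length (lay ?us) + length (lay (?s # ?vs))" by (subst ss) simp
  show ?thesis
  proof (cases ?s)
    case Nil
    have 3: "steps (Suc 0) (WalkD 0 K, rev (lay ?us) @ [Blank], lay (?s # ?vs) @ replicate N Blank)
      (Back (i + 2) (after K Blank), rev (lay ?us) @ [Blank], Blank # lay ?vs @ replicate N Blank)"
      using Nil idx by (intro steps_1I) (simp add: gs)
    have 4: "steps (length (Blank # lay ?us @ [Blank])) (Back (i + 2) (after K Blank), rev (Blank # lay ?us), Blank # lay ?vs @ replicate N Blank)
      (Run (after K Blank), [], (Blank # lay ?us @ [Blank]) @ lay ?vs @ replicate N Blank)"
      using count_lay[OF okp(1)] lus by (intro back_home) auto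
    have upd: "ss[i := tl (ss ! i)] = ss" using Nil by (metis list.sel(2) list_update_id)
    have e: "(Blank # lay ?us @ [Blank]) @ lay ?vs @ replicate N Blank = Blank # lay ss @ replicate N Blank"
      using lay Nil by simp
    have "steps (Suc 0 + length (lay ?us) + Suc 0 + length (Blank # lay ?us @ [Blank])) (home K ss N)
       (home (after K (peek (ss ! i))) (ss[i := tl (ss ! i)]) N)"
      using steps_trans[OF steps_trans[OF steps_trans[OF 1 2] 3] 4[unfolded rev.simps e]]
      unfolding upd by (simp only: home_def Nil peek.simps)
    moreover have "Suc 0 + length (lay ?us) + Suc 0 + length (Blank # lay ?us @ [Blank]) \<le> 6 * length (lay ss) + 12"
      using ll by simp
    ultimately show ?thesis by blast
  next
    case (Cons a s)
    then have a: "a \<noteq> Blank" using okp(2) by auto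
    let ?V = "lay (s # ?vs)" and ?r = "replicate N Blank"
    have okV: "okl (s # ?vs)" using okp(2) Cons by simp
    have cV: "count_list ?V Blank = 4 - i" using count_lay[OF okV] l4 by simp
    have 3: "steps (Suc 0) (WalkD 0 K, rev (lay ?us) @ [Blank], lay (?s # ?vs) @ ?r)
      (GoEnd (4 - i) a K, a # rev (lay ?us) @ [Blank], ?V @ ?r)"
      using Cons idx a by (intro steps_1I) (simp add: gs)
    have Vn: "?V \<noteq> []" by simp
    have Vl: "last ?V = Blank" by (rule last_lay) simp
    have 4: "steps (length ?V) (GoEnd (4 - i) a K, a # rev (lay ?us) @ [Blank], ?V @ ?r)
      (Del (4 - i) Blank a K, rev (butlast ?V) @ a # rev (lay ?us) @ [Blank], Blank # ?r)"
      using goEnd[OF Vn Vl, of a K "a # rev (lay ?us) @ [Blank]" ?r] cV idx by simp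
    obtain l ls where l: "rev (Blank # lay ?us) = l # ls" "l = Blank"
    proof -
      have "last (Blank # lay ?us) = Blank" using last_lay[of ?us] by (simp add: lay_Nil)
      then have "hd (rev (Blank # lay ?us)) = Blank" by (simp only: hd_rev)
      then show ?thesis using that by (cases "rev (Blank # lay ?us)") auto
    qed
    have 5: "steps (length (a # ?V)) (Del (4 - i) Blank a K, rev (butlast ?V) @ a # rev (lay ?us) @ [Blank], Blank # ?r)
      (Del 0 a a K, ls, l # ?V @ Blank # ?r)"
      using del_run[of "a # ?V" Blank a K l ls ?r] Vl cV a l(1) by auto
    have 6: "steps (Suc 0) (Del 0 a a K, ls, l # ?V @ Blank # ?r) (Back (i + 1) (after K a), ls, Blank # ?V @ Blank # ?r)"
      using l idx by (intro steps_1I) (simp add: gs)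
    have lr: "Blank # lay ?us = rev ls @ [Blank]" using l by (metis rev.simps(2) rev_rev_ident)
    have 7: "steps (length (Blank # lay ?us)) (Back (i + 1) (after K a), rev (rev ls), Blank # ?V @ Blank # ?r)
      (Run (after K a), [], (Blank # lay ?us) @ ?V @ Blank # ?r)"
      using count_lay[OF okp(1)] lus by (intro back_home[OF refl _ lr]) auto
    have upd: "ss[i := tl (ss ! i)] = ?us @ s # ?vs" using len i Cons by (simp add: upd_conv_take_nth_drop)
    have e: "(Blank # lay ?us) @ ?V @ Blank # ?r = Blank # lay (?us @ s # ?vs) @ replicate (Suc N) Blank"
      by simp
    have "steps (Suc 0 + length (lay ?us) + Suc 0 + length ?V + length (a # ?V) + Suc 0 + length (Blank # lay ?us)) (home K ss N)
       (home (after K (peek (ss ! i))) (ss[i := tl (ss ! i)]) (Suc N))"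
      using steps_trans[OF steps_trans[OF steps_trans[OF steps_trans[OF steps_trans[OF steps_trans[OF 1 2] 3] 4] 5] 6] 7[unfolded rev_rev_ident e]]
      unfolding upd by (simp only: home_def Cons peek.simps)
    moreover have "Suc 0 + length (lay ?us) + Suc 0 + length ?V + length (a # ?V) + Suc 0 + length (Blank # lay ?us) \<le> 6 * length (lay ss) + 12"
      using ll Cons by simp
    ultimately show ?thesis using le_SucI by blast
  qed
qed

lemma length_lay_update: "i < length ss \<Longrightarrow> length (lay (ss[i := s])) + length (ss ! i) = length (lay ss) + length s"
proof -
  assume i: "i < length ss"
  then have "length (lay ss) = length (lay (take i ss @ ss ! i # drop (Suc i) ss))"
    using id_take_nth_drop[of i ss] by simp
  then show ?thesis using i by (simp add: upd_conv_take_nth_drop)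
qed

lemma okl_update: "okl ss \<Longrightarrow> Blank \<notin> set s \<Longrightarrow> okl (ss[i := s])"
  using set_update_subset_insert[of ss i s] unfolding okl_def by fastforce

lemma okl_nth: "okl ss \<Longrightarrow> i < length ss \<Longrightarrow> Blank \<notin> set (ss ! i)"
  by (simp add: okl_def)

lemma not_in_tl: "x \<notin> set s \<Longrightarrow> x \<notin> set (tl s)"
  by (cases s) auto

text \<open>An instruction lengthens the stacks by at most one symbol, so \<open>W\<close> bounds
  every intermediate tape and each of the \<open>n\<close> instructions costs time linear in
  \<open>W\<close>. At least \<open>n\<close> spare blanks are provided because each instruction
  consumes at most one.\<close>

theorem exec_simulation:
  assumes "exec c s n s'" "wfc c" "okl s" "length s = 4" "length (lay s) + n \<le> W" "n \<le> N"
  shows "okl s' \<and> length s' = 4 \<and> length (lay s') \<le> length (lay s) + n \<and>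
    (\<exists>t \<le> n * (6 * W + 12). \<exists>N'. N \<le> N' + n \<and> steps t (home (c # K) s N) (home K s' N'))"
  using assms
proof (induction arbitrary: K N rule: exec.induct)
  case (Skip s)
  have "steps (Suc 0) (home (Skip # K) s N) (home K s N)"
    by (rule steps_1I) (simp add: home_def gs)
  then have "\<exists>t \<le> 1 * (6 * W + 12). \<exists>N'. N \<le> N' + 1 \<and> steps t (home (Skip # K) s N) (home K s N')"
    by (intro exI[of _ "Suc 0"] conjI exI[of _ N]) simp_all
  then show ?case using Skip by simp
next
  case (Push i a s)
  then obtain N1 where N: "N = Suc N1" by (cases N) auto
  have i: "i < 4" and a: "a \<noteq> Blank" using Push by auto
  obtain t where t: "t \<le> 3 * length (lay s) + 6" "steps t (home (Push i a # K) s N) (home K (s[i := a # s ! i]) N1)"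
    using push_step[OF Push(2,3) i a, of K N1] N by blast
  have "okl (s[i := a # s ! i])" using Push a by (intro okl_update) (auto simp: okl_nth)
  moreover have "length (lay (s[i := a # s ! i])) = Suc (length (lay s))"
    using length_lay_update[of i s "a # s ! i"] i Push by simp
  moreover have "\<exists>t \<le> 1 * (6 * W + 12). \<exists>N'. N \<le> N' + 1 \<and> steps t (home (Push i a # K) s N) (home K (s[i := a # s ! i]) N')"
    using t Push N by (intro exI[of _ t] conjI exI[of _ N1]) simp_all
  ultimately show ?case using Push by simp
next
  case (Seq c s n s' d m s'')
  have 1: "steps (Suc 0) (home (Seq c d # K) s N) (home (c # d # K) s N)"
    by (rule steps_1I) (simp add: home_def gs)
  from Seq.IH(1)[of N "d # K"] Seq.prems obtain t1 N1 where
    A: "okl s'" "length s' = 4" "length (lay s') \<le> length (lay s) + n" "t1 \<le> n * (6 * W + 12)" "N \<le> N1 + n"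
     "steps t1 (home (c # d # K) s N) (home (d # K) s' N1)" by auto
  from Seq.IH(2)[of N1 K] Seq.prems A obtain t2 N2 where
    B: "okl s''" "length s'' = 4" "length (lay s'') \<le> length (lay s') + m" "t2 \<le> m * (6 * W + 12)" "N1 \<le> N2 + m"
     "steps t2 (home (d # K) s' N1) (home K s'' N2)" by auto
  have "steps (Suc 0 + t1 + t2) (home (Seq c d # K) s N) (home K s'' N2)"
    using steps_trans[OF steps_trans[OF 1 A(6)] B(6)] .
  moreover have "Suc 0 + t1 + t2 \<le> (n + m + 1) * (6 * W + 12)" using A(4) B(4) by (simp add: algebra_simps)
  moreover have "N \<le> N2 + (n + m + 1)" using A(5) B(5) by simp
  ultimately have "\<exists>t \<le> (n + m + 1) * (6 * W + 12). \<exists>N'. N \<le> N' + (n + m + 1) \<and> steps t (home (Seq c d # K) s N) (home K s'' N')"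
    by blast
  then show ?case using A(3) B(1-3) by simp
next
  case (Case f s i n s')
  have i: "i < 4" "wfc (f (peek (s ! i)))" using Case.prems by auto
  obtain t N0 where t: "t \<le> 6 * length (lay s) + 12" "N \<le> N0"
    "steps t (home (Case i f # K) s N) (home (f (peek (s ! i)) # K) (s[i := tl (s ! i)]) N0)"
    using pop_step[OF Case.prems(2,3) i(1), of "Case i f # K" N] by auto
  have ok: "okl (s[i := tl (s ! i)])" using Case.prems i okl_nth[of s i] by (intro okl_update not_in_tl) auto
  have len: "length (lay (s[i := tl (s ! i)])) \<le> length (lay s)"
    using length_lay_update[of i s "tl (s ! i)"] i Case.prems by simp
  from Case.IH[of N0 K] Case.prems i ok len t obtain t1 N1 where
    A: "okl s'" "length s' = 4" "length (lay s') \<le> length (lay s) + n" "t1 \<le> n * (6 * W + 12)" "N0 \<le> N1 + n"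
     "steps t1 (home (f (peek (s ! i)) # K) (s[i := tl (s ! i)]) N0) (home K s' N1)" by auto
  have "steps (t + t1) (home (Case i f # K) s N) (home K s' N1)"
    using steps_trans[OF t(3) A(6)] .
  moreover have "t + t1 \<le> (n + 1) * (6 * W + 12)" using A(4) t(1) Case.prems by (simp add: algebra_simps)
  moreover have "N \<le> N1 + (n + 1)" using A(5) t by simp
  ultimately have "\<exists>t \<le> (n + 1) * (6 * W + 12). \<exists>N'. N \<le> N' + (n + 1) \<and> steps t (home (Case i f # K) s N) (home K s' N')"
    by blast
  then show ?case using A(1-3) len by simp
next
  case (LoopE s i f)
  have i: "i < 4" using LoopE.prems by auto
  obtain t N0 where t: "t \<le> 6 * length (lay s) + 12" "N \<le> N0"
    "steps t (home (Loop i f # K) s N) (home K (s[i := tl (s ! i)]) N0)"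
    using pop_step[OF LoopE.prems(2,3) i(1), of "Loop i f # K" N] LoopE by auto
  have "s[i := tl (s ! i)] = s" using LoopE by (metis list.sel(2) list_update_id)
  then have "\<exists>t \<le> 1 * (6 * W + 12). \<exists>N'. N \<le> N' + 1 \<and> steps t (home (Loop i f # K) s N) (home K s N')"
    using t LoopE.prems by (intro exI[of _ t] conjI exI[of _ N0]) simp_all
  then show ?case using LoopE.prems by simp
next
  case (LoopS s i a r f n s' m s'')
  have i: "i < 4" "wfc (f a)" using LoopS.prems by auto
  have a: "a \<noteq> Blank" "Blank \<notin> set r" using okl_nth[OF LoopS.prems(2), of i] i LoopS by auto
  obtain t N0 where t: "t \<le> 6 * length (lay s) + 12" "N \<le> N0"
    "steps t (home (Loop i f # K) s N) (home (f a # Loop i f # K) (s[i := r]) N0)"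
    using pop_step[OF LoopS.prems(2,3) i(1), of "Loop i f # K" N] LoopS.hyps(1) a by auto
  have ok: "okl (s[i := r])" using LoopS.prems a by (intro okl_update)
  have len: "length (lay (s[i := r])) \<le> length (lay s)"
    using length_lay_update[of i s r] i LoopS by simp
  from LoopS.IH(1)[of N0 "Loop i f # K"] LoopS.prems i ok len t obtain t1 N1 where
    A: "okl s'" "length s' = 4" "length (lay s') \<le> length (lay s) + n" "t1 \<le> n * (6 * W + 12)" "N0 \<le> N1 + n"
     "steps t1 (home (f a # Loop i f # K) (s[i := r]) N0) (home (Loop i f # K) s' N1)" by auto
  from LoopS.IH(2)[of N1 K] LoopS.prems A t obtain t2 N2 where
    B: "okl s''" "length s'' = 4" "length (lay s'') \<le> length (lay s') + m" "t2 \<le> m * (6 * W + 12)" "N1 \<le> N2 + m"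
     "steps t2 (home (Loop i f # K) s' N1) (home K s'' N2)" by auto
  have "steps (t + t1 + t2) (home (Loop i f # K) s N) (home K s'' N2)"
    using steps_trans[OF steps_trans[OF t(3) A(6)] B(6)] .
  moreover have "t + t1 + t2 \<le> (n + m + 1) * (6 * W + 12)" using t A(4) B(4) LoopS.prems by (simp add: algebra_simps)
  moreover have "N \<le> N2 + (n + m + 1)" using A(5) B(5) t by simp
  ultimately have "\<exists>t \<le> (n + m + 1) * (6 * W + 12). \<exists>N'. N \<le> N' + (n + m + 1) \<and> steps t (home (Loop i f # K) s N) (home K s'' N')"
    by blast
  then show ?case using A(3) B(1-3) len by simp
qed

text \<open>Inserting one blank in front of the input, with the shift running as far as the fourth
  blank behind it, already produces the layout with the input on stack 0. So the machine can start
  in an \<open>Ins\<close> phase.\<close>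

lemma init_run:
  assumes "Blank \<notin> set x"
  shows "steps (2 * length x + 8) (Ins 4 Blank K, [], x @ replicate (N + 5) Blank) (home K [x, [], [], []] N)"
proof -
  let ?Y = "x @ [Blank, Blank, Blank]" and ?r = "replicate (Suc N) Blank"
  have c: "count_list (?Y @ [Blank]) Blank = 4" "count_list ?Y Blank = 3" using assms by (simp_all add: count_list_0_iff)
  have Suc3: "Suc 3 = 4" by simp
  have 1: "steps (length (?Y @ [Blank])) (Ins 4 Blank K, [], (?Y @ [Blank]) @ ?r)
    (Back 4 K, rev (butlast (Blank # ?Y)), last (Blank # ?Y) # ?r)"
    using ins[of "?Y @ [Blank]" Blank K "[]" ?r] unfolding c butlast_snoc append_Nil2 by simp
  have 2: "steps (Suc (length ?Y)) (Back 4 K, rev (butlast (Blank # ?Y)), last (Blank # ?Y) # ?r)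
    (Run K, [], Blank # ?Y @ ?r)"
    using back_run[of ?Y K ?r, unfolded c(2)] by (simp only: Suc3)
  have e: "(?Y @ [Blank]) @ ?r = x @ replicate (N + 5) Blank"
    by (simp add: eval_nat_numeral)
  have e2: "Blank # ?Y @ ?r = Blank # lay [x, [], [], []] @ replicate N Blank"
    by simp
  have e3: "length (?Y @ [Blank]) + Suc (length ?Y) = 2 * length x + 8" by simp
  show ?thesis using steps_trans[OF 1 2] unfolding e e2 e3 home_def .
qed

definition computes_bool :: "com \<Rightarrow> (sym list \<Rightarrow> bool) \<Rightarrow> bool" where
  "computes_bool c f \<longleftrightarrow> wfc c \<and> (\<exists>k. \<forall>x. Blank \<notin> set x \<longrightarrow>
     (\<exists>n s. n \<le> (length x + 2) ^ k \<and> exec c [x, [], [], []] n s \<and> (f x \<longleftrightarrow> peek (s ! 0) = One)))"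

theorem stack_program_to_tm:
  assumes "computes_bool p f"
  obtains M c d where "tm_wf M" "\<And>x. Blank \<notin> set x \<Longrightarrow> decides_within M (c * length x ^ d + c) x (f x)"
proof -
  obtain k where wf: "wfc p" and ex: "\<And>x. Blank \<notin> set x \<Longrightarrow>
     \<exists>n s. n \<le> (length x + 2) ^ k \<and> exec p [x, [], [], []] n s \<and> (f x \<longleftrightarrow> peek (s ! 0) = One)"
    using assms unfolding computes_bool_def by blast
  define C where "C = insert [] (conts p [])"
  have C: "succs K \<subseteq> C" if "K \<in> C" for K
    using that conts_closed[of K p "[]"] by (auto simp: C_def)
  have ok: "hd_ok K" if "K \<in> C" for K
    using that conts_hd_ok[OF wf] by (auto simp: C_def)
  have pC: "[p] \<in> C" using conts_self by (auto simp: C_def)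
  obtain M where M: "tm_wf M" "\<And>t x ans. fst ((gstep delta ^^ t) (Ins 4 Blank [p], [], x)) = (if ans then Acc else Rej)
      \<Longrightarrow> decides_within M t x ans"
    by (rule finite_machine_to_tm[of "ctls C" delta "Ins 4 Blank [p]" Acc Rej])
      (use finite_ctls[of C] finite_conts delta_closed[OF C ok] pC in \<open>auto simp: in_ctls C_def\<close>)
  define c d :: nat where "c = 200 * 3 ^ (2 * k)" and "d = 2 * k + 2"
  have "decides_within M (c * length x ^ d + c) x (f x)" if x: "Blank \<notin> set x" for x
  proof -
    obtain n s where n: "n \<le> (length x + 2) ^ k" and e: "exec p [x, [], [], []] n s" and f: "f x \<longleftrightarrow> peek (s ! 0) = One"
      using ex[OF x] by blast
    define W where "W = length (lay [x, [], [], []]) + n"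
    from exec_simulation[OF e wf, of W n "[]"] x obtain t N' where
      s: "okl s" "length s = 4" and t: "t \<le> n * (6 * W + 12)" "steps t (home [p] [x, [], [], []] n) (home [] s N')"
      unfolding W_def by auto
    obtain s0 ss where s0: "s = s0 # ss" using s by (cases s) auto
    have 1: "steps (2 * length x + 8) (Ins 4 Blank [p], [], x @ replicate (n + 5) Blank) (home [p] [x, [], [], []] n)"
      by (rule init_run[OF x])
    have 2: "steps (Suc 0) (home [] s N') (Chk, [Blank], lay s @ replicate N' Blank)"
      by (rule steps_1I) (simp add: home_def gs)
    obtain ls rs where 3: "steps (Suc 0) (Chk, [Blank], lay s @ replicate N' Blank) ((if f x then Acc else Rej), ls, rs)"
    proof -
      have "steps (Suc 0) (Chk, [Blank], lay s @ replicate N' Blank)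
        ((if f x then Acc else Rej), [Blank], lay s @ replicate N' Blank)"
        unfolding f s0 by (rule steps_1I) (cases s0; simp add: gs)
      then show ?thesis using that by blast
    qed
    let ?t = "2 * length x + 8 + t + Suc 0 + Suc 0" and ?T = "c * length x ^ d + c"
    have "?t \<le> ?T"
    proof -
      define m where "m = max (length x) 1"
      define Q where "Q = (3 * m) ^ k"
      have m: "1 \<le> m" "length x \<le> m" by (simp_all add: m_def)
      have Q1: "1 \<le> Q" using m by (simp add: Q_def)
      have nQ: "n \<le> Q" using n power_mono[of "length x + 2" "3 * m" k] m unfolding Q_def by linarith
      have QQ: "Q \<le> Q * Q" "1 \<le> Q * Q" using Q1 by auto
      have QQm: "Q * Q \<le> Q * Q * m" "m \<le> Q * Q * m" using m QQ by auto
      have "Q * m \<le> Q * Q * m" using QQ by simp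
      have "t \<le> Q * (6 * (m + 4 + Q) + 12)"
        using t(1) nQ m by (intro order_trans[OF t(1)] mult_mono) (auto simp: W_def)
      also have "\<dots> = 6 * (Q * m) + 36 * Q + 6 * (Q * Q)" by (simp add: algebra_simps)
      finally have "?t \<le> 60 * (Q * Q * m)"
        using QQ QQm \<open>Q * m \<le> Q * Q * m\<close> m by linarith
      also have "Q * Q * m = 3 ^ (2 * k) * m ^ (2 * k + 1)"
        by (simp add: Q_def power_mult_distrib power_add mult_2)
      also have "m ^ (2 * k + 1) \<le> length x ^ d + 1"
      proof (cases "length x = 0")
        case False
        then have "m = length x" unfolding m_def by linarith
        moreover have "m ^ (2 * k + 1) \<le> m ^ (2 * k + 2)" using m(1) by (intro power_increasing) auto
        ultimately show ?thesis unfolding d_def by (metis trans_le_add1)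
      qed (simp add: m_def)
      finally have "?t \<le> 60 * (3 ^ (2 * k) * (length x ^ d + 1))" by simp
      also have "\<dots> \<le> ?T" by (simp add: c_def algebra_simps)
      finally show ?thesis .
    qed
    \<comment> \<open>\<open>decides_within\<close> asks for the state at exactly time
      \<open>?T\<close>; the surplus \<open>u\<close> is spent in the accepting or rejecting state,
      which is never left.\<close>
    then obtain u where u: "?T = ?t + u" using le_Suc_ex by blast
    have stay: "fst ((gstep delta ^^ u) (q, ls, rs)) = q" if "q = Acc \<or> q = Rej" for q ls rs
    proof (induction u)
      case (Suc u)
      obtain q1 l1 r1 where *: "(gstep delta ^^ u) (q, ls, rs) = (q1, l1, r1)" by (metis prod_cases3)
      then show ?case using Suc that by (auto simp: fst_gstep)
    qed simp
    have "steps ?t (Ins 4 Blank [p], [], x @ replicate (n + 5) Blank) ((if f x then Acc else Rej), ls, rs)"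
      by (rule steps_trans[OF steps_trans[OF steps_trans[OF 1 t(2)] 2] 3])
    then have "(gstep delta ^^ ?T) (Ins 4 Blank [p], [], x @ replicate (n + 5) Blank)
       = (gstep delta ^^ u) ((if f x then Acc else Rej), ls, rs)"
      unfolding u steps_def by (simp only: add.commute[of ?t u] funpow_add comp_def)
    then have "fst ((gstep delta ^^ ?T) (Ins 4 Blank [p], [], x @ replicate (n + 5) Blank)) = (if f x then Acc else Rej)"
      using stay by simp
    then have "fst ((gstep delta ^^ ?T) (Ins 4 Blank [p], [], x)) = (if f x then Acc else Rej)"
      using gsteps_pad[of ?T delta "Ins 4 Blank [p]" "[]" x "n + 5"] by auto
    then show ?thesis by (rule M(2))
  qed
  with M(1) show ?thesis using that by blast
qed

section \<open>Polynomially bounded functions\<close>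

text \<open>Powers of a base that is at least 2 absorb constants, sums and products by raising the
  exponent, so no coefficients have to be tracked.\<close>

definition pb :: "('a \<Rightarrow> nat) \<Rightarrow> ('a \<Rightarrow> nat) \<Rightarrow> bool" where
  "pb m t \<longleftrightarrow> (\<exists>k. \<forall>x. t x \<le> (m x + 2) ^ k)"

lemma pb_mono: "pb m u \<Longrightarrow> (\<And>x. t x \<le> u x) \<Longrightarrow> pb m t"
  unfolding pb_def by (meson order_trans)

lemma pb_self: "pb m m"
  unfolding pb_def by (rule exI[of _ 1]) simp

lemma pb_const: "pb m (\<lambda>_. c)"
proof -
  have "c \<le> 2 ^ c" by (rule less_imp_le[OF less_exp])
  also have "2 ^ c \<le> (m x + 2) ^ c" for x by (rule power_mono) auto
  finally show ?thesis unfolding pb_def by (intro exI[of _ c] allI)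
qed

lemma pb_add: assumes "pb m t" "pb m u" shows "pb m (\<lambda>x. t x + u x)"
proof -
  obtain k l where k: "\<And>x. t x \<le> (m x + 2) ^ k" and l: "\<And>x. u x \<le> (m x + 2) ^ l"
    using assms unfolding pb_def by blast
  have "t x + u x \<le> (m x + 2) ^ (Suc (k + l))" for x
  proof -
    have "t x \<le> (m x + 2) ^ (k + l)" by (rule order_trans[OF k]) (auto intro: power_increasing)
    moreover have "u x \<le> (m x + 2) ^ (k + l)" by (rule order_trans[OF l]) (auto intro: power_increasing)
    moreover have "2 * (m x + 2) ^ (k + l) \<le> (m x + 2) ^ (Suc (k + l))" by simp
    ultimately show ?thesis by linarith
  qed
  then show ?thesis unfolding pb_def by blast
qed

lemma pb_mult: assumes "pb m t" "pb m u" shows "pb m (\<lambda>x. t x * u x)"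
proof -
  obtain k l where k: "\<And>x. t x \<le> (m x + 2) ^ k" and l: "\<And>x. u x \<le> (m x + 2) ^ l"
    using assms unfolding pb_def by blast
  have "t x * u x \<le> (m x + 2) ^ (k + l)" for x
    unfolding power_add using k l by (intro mult_mono) auto
  then show ?thesis unfolding pb_def by blast
qed

lemma pb_comp: assumes "pb m (\<lambda>x. m' (f x))" "pb m' t" shows "pb m (\<lambda>x. t (f x))"
proof -
  obtain k l where k: "\<And>x. m' (f x) \<le> (m x + 2) ^ k" and l: "\<And>x. t x \<le> (m' x + 2) ^ l"
    using assms unfolding pb_def by blast
  have "t (f x) \<le> (m x + 2) ^ ((k + 2) * l)" for x
  proof -
    have "1 \<le> (m x + 2) ^ k" by simp
    then have "(m x + 2) ^ k + 2 \<le> 2 * 2 * (m x + 2) ^ k" by linarith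
    also have "\<dots> \<le> (m x + 2) * (m x + 2) * (m x + 2) ^ k" by (intro mult_mono) auto
    also have "\<dots> = (m x + 2) ^ (k + 2)" by (simp only: power_add power2_eq_square mult.commute)
    finally have "m' (f x) + 2 \<le> (m x + 2) ^ (k + 2)" using k[of x] by linarith
    then have "(m' (f x) + 2) ^ l \<le> ((m x + 2) ^ (k + 2)) ^ l" by (rule power_mono) simp
    then show ?thesis using l[of "f x"] unfolding power_mult by linarith
  qed
  then show ?thesis unfolding pb_def by blast
qed

section \<open>Computing with trees on the stack machine\<close>

datatype val = V0 | V2 val val

text \<open>A prefix code: the end of a tree is determined by its own symbols, so codes can be
  stacked without separators above arbitrary other data.\<close>

primrec code :: "val \<Rightarrow> sym list" where
  "code V0 = [Zero]"
| "code (V2 a b) = One # code a @ code b"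

definition vsize :: "val \<Rightarrow> nat" where
  "vsize v = length (code v)"

lemma vsize_simps [simp]: "vsize V0 = 1" "vsize (V2 a b) = Suc (vsize a + vsize b)"
  by (simp_all add: vsize_def)

lemma vsize_pos [simp]: "0 < vsize v" "Suc 0 \<le> vsize v"
  by (induction v) auto

definition run :: "com \<Rightarrow> sym list list \<Rightarrow> sym list list \<Rightarrow> nat \<Rightarrow> bool" where
  "run c s s' n \<longleftrightarrow> (\<exists>m\<le>n. exec c s m s')"

lemma run_mono: "run c s s' n \<Longrightarrow> n \<le> n' \<Longrightarrow> run c s s' n'"
  unfolding run_def by (meson order_trans)

lemma run_skip: "1 \<le> n \<Longrightarrow> run Skip s s n"
  unfolding run_def using exec.Skip by blast

lemma run_push: "s[i := a # s ! i] = s' \<Longrightarrow> 1 \<le> n \<Longrightarrow> run (Push i a) s s' n"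
  unfolding run_def using exec.Push by blast

lemma run_seq: "run c s s' n \<Longrightarrow> run d s' s'' m \<Longrightarrow> run (Seq c d) s s'' (n + m + 1)"
  unfolding run_def by (meson add_mono exec.Seq le_refl)

lemma run_case: "s[i := tl (s ! i)] = s1 \<Longrightarrow> run (f (peek (s ! i))) s1 s' n \<Longrightarrow> run (Case i f) s s' (n + 1)"
  unfolding run_def using exec.Case by fastforce

lemma run_loopE: "s ! i = [] \<Longrightarrow> run (Loop i f) s s 1"
  unfolding run_def using exec.LoopE by blast

lemma run_loopS: "s ! i = a # r \<Longrightarrow> s[i := r] = s1 \<Longrightarrow> run (f a) s1 s' n \<Longrightarrow> run (Loop i f) s' s'' m \<Longrightarrow>
    run (Loop i f) s s'' (n + m + 1)"
  unfolding run_def by (meson add_mono exec.LoopS le_refl)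

text \<open>A loop body has to be well-formed for every symbol, \<open>Blank\<close> included, so a
  symbol is forced to be a bit before it is pushed.\<close>

definition to_bit :: "sym \<Rightarrow> sym" where
  "to_bit s = (if s = One then One else Zero)"

lemma wfc_to_bit [simp]: "to_bit s \<noteq> Blank"
  by (simp add: to_bit_def)

text \<open>In this loop the height of stack 3 is the number of subtrees still to be read.\<close>

definition xfer_loop :: "nat \<Rightarrow> com" where
  "xfer_loop i = Loop 3 (\<lambda>_. Case i (\<lambda>s. if s = One then Seq (Push 2 One) (Seq (Push 3 One) (Push 3 One)) else Push 2 Zero))"

definition xfer :: "nat \<Rightarrow> com" where
  "xfer i = Seq (Push 3 One) (xfer_loop i)"

definition two :: "nat \<Rightarrow> sym list \<Rightarrow> sym list \<Rightarrow> sym list \<Rightarrow> sym list \<Rightarrow> sym list list" where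
  "two i x y q c = (if i = 0 then [x, y, q, c] else [y, x, q, c])"

lemma run_push3:
  assumes "s[2 := One # s ! 2, 3 := One # One # s ! 3] = s'" "length s = 4" "5 \<le> n"
  shows "run (Seq (Push 2 One) (Seq (Push 3 One) (Push 3 One))) s s' n"
proof -
  let ?s1 = "s[2 := One # s ! 2]"
  let ?s2 = "?s1[3 := One # ?s1 ! 3]"
  have "run (Seq (Push 2 One) (Seq (Push 3 One) (Push 3 One))) s (?s2[3 := One # ?s2 ! 3]) (1 + (1 + 1 + 1) + 1)"
    by (rule run_seq[OF run_push[OF refl order_refl] run_seq[OF run_push[OF refl order_refl] run_push[OF refl order_refl]]])
  moreover have "?s2[3 := One # ?s2 ! 3] = s'" using assms by auto
  ultimately show ?thesis using assms(3) by (auto elim: run_mono)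
qed

text \<open>A forest \<open>vs\<close> is read instead of a single tree because reading a node
  replaces one pending tree by two. The total code length still decreases, hence the
  measure.\<close>

lemma xfer_loop:
  assumes "i < 2"
  shows "run (xfer_loop i) (two i (concat (map code vs) @ r) y q (replicate (length vs) One))
    (two i r y (rev (concat (map code vs)) @ q) []) (8 * length (concat (map code vs)) + 1)"
proof (induction "length (concat (map code vs))" arbitrary: vs q rule: less_induct)
  case less
  have i: "i = 0 \<or> i = Suc 0" using assms by auto
  show ?case
  proof (cases vs)
    case Nil
    then show ?thesis unfolding xfer_loop_def
      by (auto intro!: run_mono[OF run_loopE] simp: two_def)
  next
    case (Cons v us)
    show ?thesis
    proof (cases v)
      case V0
      have IH: "run (xfer_loop i) (two i (concat (map code us) @ r) y (Zero # q) (replicate (length us) One))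
        (two i r y (rev (concat (map code us)) @ Zero # q) []) (8 * length (concat (map code us)) + 1)"
        using less[of us "Zero # q"] Cons V0 by simp
      have "run (Case i (\<lambda>s. if s = One then Seq (Push 2 One) (Seq (Push 3 One) (Push 3 One)) else Push 2 Zero))
         (two i (Zero # concat (map code us) @ r) y q (replicate (length us) One))
         (two i (concat (map code us) @ r) y (Zero # q) (replicate (length us) One)) (1 + 1)"
        by (rule run_case[OF refl]) (use i in \<open>auto simp: two_def intro!: run_push\<close>)
      from run_loopS[OF _ _ this IH[unfolded xfer_loop_def], where s = "two i (concat (map code vs) @ r) y q (replicate (length vs) One)" and a = One, folded xfer_loop_def]
      have "run (xfer_loop i) (two i (concat (map code vs) @ r) y q (replicate (length vs) One)) (two i r y (rev (concat (map code vs)) @ q) []) (1 + 1 + (8 * length (concat (map code us)) + 1) + 1)"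
        using i Cons V0 by (auto simp: two_def)
      then show ?thesis by (rule run_mono) (simp add: Cons V0)
    next
      case (V2 a b)
      have IH: "run (xfer_loop i) (two i (code a @ code b @ concat (map code us) @ r) y (One # q) (One # One # replicate (length us) One))
        (two i r y (rev (code a @ code b @ concat (map code us)) @ One # q) []) (8 * length (code a @ code b @ concat (map code us)) + 1)"
        using less[of "a # b # us" "One # q"] Cons V2 by simp
      have "run (Case i (\<lambda>s. if s = One then Seq (Push 2 One) (Seq (Push 3 One) (Push 3 One)) else Push 2 Zero))
         (two i (One # code a @ code b @ concat (map code us) @ r) y q (replicate (length us) One))
         (two i (code a @ code b @ concat (map code us) @ r) y (One # q) (One # One # replicate (length us) One)) (1 + (1 + 1 + 1) + 1 + 1)"
        by (rule run_case[OF refl]) (use i in \<open>auto simp: two_def intro!: run_push run_push3\<close>)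
      from run_loopS[OF _ _ this IH[unfolded xfer_loop_def], where s = "two i (concat (map code vs) @ r) y q (replicate (length vs) One)" and a = One, folded xfer_loop_def]
      have "run (xfer_loop i) (two i (concat (map code vs) @ r) y q (replicate (length vs) One)) (two i r y (rev (concat (map code vs)) @ q) []) (1 + (1 + 1 + 1) + 1 + 1 + (8 * length (code a @ code b @ concat (map code us)) + 1) + 1)"
        using i Cons V2 by (auto simp: two_def)
      then show ?thesis by (rule run_mono) (simp add: Cons V2)
    qed
  qed
qed

lemma xfer:
  assumes "i < 2"
  shows "run (xfer i) (two i (code v @ r) y [] []) (two i r y (rev (code v)) []) (8 * vsize v + 3)"
proof -
  have "run (Push 3 One) (two i (code v @ r) y [] []) (two i (code v @ r) y [] [One]) 1"
    by (rule run_push) (auto simp: two_def)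
  moreover have "run (xfer_loop i) (two i (code v @ r) y [] [One]) (two i r y (rev (code v)) []) (8 * vsize v + 1)"
    using xfer_loop[OF assms, of "[v]" r y "[]"] by (simp add: vsize_def)
  ultimately show ?thesis unfolding xfer_def by (rule run_mono[OF run_seq]) simp
qed

text \<open>Emptying stack 2 undoes the reversal made by \<open>xfer\<close>. The flags
  \<open>b0\<close> and \<open>b1\<close> tell which of the stacks 0 and 1 receive a copy, so that
  one induction covers moving, copying and deleting.\<close>

lemma drain:
  assumes "\<And>s x y q. s \<in> {Zero, One} \<Longrightarrow> run (f s) [x, y, q, []] [(if b0 then s # x else x), (if b1 then s # y else y), q, []] k"
  shows "set w \<subseteq> {Zero, One} \<Longrightarrow> run (Loop 2 f) [x, y, w, []] [(if b0 then rev w @ x else x), (if b1 then rev w @ y else y), [], []] ((k + 1) * length w + 1)"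
proof (induction w arbitrary: x y)
  case Nil
  then show ?case by (auto intro!: run_mono[OF run_loopE])
next
  case (Cons a w)
  have 1: "run (f a) [x, y, w, []] [(if b0 then a # x else x), (if b1 then a # y else y), w, []] k"
    using assms Cons.prems by auto
  have 2: "run (Loop 2 f) [(if b0 then a # x else x), (if b1 then a # y else y), w, []]
    [(if b0 then rev w @ (if b0 then a # x else x) else (if b0 then a # x else x)), (if b1 then rev w @ (if b1 then a # y else y) else (if b1 then a # y else y)), [], []]
     ((k + 1) * length w + 1)"
    using Cons.IH Cons.prems by simp
  have 3: "run (Loop 2 f) [x, y, a # w, []]
    [(if b0 then rev w @ (if b0 then a # x else x) else (if b0 then a # x else x)), (if b1 then rev w @ (if b1 then a # y else y) else (if b1 then a # y else y)), [], []]
    (k + ((k + 1) * length w + 1) + 1)"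
    by (rule run_loopS[OF _ _ 1 2]) simp_all
  show ?case by (rule run_mono[OF 3[THEN back_subst[where P = "\<lambda>s. run _ _ s _"]]]) auto
qed

lemma set_code: "set (code v) \<subseteq> {Zero, One}"
  by (induction v) auto

definition save :: com where "save = Seq (xfer 0) (Loop 2 (\<lambda>s. Push 1 (to_bit s)))"
definition restore :: com where "restore = Seq (xfer 1) (Loop 2 (\<lambda>s. Push 0 (to_bit s)))"
definition dup :: com where "dup = Seq (xfer 0) (Loop 2 (\<lambda>s. Seq (Push 0 (to_bit s)) (Push 1 (to_bit s))))"
definition drop_main :: com where "drop_main = Seq (xfer 0) (Loop 2 (\<lambda>s. Skip))"
definition drop_aux :: com where "drop_aux = Seq (xfer 1) (Loop 2 (\<lambda>s. Skip))"

lemma wfc_prims: "wfc save" "wfc restore" "wfc dup" "wfc drop_main" "wfc drop_aux"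
  by (auto simp: save_def restore_def dup_def drop_main_def drop_aux_def xfer_def xfer_loop_def)

lemma run_prims:
  "run save [code v @ r0, r1, [], []] [r0, code v @ r1, [], []] (20 * vsize v)"
  "run restore [r0, code v @ r1, [], []] [code v @ r0, r1, [], []] (20 * vsize v)"
  "run dup [code v @ r0, r1, [], []] [code v @ r0, code v @ r1, [], []] (20 * vsize v)"
  "run drop_main [code v @ r0, r1, [], []] [r0, r1, [], []] (20 * vsize v)"
  "run drop_aux [r0, code v @ r1, [], []] [r0, r1, [], []] (20 * vsize v)"
proof -
  have w: "set (rev (code v)) \<subseteq> {Zero, One}" using set_code by simp
  have l: "length (rev (code v)) = vsize v" by (simp add: vsize_def)
  have x0: "run (xfer 0) [code v @ r0, r1, [], []] [r0, r1, rev (code v), []] (8 * vsize v + 3)"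
    using xfer[of 0 v r0 r1] by (simp add: two_def)
  have x1: "run (xfer 1) [r0, code v @ r1, [], []] [r0, r1, rev (code v), []] (8 * vsize v + 3)"
    using xfer[of 1 v r1 r0] by (simp add: two_def)
  have p0: "run (Push 0 (to_bit s)) [x, y, q, []] [s # x, y, q, []] 1" if "s \<in> {Zero, One}" for s x y q
    using that by (intro run_push) (auto simp: to_bit_def)
  have p1: "run (Push 1 (to_bit s)) [x, y, q, []] [x, s # y, q, []] 1" if "s \<in> {Zero, One}" for s x y q
    using that by (intro run_push) (auto simp: to_bit_def)
  have p01: "run (Seq (Push 0 (to_bit s)) (Push 1 (to_bit s))) [x, y, q, []] [s # x, s # y, q, []] 3" if "s \<in> {Zero, One}" for s x y q
    by (rule run_mono[OF run_seq[OF p0[OF that] p1[OF that]]]) simp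
  have d1: "run (Loop 2 (\<lambda>s. Push 1 (to_bit s))) [r0, r1, rev (code v), []] [r0, code v @ r1, [], []] (2 * vsize v + 1)"
    using drain[of "\<lambda>s. Push 1 (to_bit s)" False True 1, OF _ w, of r0 r1] p1 l by (simp add: mult_2)
  have d0: "run (Loop 2 (\<lambda>s. Push 0 (to_bit s))) [r0, r1, rev (code v), []] [code v @ r0, r1, [], []] (2 * vsize v + 1)"
    using drain[of "\<lambda>s. Push 0 (to_bit s)" True False 1, OF _ w, of r0 r1] p0 l by (simp add: mult_2)
  have d01: "run (Loop 2 (\<lambda>s. Seq (Push 0 (to_bit s)) (Push 1 (to_bit s)))) [r0, r1, rev (code v), []] [code v @ r0, code v @ r1, [], []] (4 * vsize v + 1)"
    using drain[of "\<lambda>s. Seq (Push 0 (to_bit s)) (Push 1 (to_bit s))" True True 3, OF _ w, of r0 r1] p01 l by simp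
  have d: "run (Loop 2 (\<lambda>s. Skip)) [r0, r1, rev (code v), []] [r0, r1, [], []] (2 * vsize v + 1)"
    using drain[of "\<lambda>s. Skip" False False 1, OF _ w, of r0 r1] run_skip l by (simp add: mult_2)
  have v: "1 \<le> vsize v" by simp
  show "run save [code v @ r0, r1, [], []] [r0, code v @ r1, [], []] (20 * vsize v)"
    unfolding save_def by (rule run_mono[OF run_seq[OF x0 d1]]) (use v in linarith)
  show "run restore [r0, code v @ r1, [], []] [code v @ r0, r1, [], []] (20 * vsize v)"
    unfolding restore_def by (rule run_mono[OF run_seq[OF x1 d0]]) (use v in linarith)
  show "run dup [code v @ r0, r1, [], []] [code v @ r0, code v @ r1, [], []] (20 * vsize v)"
    unfolding dup_def by (rule run_mono[OF run_seq[OF x0 d01]]) (use v in linarith)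
  show "run drop_main [code v @ r0, r1, [], []] [r0, r1, [], []] (20 * vsize v)"
    unfolding drop_main_def by (rule run_mono[OF run_seq[OF x0 d]]) (use v in linarith)
  show "run drop_aux [r0, code v @ r1, [], []] [r0, r1, [], []] (20 * vsize v)"
    unfolding drop_aux_def by (rule run_mono[OF run_seq[OF x1 d]]) (use v in linarith)
qed

section \<open>Encoding of data types as trees\<close>

class enc =
  fixes enc :: "'a \<Rightarrow> val"

instantiation bool :: enc
begin
definition enc_bool :: "bool \<Rightarrow> val" where "enc_bool b = (if b then V2 V0 V0 else V0)"
instance ..
end

instantiation unit :: enc
begin
definition enc_unit :: "unit \<Rightarrow> val" where "enc_unit _ = V0"
instance ..
end

text \<open>Unary, so that a loop with \<open>n\<close> rounds has a number of rounds linear in the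
  size of \<open>n\<close>.\<close>

instantiation nat :: enc
begin
primrec enc_nat :: "nat \<Rightarrow> val" where
  "enc_nat 0 = V0"
| "enc_nat (Suc n) = V2 V0 (enc_nat n)"
instance ..
end

instantiation prod :: (enc, enc) enc
begin
definition enc_prod :: "'a \<times> 'b \<Rightarrow> val" where "enc_prod p = V2 (enc (fst p)) (enc (snd p))"
instance ..
end

instantiation list :: (enc) enc
begin
primrec enc_list :: "'a list \<Rightarrow> val" where
  "enc_list [] = V0"
| "enc_list (x # xs) = V2 (enc x) (enc_list xs)"
instance ..
end

abbreviation tcode :: "'a::enc \<Rightarrow> sym list" where "tcode x \<equiv> code (enc x)"

definition sz :: "'a::enc \<Rightarrow> nat" where "sz x = vsize (enc x)"

lemma sz_simps [simp]:
  "sz (a, b) = Suc (sz a + sz b)" "sz (0 :: nat) = 1" "sz (Suc n) = Suc (Suc (sz n))"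
  "sz ([] :: 'a::enc list) = 1" "sz (x # xs) = Suc (sz x + sz xs)"
  by (simp_all add: sz_def enc_prod_def)

lemma sz_pos [simp]: "0 < sz x" "Suc 0 \<le> sz x"
  by (simp_all add: sz_def)

text \<open>The result must appear above arbitrary contents \<open>r0\<close> and \<open>r1\<close>
  that stay untouched. This frame property allows programs to be combined while arguments are parked
  on stack 1.\<close>

definition ptime :: "('a::enc \<Rightarrow> 'b::enc) \<Rightarrow> bool" where
  "ptime f \<longleftrightarrow> (\<exists>c t. wfc c \<and>
     (\<forall>x r0 r1. run c [tcode x @ r0, r1, [], []] [tcode (f x) @ r0, r1, [], []] (t x)) \<and> pb sz t)"

lemma ptimeI: "wfc c \<Longrightarrow> (\<And>x r0 r1. run c [tcode x @ r0, r1, [], []] [tcode (f x) @ r0, r1, [], []] (t x)) \<Longrightarrow>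
    pb sz t \<Longrightarrow> ptime f"
  unfolding ptime_def by blast

lemma ptimeE:
  assumes "ptime f"
  obtains c t where "wfc c" "\<And>x r0 r1. run c [tcode x @ r0, r1, [], []] [tcode (f x) @ r0, r1, [], []] (t x)" "pb sz t"
  using assms unfolding ptime_def by blast

lemma length_lay_update_le: "length x \<le> Suc (length (s ! i)) \<Longrightarrow> length (lay (s[i := x])) \<le> length (lay s) + 1"
  using length_lay_update[of i s x] by (cases "i < length s") (auto simp: list_update_beyond)

lemma exec_length: "exec c s n s' \<Longrightarrow> length (lay s') \<le> length (lay s) + n"
proof (induction rule: exec.induct)
  case (Push i a s)
  then show ?case using length_lay_update_le[of "a # s ! i" s i] by simp
next
  case (Case f s i n s')
  then show ?case using length_lay_update_le[of "tl (s ! i)" s i] by (simp; linarith)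
next
  case (LoopS s i a r f n s' m s'')
  then show ?case using length_lay_update_le[of r s i] by simp
qed auto


lemmas run_tprims = run_prims[where v = "enc x" for x, folded sz_def]

lemma run_sz: "run c [tcode x @ r0, r1, [], []] [tcode w @ r0, r1, [], []] n \<Longrightarrow> sz w \<le> sz x + n"
  unfolding run_def using exec_length by (fastforce simp: vsize_def sz_def)

text \<open>A step adds at most one symbol, so the output is at most as long as the input plus the
  running time. Hence a bound on time is also a bound on size.\<close>

lemma ptime_sz: assumes "ptime f" shows "pb sz (\<lambda>x. sz (f x))"
proof -
  obtain c t where c: "\<And>x r0 r1. run c [tcode x @ r0, r1, [], []] [tcode (f x) @ r0, r1, [], []] (t x)" "pb sz t"
    using ptimeE[OF assms] by metis
  show ?thesis by (rule pb_mono[OF pb_add[OF pb_self c(2)]]) (rule run_sz[OF c(1)])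
qed

lemma pb_prim: "pb m f \<Longrightarrow> pb m (\<lambda>x. 20 * f x)"
  by (rule pb_mult[OF pb_const])

section \<open>Closure properties of polynomial time\<close>

named_theorems ptime_intros

lemma ptime_id [ptime_intros]: "ptime (\<lambda>x. x)"
  by (rule ptimeI[of Skip _ "\<lambda>_. 1"]) (auto intro: run_skip pb_const)

lemma ptime_comp: assumes "ptime f" "ptime g" shows "ptime (\<lambda>x. f (g x))"
proof -
  obtain c t where c: "wfc c" "\<And>x r0 r1. run c [tcode x @ r0, r1, [], []] [tcode (f x) @ r0, r1, [], []] (t x)" "pb sz t"
    using ptimeE[OF assms(1)] by metis
  obtain d u where d: "wfc d" "\<And>x r0 r1. run d [tcode x @ r0, r1, [], []] [tcode (g x) @ r0, r1, [], []] (u x)" "pb sz u"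
    using ptimeE[OF assms(2)] by metis
  show ?thesis
    by (rule ptimeI[of "Seq d c" _ "\<lambda>x. u x + t (g x) + 1"])
      (use c d in \<open>auto intro!: run_seq pb_add pb_const pb_comp[where f = g, OF ptime_sz[OF assms(2)]] simp del: One_nat_def Suc_eq_plus1\<close>)
qed

primrec push_list :: "sym list \<Rightarrow> com" where
  "push_list [] = Skip"
| "push_list (a # w) = Seq (push_list w) (Push 0 a)"

lemma run_push_list: "run (push_list w) [r0, r1, [], []] [w @ r0, r1, [], []] (2 * length w + 1)"
proof (induction w)
  case (Cons a w)
  have "run (push_list (a # w)) [r0, r1, [], []] [(a # w) @ r0, r1, [], []] ((2 * length w + 1) + 1 + 1)"
    unfolding push_list.simps by (rule run_seq[OF Cons run_push]) simp_all
  then show ?case by (rule run_mono) simp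
qed (auto intro: run_skip)

lemma wfc_push_list: "set w \<subseteq> {Zero, One} \<Longrightarrow> wfc (push_list w)"
  by (induction w) auto

lemma ptime_const [ptime_intros]: "ptime (\<lambda>_. k)"
proof (rule ptimeI)
  show "wfc (Seq drop_main (push_list (tcode k)))" by (simp add: wfc_prims wfc_push_list set_code)
  show "run (Seq drop_main (push_list (tcode k))) [tcode x @ r0, r1, [], []] [tcode k @ r0, r1, [], []]
     (20 * sz x + (2 * length (tcode k) + 1) + 1)" for x :: 'a and r0 r1
    by (rule run_seq[OF run_tprims(4) run_push_list])
  show "pb sz (\<lambda>x. 20 * sz x + (2 * length (tcode k) + 1) + 1)" by (intro pb_add pb_prim pb_self pb_const)
qed

lemma tcode_Pair: "tcode (a, b) = One # tcode a @ tcode b"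
  by (simp add: enc_prod_def)

text \<open>The second component is computed first: its code then lies below that of the first, and
  a leading \<open>One\<close> completes the code of the pair.\<close>

lemma ptime_Pair [ptime_intros]: assumes "ptime f" "ptime g" shows "ptime (\<lambda>x. (f x, g x))"
proof -
  obtain c t where c: "wfc c" "\<And>x r0 r1. run c [tcode x @ r0, r1, [], []] [tcode (f x) @ r0, r1, [], []] (t x)" "pb sz t"
    using ptimeE[OF assms(1)] by metis
  obtain d u where d: "wfc d" "\<And>x r0 r1. run d [tcode x @ r0, r1, [], []] [tcode (g x) @ r0, r1, [], []] (u x)" "pb sz u"
    using ptimeE[OF assms(2)] by metis
  show ?thesis
  proof (rule ptimeI)
    show "wfc (Seq dup (Seq d (Seq restore (Seq c (Push 0 One)))))" using c d by (simp add: wfc_prims)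
    show "run (Seq dup (Seq d (Seq restore (Seq c (Push 0 One))))) [tcode x @ r0, r1, [], []]
      [tcode (f x, g x) @ r0, r1, [], []] (20 * sz x + (u x + (20 * sz x + (t x + 1 + 1) + 1) + 1) + 1)" for x r0 r1
      by (rule run_seq[OF run_tprims(3) run_seq[OF d(2) run_seq[OF run_tprims(2) run_seq[OF c(2) run_push]]]])
        (simp_all add: tcode_Pair)
    show "pb sz (\<lambda>x. 20 * sz x + (u x + (20 * sz x + (t x + 1 + 1) + 1) + 1) + 1)"
      by (intro pb_add pb_prim pb_self pb_const c d)
  qed
qed

lemma ptime_fst0: "ptime (fst :: 'a::enc \<times> 'b::enc \<Rightarrow> 'a)"
proof (rule ptimeI)
  let ?c = "Seq save (Seq drop_main restore)"
  show "wfc (Case 0 (\<lambda>_. ?c))" by (simp add: wfc_prims)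
  show "run (Case 0 (\<lambda>_. ?c)) [tcode x @ r0, r1, [], []] [tcode (fst x) @ r0, r1, [], []] (60 * sz x + 3)" for x :: "'a \<times> 'b" and r0 r1
  proof -
    obtain a b where x: "x = (a, b)" by force
    have "run ?c [tcode a @ tcode b @ r0, r1, [], []] [tcode a @ r0, r1, [], []]
          (20 * sz a + (20 * sz b + 20 * sz a + 1) + 1)"
      by (rule run_seq[OF run_tprims(1) run_seq[OF run_tprims(4) run_tprims(2)]])
    then have "run (Case 0 (\<lambda>_. ?c)) [tcode x @ r0, r1, [], []] [tcode (fst x) @ r0, r1, [], []]
          (20 * sz a + (20 * sz b + 20 * sz a + 1) + 1 + 1)"
      by (intro run_case) (auto simp: tcode_Pair x)
    then show ?thesis by (rule run_mono) (simp add: x)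
  qed
  show "pb sz (\<lambda>x :: 'a \<times> 'b. 60 * sz x + 3)" by (intro pb_add pb_mult pb_self pb_const)
qed

lemma ptime_snd0: "ptime (snd :: 'a::enc \<times> 'b::enc \<Rightarrow> 'b)"
proof (rule ptimeI)
  show "wfc (Case 0 (\<lambda>_. drop_main))" by (simp add: wfc_prims)
  show "run (Case 0 (\<lambda>_. drop_main)) [tcode x @ r0, r1, [], []] [tcode (snd x) @ r0, r1, [], []] (20 * sz x + 1)" for x :: "'a \<times> 'b" and r0 r1
  proof -
    obtain a b where x: "x = (a, b)" by force
    have "run drop_main [tcode a @ tcode b @ r0, r1, [], []] [tcode b @ r0, r1, [], []] (20 * sz a)"
      by (rule run_tprims(4))
    then have "run (Case 0 (\<lambda>_. drop_main)) [tcode x @ r0, r1, [], []] [tcode (snd x) @ r0, r1, [], []] (20 * sz a + 1)"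
      by (intro run_case) (auto simp: tcode_Pair x)
    then show ?thesis by (rule run_mono) (simp add: x)
  qed
  show "pb sz (\<lambda>x :: 'a \<times> 'b. 20 * sz x + 1)" by (intro pb_add pb_mult pb_self pb_const)
qed

lemmas ptime_fst [ptime_intros] = ptime_comp[OF ptime_fst0]
lemmas ptime_snd [ptime_intros] = ptime_comp[OF ptime_snd0]

lemma ptime_cong: "ptime f \<Longrightarrow> (\<And>x. f x = g x) \<Longrightarrow> ptime g"
  by (simp add: ptime_def)

text \<open>Programs see only codes, so conversions between types with equal codes cost
  nothing.\<close>

lemma ptime_inj:
  assumes "\<And>x. enc (f x) = enc (g x)" "ptime f" shows "ptime g"
  using assms unfolding ptime_def by simp

lemma ptime_Suc [ptime_intros]: "ptime f \<Longrightarrow> ptime (\<lambda>x. Suc (f x))"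
  by (rule ptime_inj[where f = "\<lambda>x. (0 :: nat, f x)"]) (simp add: enc_prod_def, intro ptime_intros)

lemma ptime_Cons [ptime_intros]: "ptime f \<Longrightarrow> ptime g \<Longrightarrow> ptime (\<lambda>x. f x # g x)"
  by (rule ptime_inj[where f = "\<lambda>x. (f x, g x)"]) (auto simp: enc_prod_def intro: ptime_Pair)

lemma ptime_case_list [ptime_intros]:
  assumes "ptime l" "ptime a" "ptime (\<lambda>p. b (fst p) (fst (snd p)) (snd (snd p)))"
  shows "ptime (\<lambda>x. case l x of [] \<Rightarrow> a x | y # ys \<Rightarrow> b x y ys)"
proof -
  let ?b = "\<lambda>p. b (fst p) (fst (snd p)) (snd (snd p))"
  obtain e w where e: "wfc e" "\<And>x r0 r1. run e [tcode x @ r0, r1, [], []] [tcode (l x) @ r0, r1, [], []] (w x)" "pb sz w"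
    using ptimeE[OF assms(1)] by metis
  obtain c t where c: "wfc c" "\<And>x r0 r1. run c [tcode x @ r0, r1, [], []] [tcode (a x) @ r0, r1, [], []] (t x)" "pb sz t"
    using ptimeE[OF assms(2)] by metis
  obtain d u where d: "wfc d" "\<And>x r0 r1. run d [tcode x @ r0, r1, [], []] [tcode (?b x) @ r0, r1, [], []] (u x)" "pb sz u"
    using ptimeE[OF assms(3)] by metis
  obtain k where k: "\<And>x. u x \<le> (sz x + 2) ^ k" using d(3) unfolding pb_def by blast
  \<comment> \<open>The branch for nonempty lists runs on \<open>(x, y, ys)\<close>, whose size is
    \<open>sz x + sz (l x) + 1\<close>. This turns its running time into a function of
    \<open>x\<close>.\<close>
  define B where "B x = (sz x + sz (l x) + 3) ^ k" for x
  have B: "pb sz B" unfolding B_def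
    by (rule pb_comp[where m' = "\<lambda>n. n" and f = "\<lambda>x. sz x + sz (l x) + 3"])
      (intro pb_add pb_self ptime_sz assms pb_const, unfold pb_def, rule exI[of _ k], auto intro: power_mono)
  \<comment> \<open>The popped symbol tells the two cases apart. What is left of a nonempty list are
    the codes of \<open>y\<close> and \<open>ys\<close>; one pushed \<open>One\<close> makes a pair
    of them, and the other one pairs this with the restored \<open>x\<close>.\<close>
  let ?k = "\<lambda>s. if s = One then Seq (Push 0 One) (Seq restore (Seq (Push 0 One) d)) else Seq restore c"
  let ?r = "\<lambda>x. case l x of [] \<Rightarrow> a x | y # ys \<Rightarrow> b x y ys"
  show ?thesis
  proof (rule ptimeI)
    show "wfc (Seq dup (Seq e (Case 0 ?k)))" using e c d by (simp add: wfc_prims)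
    show "run (Seq dup (Seq e (Case 0 ?k))) [tcode x @ r0, r1, [], []] [tcode (?r x) @ r0, r1, [], []]
      (20 * sz x + (w x + (20 * sz x + t x + B x + 5 + 1) + 1) + 1)" for x r0 r1
    proof -
      have "run (?k (peek (tcode (l x) @ r0))) [tl (tcode (l x) @ r0), tcode x @ r1, [], []]
        [tcode (?r x) @ r0, r1, [], []] (20 * sz x + t x + B x + 5)"
      proof (cases "l x")
        case Nil
        have "run (Seq restore c) [r0, tcode x @ r1, [], []] [tcode (a x) @ r0, r1, [], []] (20 * sz x + t x + 1)"
          by (rule run_seq[OF run_tprims(2) c(2)])
        then show ?thesis using Nil by (auto elim: run_mono)
      next
        case (Cons y ys)
        have "run (Seq (Push 0 One) (Seq restore (Seq (Push 0 One) d))) [tcode y @ tcode ys @ r0, tcode x @ r1, [], []] [tcode (?b (x, y, ys)) @ r0, r1, [], []]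
           (1 + (20 * sz x + (1 + u (x, y, ys) + 1) + 1) + 1)"
          by (rule run_seq[OF run_push run_seq[OF run_tprims(2) run_seq[OF run_push d(2)]]]) (simp_all add: tcode_Pair)
        moreover have "u (x, y, ys) \<le> B x" using k[of "(x, y, ys)"] Cons by (simp add: B_def numeral_3_eq_3)
        ultimately show ?thesis using Cons by (auto simp del: sz_simps elim: run_mono)
      qed
      then have "run (Case 0 ?k) [tcode (l x) @ r0, tcode x @ r1, [], []]
        [tcode (?r x) @ r0, r1, [], []] (20 * sz x + t x + B x + 5 + 1)"
        by (intro run_case) auto
      then show ?thesis by (rule run_seq[OF run_tprims(3) run_seq[OF e(2)]])
    qed
    show "pb sz (\<lambda>x. 20 * sz x + (w x + (20 * sz x + t x + B x + 5 + 1) + 1) + 1)"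
      by (intro pb_add pb_prim pb_self pb_const e c B)
  qed
qed

text \<open>Truth values and natural numbers have the same codes as certain lists of units.\<close>

lemma ptime_if [ptime_intros]: assumes "ptime p" "ptime f" "ptime g" shows "ptime (\<lambda>x. if p x then f x else g x)"
proof -
  have 1: "ptime (\<lambda>x. if p x then [()] else [])"
    by (rule ptime_inj[OF _ assms(1)]) (simp add: enc_bool_def enc_unit_def)
  have "ptime (\<lambda>x. case if p x then [()] else [] of [] \<Rightarrow> g x | _ # _ \<Rightarrow> f x)"
    by (rule ptime_case_list[OF 1 assms(3)]) (intro ptime_comp[OF assms(2)] ptime_fst ptime_id)
  then show ?thesis by (rule ptime_cong) simp
qed

lemma ptime_case_nat [ptime_intros]:
  fixes a :: "'a::enc \<Rightarrow> 'c::enc"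
  assumes "ptime l" "ptime a" "ptime (\<lambda>p. b (fst p) (snd p))"
  shows "ptime (\<lambda>x. case l x of 0 \<Rightarrow> a x | Suc y \<Rightarrow> b x y)"
proof -
  have enc: "enc (replicate n ()) = enc n" for n
    by (induction n) (simp_all add: enc_unit_def)
  have enc2: "enc us = enc (length us)" for us :: "unit list"
    by (induction us) (simp_all add: enc_unit_def)
  have 1: "ptime (\<lambda>x. replicate (l x) ())"
    by (rule ptime_inj[OF _ assms(1)]) (simp add: enc)
  have 2: "ptime (\<lambda>p :: 'a \<times> unit \<times> unit list. length (snd (snd p)))"
    by (rule ptime_inj[where f = "\<lambda>p. snd (snd p)"]) (simp add: enc2, intro ptime_intros)
  have 3: "ptime (\<lambda>p :: 'a \<times> unit \<times> unit list. b (fst p) (length (snd (snd p))))"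
    using ptime_comp[OF assms(3) ptime_Pair[OF ptime_fst[OF ptime_id] 2]] by simp
  have "ptime (\<lambda>x. case replicate (l x) () of [] \<Rightarrow> a x | y # ys \<Rightarrow> b x (length ys))"
    by (rule ptime_case_list[OF 1 assms(2) 3])
  moreover have "(case replicate n () of [] \<Rightarrow> u | y # ys \<Rightarrow> v (length ys)) = (case n of 0 \<Rightarrow> u | Suc y \<Rightarrow> v y)" for n u and v :: "nat \<Rightarrow> 'c"
    by (cases n) simp_all
  ultimately show ?thesis by simp
qed

section \<open>Bounded iteration on the stack machine\<close>

lemma sz_nat: "sz (n :: nat) = 2 * n + 1"
  by (induction n) simp_all

text \<open>A single \<open>One\<close> on stack 3 requests another test. It is consumed before
  \<open>c\<close> runs, since \<open>c\<close> expects stacks 2 and 3 to be empty. The counter is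
  the list on stack 1, from which every round discards one element.\<close>

definition iter_loop :: "com \<Rightarrow> com" where
  "iter_loop c = Loop 3 (\<lambda>_. Case 1 (\<lambda>s. if s = One then Seq drop_aux (Seq c (Push 3 One)) else Skip))"

lemma run_iter_loop:
  fixes us :: "'c::enc list"
  assumes c: "\<And>x r0 r1. run c [tcode x @ r0, r1, [], []] [tcode (f x) @ r0, r1, [], []] (t x)"
  shows "(\<And>i. i < length us \<Longrightarrow> t ((f ^^ i) w) \<le> B) \<Longrightarrow>
    run (iter_loop c) [tcode w @ r0, tcode us @ r1, [], [One]] [tcode ((f ^^ length us) w) @ r0, r1, [], []]
     (20 * sz us + length us * (B + 10) + 5)"
proof (induction us arbitrary: w)
  case Nil
  have "run (Case 1 (\<lambda>s. if s = One then Seq drop_aux (Seq c (Push 3 One)) else Skip)) [tcode w @ r0, Zero # r1, [], []]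
    [tcode w @ r0, r1, [], []] (1 + 1)"
    by (rule run_case[OF refl]) (auto intro: run_skip)
  then have "run (iter_loop c) [tcode w @ r0, Zero # r1, [], [One]] [tcode w @ r0, r1, [], []] (1 + 1 + 1 + 1)"
    unfolding iter_loop_def by (intro run_loopS[OF _ _ _ run_loopE]) auto
  then show ?case by (auto elim: run_mono)
next
  case (Cons a us)
  have B: "t w \<le> B" using Cons.prems[of 0] by simp
  have "t ((f ^^ i) (f w)) \<le> B" if "i < length us" for i
    using Cons.prems[of "Suc i"] that by (simp add: funpow_swap1)
  from Cons.IH[OF this] have IH: "run (iter_loop c) [tcode (f w) @ r0, tcode us @ r1, [], [One]]
     [tcode ((f ^^ length us) (f w)) @ r0, r1, [], []] (20 * sz us + length us * (B + 10) + 5)" .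
  have "run (Seq drop_aux (Seq c (Push 3 One))) [tcode w @ r0, tcode a @ tcode us @ r1, [], []]
    [tcode (f w) @ r0, tcode us @ r1, [], [One]] (20 * sz a + (t w + 1 + 1) + 1)"
    by (rule run_seq[OF run_tprims(5) run_seq[OF c run_push]]) simp_all
  then have "run (Case 1 (\<lambda>s. if s = One then Seq drop_aux (Seq c (Push 3 One)) else Skip)) [tcode w @ r0, tcode (a # us) @ r1, [], []]
    [tcode (f w) @ r0, tcode us @ r1, [], [One]] (20 * sz a + (t w + 1 + 1) + 1 + 1)"
    by (intro run_case) auto
  then have "run (iter_loop c) [tcode w @ r0, tcode (a # us) @ r1, [], [One]] [tcode ((f ^^ length us) (f w)) @ r0, r1, [], []]
    (20 * sz a + (t w + 1 + 1) + 1 + 1 + (20 * sz us + length us * (B + 10) + 5) + 1)"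
    unfolding iter_loop_def by (intro run_loopS[OF _ _ _ IH[unfolded iter_loop_def]]) auto
  then show ?case using B by (auto simp: funpow_swap1 elim!: run_mono)
qed

lemma length_le_sz: "length xs < sz xs"
  by (induction xs) auto

text \<open>Without the bound \<open>p\<close> the intermediate values could grow exponentially, for
  instance when \<open>f\<close> doubles the size of its argument.\<close>

lemma ptime_funpow0:
  fixes h :: "'a::enc \<Rightarrow> 'b::enc" and g :: "'a \<Rightarrow> 'c::enc list" and f :: "'b \<Rightarrow> 'b"
  assumes "ptime f" "ptime g" "ptime h" and p: "pb sz p" and bound: "\<And>x i. i < length (g x) \<Longrightarrow> sz ((f ^^ i) (h x)) \<le> p x"
  shows "ptime (\<lambda>x. (f ^^ length (g x)) (h x))"
proof -
  obtain b w0 where b: "wfc b" "\<And>(x :: 'b) r0 r1. run b [tcode x @ r0, r1, [], []] [tcode (f x) @ r0, r1, [], []] (w0 x)" "pb sz w0"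
    using ptimeE[OF assms(1)] by metis
  obtain k where k: "\<And>x. w0 x \<le> (sz x + 2) ^ k" using b(3) unfolding pb_def by blast
  obtain c t where c: "wfc c" "\<And>x r0 r1. run c [tcode x @ r0, r1, [], []] [tcode (g x) @ r0, r1, [], []] (t x)" "pb sz t"
    using ptimeE[OF assms(2)] by metis
  obtain d u where d: "wfc d" "\<And>x r0 r1. run d [tcode x @ r0, r1, [], []] [tcode (h x) @ r0, r1, [], []] (u x)" "pb sz u"
    using ptimeE[OF assms(3)] by metis
  let ?B = "\<lambda>x. (p x + 2) ^ k"
  have pB: "pb sz ?B"
    by (rule pb_comp[where m' = "\<lambda>n. n" and f = p]) (use p in \<open>auto simp: pb_def\<close>)
  let ?prog = "Seq dup (Seq d (Seq restore (Seq c (Seq save (Seq (Push 3 One) (iter_loop b))))))"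
  let ?t = "\<lambda>x. 20 * sz x + (u x + (20 * sz x + (t x + (20 * sz (g x) + (1 + (20 * sz (g x) + sz (g x) * (?B x + 10) + 5) + 1) + 1) + 1) + 1) + 1) + 1"
  show ?thesis
  proof (rule ptimeI)
    show "wfc ?prog" using b c d by (simp add: wfc_prims iter_loop_def)
    show "run ?prog [tcode x @ r0, r1, [], []] [tcode ((f ^^ length (g x)) (h x)) @ r0, r1, [], []] (?t x)" for x r0 r1
    proof -
      have "w0 ((f ^^ i) (h x)) \<le> ?B x" if "i < length (g x)" for i
        by (rule order_trans[OF k power_mono]) (use bound[OF that] in auto)
      from run_iter_loop[where f = f and t = w0 and us = "g x" and w = "h x" and B = "?B x", OF b(2) this]
      have R: "run (iter_loop b) [tcode (h x) @ r0, tcode (g x) @ r1, [], [One]] [tcode ((f ^^ length (g x)) (h x)) @ r0, r1, [], []]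
        (20 * sz (g x) + sz (g x) * (?B x + 10) + 5)"
        by (rule run_mono) (use length_le_sz[of "g x"] in \<open>auto intro: mult_right_mono\<close>)
      have P: "run (Push 3 One) [tcode (h x) @ r0, tcode (g x) @ r1, [], []] [tcode (h x) @ r0, tcode (g x) @ r1, [], [One]] 1"
        by (rule run_push) simp_all
      show ?thesis
        by (rule run_seq[OF run_tprims(3) run_seq[OF d(2) run_seq[OF run_tprims(2) run_seq[OF c(2) run_seq[OF run_tprims(1) run_seq[OF P R]]]]]])
    qed
    show "pb sz ?t"
      by (intro pb_add pb_prim pb_self pb_const c d pb_mult ptime_sz assms pB)
  qed
qed

subsection \<open>Iteration and list functions\<close>

text \<open>The parameter \<open>x\<close> of the loop body travels along as a component of the
  state.\<close>

lemma ptime_funpow_list: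
  fixes F :: "'a::enc \<Rightarrow> 'b::enc \<Rightarrow> 'b" and l :: "'a \<Rightarrow> 'c::enc list"
  assumes "ptime l" "ptime h" "ptime (\<lambda>p. F (fst p) (snd p))" "pb sz B"
    and B: "\<And>x i. i \<le> length (l x) \<Longrightarrow> sz ((F x ^^ i) (h x)) \<le> B x"
  shows "ptime (\<lambda>x. (F x ^^ length (l x)) (h x))"
proof -
  let ?f = "\<lambda>p. (fst p, F (fst p) (snd p))"
  have f: "(?f ^^ i) (x, s) = (x, (F x ^^ i) s)" for i x s
    by (induction i) simp_all
  have "ptime (\<lambda>x. (?f ^^ length (l x)) (x, h x))"
  proof (rule ptime_funpow0)
    show "pb sz (\<lambda>x. sz x + B x + 1)" by (intro pb_add pb_self pb_const assms)
    show "sz ((?f ^^ i) (x, h x)) \<le> sz x + B x + 1" if "i < length (l x)" for x i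
      using B[of i x] that by (simp add: f)
  qed (intro ptime_intros assms)+
  from ptime_snd[OF this] show ?thesis by (simp add: f)
qed

lemma ptime_funpow:
  fixes F :: "'a::enc \<Rightarrow> 'b::enc \<Rightarrow> 'b"
  assumes "ptime n" "ptime h" "ptime (\<lambda>p. F (fst p) (snd p))" "pb sz B"
    and B: "\<And>x i. i \<le> n x \<Longrightarrow> sz ((F x ^^ i) (h x)) \<le> B x"
  shows "ptime (\<lambda>x. (F x ^^ n x) (h x))"
proof -
  have enc: "enc (replicate n ()) = enc n" for n
    by (induction n) (simp_all add: enc_unit_def)
  have 1: "ptime (\<lambda>x. replicate (n x) ())"
    by (rule ptime_inj[OF _ assms(1)]) (simp add: enc)
  from ptime_funpow_list[OF this assms(2,3,4)] B show ?thesis by simp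
qed

lemma sz_funpow:
  fixes F :: "'a::enc \<Rightarrow> 'a"
  assumes "\<And>s. sz (F s) \<le> sz s + G" shows "sz ((F ^^ i) h) \<le> sz h + i * G"
proof (induction i)
  case (Suc i)
  then show ?case using assms[of "(F ^^ i) h"] by simp
qed simp

lemma ptime_funpow_grow:
  fixes F :: "'a::enc \<Rightarrow> 'b::enc \<Rightarrow> 'b"
  assumes "ptime n" "ptime h" "ptime (\<lambda>p. F (fst p) (snd p))" "pb sz G"
    and G: "\<And>x s. sz (F x s) \<le> sz s + G x"
  shows "ptime (\<lambda>x. (F x ^^ n x) (h x))"
proof (rule ptime_funpow[OF assms(1-3)])
  show "pb sz (\<lambda>x. sz (h x) + sz (n x) * G x)" by (intro pb_add pb_mult ptime_sz assms)
  show "sz ((F x ^^ i) (h x)) \<le> sz (h x) + sz (n x) * G x" if "i \<le> n x" for x i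
    by (rule order_trans[OF sz_funpow[OF G]]) (use that in \<open>auto simp only: sz_nat intro!: add_mono mult_right_mono\<close>)
qed

lemma sz_mem: "y \<in> set l \<Longrightarrow> sz y < sz l"
  by (induction l) auto

lemma sz_foldl:
  assumes "\<And>y s. y \<in> set l \<Longrightarrow> sz (F s y) \<le> sz s + G" shows "sz (foldl F h l) \<le> sz h + length l * G"
  using assms
proof (induction l arbitrary: h)
  case (Cons y l)
  have "sz (foldl F (F h y) l) \<le> sz (F h y) + length l * G" by (rule Cons.IH) (use Cons.prems in auto)
  then show ?case using Cons.prems[of y h] by simp
qed simp

lemma sz_drop: "sz (drop i l) \<le> sz l"
proof (induction l arbitrary: i)
  case (Cons x l)
  then show ?case by (cases i) (auto simp: le_SucI trans_le_add2)
qed simp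

text \<open>This iterates a step on the pair of the remaining list and the accumulator. Exponential
  growth is excluded because each step adds at most \<open>G x\<close>, independently of the
  accumulator.\<close>

lemma ptime_foldl:
  fixes F :: "'a::enc \<Rightarrow> 'b::enc \<Rightarrow> 'c::enc \<Rightarrow> 'b"
  assumes l: "ptime l" and h: "ptime h" and F: "ptime (\<lambda>p. F (fst p) (fst (snd p)) (snd (snd p)))" and G: "pb sz G"
    and grow: "\<And>x y s. y \<in> set (l x) \<Longrightarrow> sz (F x s y) \<le> sz s + G x"
  shows "ptime (\<lambda>x. foldl (F x) (h x) (l x))"
proof -
  define S where "S = (\<lambda>x (p :: 'c list \<times> 'b). case fst p of [] \<Rightarrow> ([], snd p) | y # ys \<Rightarrow> (ys, F x (snd p) y))"
  have S: "i \<le> length l \<Longrightarrow> (S x ^^ i) (l, a) = (drop i l, foldl (F x) a (take i l))" for i x l a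
  proof (induction i)
    case (Suc i)
    then show ?case by (simp add: S_def take_Suc_conv_app_nth flip: Cons_nth_drop_Suc)
  qed simp
  have 1: "ptime (\<lambda>q :: ('a \<times> 'c list \<times> 'b) \<times> 'c \<times> 'c list. F (fst (fst q)) (snd (snd (fst q))) (fst (snd q)))"
  proof -
    have "ptime (\<lambda>q :: ('a \<times> 'c list \<times> 'b) \<times> 'c \<times> 'c list. (fst (fst q), snd (snd (fst q)), fst (snd q)))"
      by (intro ptime_intros)
    from ptime_comp[OF F this] show ?thesis by simp
  qed
  have "ptime (\<lambda>p. S (fst p) (snd p))"
    unfolding S_def by (intro ptime_intros 1)
  moreover have "pb sz (\<lambda>x. sz (l x) + sz (h x) + sz (l x) * G x + 1)"
    by (intro pb_add pb_mult ptime_sz assms pb_const)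
  moreover have "sz ((S x ^^ i) (l x, h x)) \<le> sz (l x) + sz (h x) + sz (l x) * G x + 1" if "i \<le> length (l x)" for x i
  proof -
    have "sz (foldl (F x) (h x) (take i (l x))) \<le> sz (h x) + length (take i (l x)) * G x"
      by (rule sz_foldl) (use grow in_set_takeD in metis)
    moreover have "length (take i (l x)) * G x \<le> sz (l x) * G x"
      using length_le_sz[of "l x"] by (intro mult_right_mono) auto
    moreover have "sz ((S x ^^ i) (l x, h x)) = Suc (sz (drop i (l x)) + sz (foldl (F x) (h x) (take i (l x))))"
      by (simp add: S that)
    ultimately show ?thesis using sz_drop[of i "l x"] by linarith
  qed
  ultimately have "ptime (\<lambda>x. (S x ^^ length (l x)) (l x, h x))"
    by (intro ptime_funpow_list[where B = "\<lambda>x. sz (l x) + sz (h x) + sz (l x) * G x + 1"] ptime_Pair l h)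
  from ptime_snd[OF this] show ?thesis by (simp add: S)
qed

lemma pb_elem:
  assumes "ptime l" "pb sz t"
  obtains G where "pb sz G" "\<And>x y. y \<in> set (l x) \<Longrightarrow> t (x, y) \<le> G x"
proof -
  obtain k where k: "\<And>p. t p \<le> (sz p + 2) ^ k" using assms(2) unfolding pb_def by blast
  have "pb sz (\<lambda>x. (sz x + sz (l x) + 3) ^ k)"
    by (rule pb_comp[where m' = "\<lambda>n. n" and f = "\<lambda>x. sz x + sz (l x) + 3"])
      (intro pb_add pb_self ptime_sz assms pb_const, unfold pb_def, rule exI[of _ k], auto intro: power_mono)
  moreover have "t (x, y) \<le> (sz x + sz (l x) + 3) ^ k" if "y \<in> set (l x)" for x y
    by (rule order_trans[OF k power_mono]) (use sz_mem[OF that] in auto)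
  ultimately show ?thesis using that by blast
qed

section \<open>List functions, connectives and unary arithmetic\<close>

lemma ptime_rev [ptime_intros]:
  assumes "ptime l" shows "ptime (\<lambda>x. rev (l x))"
proof -
  have "ptime (\<lambda>x. foldl (\<lambda>acc y. y # acc) [] (l x))"
    by (rule ptime_foldl[where G = "\<lambda>x. sz (l x)"]) ((intro ptime_intros assms ptime_sz)+, auto dest!: sz_mem)
  moreover have "foldl (\<lambda>acc y. y # acc) a xs = rev xs @ a" for xs a :: "'b list"
    by (induction xs arbitrary: a) simp_all
  ultimately show ?thesis by simp
qed

lemma ptime_append [ptime_intros]:
  assumes "ptime l" "ptime k" shows "ptime (\<lambda>x. l x @ k x)"
proof -
  have "ptime (\<lambda>x. foldl (\<lambda>acc y. y # acc) (k x) (rev (l x)))"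
    by (rule ptime_foldl[where G = "\<lambda>x. sz (l x)"]) ((intro ptime_intros assms ptime_sz)+, auto dest!: sz_mem)
  moreover have "foldl (\<lambda>acc y. y # acc) a xs = rev xs @ a" for xs a :: "'b list"
    by (induction xs arbitrary: a) simp_all
  ultimately show ?thesis by simp
qed

lemma ptime_map [ptime_intros]:
  fixes f :: "'a::enc \<Rightarrow> 'b::enc \<Rightarrow> 'c::enc"
  assumes "ptime (\<lambda>p. f (fst p) (snd p))" "ptime l" shows "ptime (\<lambda>x. map (f x) (l x))"
proof -
  obtain G where G: "pb sz G" "\<And>x y. y \<in> set (l x) \<Longrightarrow> sz (f x y) \<le> G x"
    using pb_elem[OF assms(2) ptime_sz[OF assms(1)]] by auto
  have 1: "ptime (\<lambda>p :: 'a \<times> 'c list \<times> 'b. f (fst p) (snd (snd p)))"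
    using ptime_comp[OF assms(1), where g = "\<lambda>p :: 'a \<times> 'c list \<times> 'b. (fst p, snd (snd p))"] by (simp add: ptime_intros)
  have "ptime (\<lambda>x. foldl (\<lambda>acc y. f x y # acc) [] (l x))"
    by (rule ptime_foldl[where G = "\<lambda>x. G x + 1"]) ((intro ptime_intros assms 1 pb_add pb_const G)+, use G(2) in auto)
  moreover have "foldl (\<lambda>acc y. f x y # acc) a xs = rev (map (f x) xs) @ a" for x xs a
    by (induction xs arbitrary: a) simp_all
  ultimately have "ptime (\<lambda>x. rev (map (f x) (l x)))" by simp
  from ptime_rev[OF this] show ?thesis by simp
qed

lemma ptime_filter [ptime_intros]:
  fixes f :: "'a::enc \<Rightarrow> 'b::enc \<Rightarrow> bool"
  assumes "ptime (\<lambda>p. f (fst p) (snd p))" "ptime l" shows "ptime (\<lambda>x. filter (f x) (l x))"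
proof -
  have 1: "ptime (\<lambda>p :: 'a \<times> 'b list \<times> 'b. f (fst p) (snd (snd p)))"
    using ptime_comp[OF assms(1), where g = "\<lambda>p :: 'a \<times> 'b list \<times> 'b. (fst p, snd (snd p))"] by (simp add: ptime_intros)
  have "ptime (\<lambda>x. foldl (\<lambda>acc y. if f x y then y # acc else acc) [] (l x))"
    by (rule ptime_foldl[where G = "\<lambda>x. sz (l x)"]) ((intro ptime_intros assms 1 ptime_sz)+, auto dest!: sz_mem)
  moreover have "foldl (\<lambda>acc y. if f x y then y # acc else acc) a xs = rev (filter (f x) xs) @ a" for x xs a
    by (induction xs arbitrary: a) simp_all
  ultimately have "ptime (\<lambda>x. rev (filter (f x) (l x)))" by simp
  from ptime_rev[OF this] show ?thesis by simp
qed

lemma sz_append: "sz (xs @ ys) + 1 = sz xs + sz ys"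
  by (induction xs) simp_all

lemma ptime_concat [ptime_intros]:
  assumes "ptime l" shows "ptime (\<lambda>x. concat (l x))"
proof -
  have "sz (s @ y) \<le> sz s + sz (l x)" if "y \<in> set (l x)" for s y x
    using sz_append[of s y] sz_mem[OF that] by linarith
  then have "ptime (\<lambda>x. foldl (\<lambda>acc y. acc @ y) [] (l x))"
    by (intro ptime_foldl[where G = "\<lambda>x. sz (l x)"] ptime_intros assms ptime_sz)
  moreover have "foldl (\<lambda>acc y. acc @ y) a xs = a @ concat xs" for xs and a :: "'b list"
    by (induction xs arbitrary: a) simp_all
  ultimately show ?thesis by simp
qed

lemma ptime_length [ptime_intros]:
  assumes "ptime l" shows "ptime (\<lambda>x. length (l x))"
proof -
  have "ptime (\<lambda>x. foldl (\<lambda>acc y. Suc acc) 0 (l x))"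
    by (rule ptime_foldl[where G = "\<lambda>x. 2"]) ((intro ptime_intros assms pb_const)+, auto)
  moreover have "foldl (\<lambda>acc y. Suc acc) a xs = a + length xs" for xs :: "'b list" and a
    by (induction xs arbitrary: a) simp_all
  ultimately show ?thesis by simp
qed

lemma ptime_not [ptime_intros]: "ptime f \<Longrightarrow> ptime (\<lambda>x. \<not> f x)"
  by (rule ptime_cong[OF ptime_if[OF _ ptime_const[of False] ptime_const[of True]]]) auto

lemma ptime_conj [ptime_intros]: "ptime f \<Longrightarrow> ptime g \<Longrightarrow> ptime (\<lambda>x. f x \<and> g x)"
  by (rule ptime_cong[OF ptime_if[OF _ _ ptime_const[of False]], of f g]) auto

lemma ptime_disj [ptime_intros]: "ptime f \<Longrightarrow> ptime g \<Longrightarrow> ptime (\<lambda>x. f x \<or> g x)"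
  by (rule ptime_cong[OF ptime_if[OF _ ptime_const[of True]], of f g]) auto

lemma ptime_null [ptime_intros]: "ptime l \<Longrightarrow> ptime (\<lambda>x. l x = [])"
  by (rule ptime_cong[OF ptime_case_list[OF _ ptime_const[of True] ptime_const[of False]], of l]) (auto split: list.splits)

lemma ptime_list_ex [ptime_intros]:
  assumes "ptime (\<lambda>p. f (fst p) (snd p))" "ptime l" shows "ptime (\<lambda>x. list_ex (f x) (l x))"
proof -
  have "list_ex P xs \<longleftrightarrow> \<not> filter P xs = []" for P and xs :: "'b list"
    by (auto simp: list_ex_iff filter_empty_conv)
  then show ?thesis using ptime_not[OF ptime_null[OF ptime_filter[OF assms]]] by simp
qed

lemma ptime_list_all [ptime_intros]:
  assumes "ptime (\<lambda>p. f (fst p) (snd p))" "ptime l" shows "ptime (\<lambda>x. list_all (f x) (l x))"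
proof -
  have "list_all P xs \<longleftrightarrow> filter (\<lambda>y. \<not> P y) xs = []" for P and xs :: "'b list"
    by (auto simp: list_all_iff filter_empty_conv)
  then show ?thesis using ptime_null[OF ptime_filter[OF ptime_not[OF assms(1)] assms(2)]] by simp
qed

lemma ptime_minus [ptime_intros]: assumes "ptime f" "ptime g" shows "ptime (\<lambda>x. f x - g x :: nat)"
proof -
  have "ptime (\<lambda>x. ((\<lambda>s. case s of 0 \<Rightarrow> 0 | Suc m \<Rightarrow> m) ^^ g x) (f x))"
    by (rule ptime_funpow_grow[where G = "\<lambda>_. 0"]) ((intro ptime_intros assms pb_const)+, auto simp: sz_nat split: nat.splits)
  moreover have "((\<lambda>s. case s of 0 \<Rightarrow> 0 | Suc m \<Rightarrow> m) ^^ b) a = a - b" for a b :: nat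
    by (induction b) (auto split: nat.splits)
  ultimately show ?thesis by simp
qed

lemma ptime_plus [ptime_intros]: assumes "ptime f" "ptime g" shows "ptime (\<lambda>x. f x + g x :: nat)"
proof -
  have "ptime (\<lambda>x. (Suc ^^ g x) (f x))"
    by (rule ptime_funpow_grow[where G = "\<lambda>_. 2"]) ((intro ptime_intros assms pb_const)+, auto simp: sz_nat)
  then show ?thesis by (simp add: Suc_funpow add.commute)
qed

lemma ptime_times [ptime_intros]: assumes "ptime f" "ptime g" shows "ptime (\<lambda>x. f x * g x :: nat)"
proof -
  have "ptime (\<lambda>x. ((\<lambda>s. s + f x) ^^ g x) 0)"
  proof (rule ptime_funpow_grow[where G = "\<lambda>x. sz (f x)"])
    show "ptime (\<lambda>p. snd p + f (fst p))" by (intro ptime_intros ptime_comp[OF assms(1)])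
  qed ((intro ptime_intros assms ptime_sz)+, auto simp: sz_nat)
  moreover have "((\<lambda>s. s + a) ^^ b) 0 = a * b" for a b :: nat
    by (induction b) auto
  ultimately show ?thesis by simp
qed

lemma ptime_eq0: "ptime f \<Longrightarrow> ptime (\<lambda>x. f x = (0 :: nat))"
  by (rule ptime_cong[OF ptime_case_nat[OF _ ptime_const[of True] ptime_const[of False]], of f]) (auto split: nat.splits)

lemma ptime_le [ptime_intros]: "ptime f \<Longrightarrow> ptime g \<Longrightarrow> ptime (\<lambda>x. f x \<le> (g x :: nat))"
  using ptime_eq0[OF ptime_minus, of f g] by simp

lemma ptime_less [ptime_intros]: "ptime f \<Longrightarrow> ptime g \<Longrightarrow> ptime (\<lambda>x. f x < (g x :: nat))"
  using ptime_le[OF ptime_Suc, of f g] by (simp add: Suc_le_eq)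

lemma ptime_eq [ptime_intros]: "ptime f \<Longrightarrow> ptime g \<Longrightarrow> ptime (\<lambda>x. f x = (g x :: nat))"
  using ptime_conj[OF ptime_le ptime_le, of f g g f] by (simp add: order_eq_iff)

lemma ptime_drop [ptime_intros]: assumes "ptime n" "ptime l" shows "ptime (\<lambda>x. drop (n x) (l x))"
proof -
  have "ptime (\<lambda>x. ((\<lambda>s. case s of [] \<Rightarrow> [] | y # ys \<Rightarrow> ys) ^^ n x) (l x))"
    by (rule ptime_funpow_grow[where G = "\<lambda>_. 0"]) ((intro ptime_intros assms pb_const)+, auto split: list.splits)
  moreover have "((\<lambda>s. case s of [] \<Rightarrow> [] | y # ys \<Rightarrow> ys) ^^ i) xs = drop i xs" for i and xs :: "'b list"
  proof (induction i)
    case (Suc i)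
    have "drop (Suc i) xs = tl (drop i xs)" by (simp add: drop_Suc drop_tl)
    then show ?case using Suc by (auto split: list.splits)
  qed simp
  ultimately show ?thesis by simp
qed

lemma ptime_upt [ptime_intros]: assumes "ptime n" shows "ptime (\<lambda>x. [0..<n x])"
proof -
  let ?F = "\<lambda>p. (Suc (fst p), fst p # snd p)"
  have F: "(?F ^^ i) (0, []) = (i, rev [0..<i])" for i
    by (induction i) simp_all
  have s: "sz (rev [0..<i]) \<le> 1 + i * (2 * i + 2)" for i
  proof (induction i)
    case (Suc i)
    have "i * (2 * i + 2) + (2 * i + 2) \<le> Suc i * (2 * Suc i + 2)" by simp
    then show ?case using Suc by (simp add: sz_nat)
  qed simp
  have s2: "sz (i, rev [0..<i]) \<le> 2 * sz n + (sz n * (2 * sz n + 2)) + 5" if "i \<le> n" for i n :: nat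
  proof -
    have "i * (2 * i + 2) \<le> sz n * (2 * sz n + 2)" using that by (intro mult_mono) (auto simp: sz_nat)
    moreover have "i \<le> sz n" using that by (simp add: sz_nat)
    ultimately show ?thesis using s[of i] sz_simps(1)[of i "rev [0..<i]"] sz_nat[of i] by linarith
  qed
  have "ptime (\<lambda>x. (?F ^^ n x) (0, []))"
    by (rule ptime_funpow[where B = "\<lambda>x. 2 * sz (n x) + (sz (n x) * (2 * sz (n x) + 2)) + 5"], unfold F)
      (intro ptime_intros assms pb_add pb_mult pb_const ptime_sz s2, assumption?)+
  then show ?thesis unfolding F using ptime_rev[OF ptime_snd] by force
qed

text \<open>The input is reversed onto stack 2 and read back, so its order is kept. The pushed words
  are a \<open>One\<close> for the list constructor followed by the code of \<open>True\<close> or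
  \<open>False\<close>; from here on \<open>Zero\<close> and \<open>Sep\<close> are no longer told
  apart.\<close>

definition read_input :: com where
  "read_input = Seq (Loop 0 (\<lambda>s. Push 2 (to_bit s))) (Seq (Push 0 Zero)
     (Loop 2 (\<lambda>s. if s = One then push_list [One, One, Zero, Zero] else push_list [One, Zero])))"

lemma run_read_input:
  "run read_input [x, [], [], []] [tcode (map (\<lambda>s. s = One) x), [], [], []] (13 * length x + 5)"
proof -
  have 1: "run (Loop 0 (\<lambda>s. Push 2 (to_bit s))) [x, [], q, []] [[], [], rev (map to_bit x) @ q, []] (2 * length x + 1)" for q
  proof (induction x arbitrary: q)
    case Nil
    then show ?case by (auto intro!: run_mono[OF run_loopE])
  next
    case (Cons a x)
    have "run (Push 2 (to_bit a)) [x, [], q, []] [x, [], to_bit a # q, []] 1" by (rule run_push) simp_all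
    from run_loopS[OF _ _ this Cons[of "to_bit a # q"], where s = "[a # x, [], q, []]"]
    have "run (Loop 0 (\<lambda>s. Push 2 (to_bit s))) [a # x, [], q, []] [[], [], rev (map to_bit (a # x)) @ q, []] (1 + (2 * length x + 1) + 1)"
      by simp
    then show ?case by (rule run_mono) simp
  qed
  let ?f = "\<lambda>s. if s = One then push_list [One, One, Zero, Zero] else push_list [One, Zero]"
  have 2: "run (Loop 2 ?f) [tcode l, [], w, []] [tcode (rev (map (\<lambda>s. s = One) w) @ l), [], [], []] (10 * length w + 1)" for w l
  proof (induction w arbitrary: l)
    case Nil
    then show ?case by (auto intro!: run_mono[OF run_loopE])
  next
    case (Cons a w)
    have "run (?f a) [tcode l, [], w, []] [tcode ((a = One) # l), [], w, []] 9"
    proof (cases "a = One")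
      case True
      have P: "run (Push 0 c) [z, [], w, []] [c # z, [], w, []] 1" for c z by (rule run_push) simp_all
      have "run (push_list [One, One, Zero, Zero]) [tcode l, [], w, []] [One # One # Zero # Zero # tcode l, [], w, []]
        (1 + 1 + 1 + 1 + 1 + 1 + 1 + 1 + 1)" unfolding push_list.simps
        by (rule run_seq[OF run_seq[OF run_seq[OF run_seq[OF run_skip[OF order_refl] P] P] P] P])
      then show ?thesis using True by (auto simp: enc_bool_def elim: run_mono)
    next
      case False
      have P: "run (Push 0 c) [z, [], w, []] [c # z, [], w, []] 1" for c z by (rule run_push) simp_all
      have "run (push_list [One, Zero]) [tcode l, [], w, []] [One # Zero # tcode l, [], w, []]
        (1 + 1 + 1 + 1 + 1)" unfolding push_list.simps
        by (rule run_seq[OF run_seq[OF run_skip[OF order_refl] P] P])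
      then show ?thesis using False by (auto simp: enc_bool_def elim: run_mono)
    qed
    from run_loopS[OF _ _ this Cons[of "(a = One) # l"], where s = "[tcode l, [], a # w, []]"]
    have "run (Loop 2 ?f) [tcode l, [], a # w, []] [tcode (rev (map (\<lambda>s. s = One) (a # w)) @ l), [], [], []] (9 + (10 * length w + 1) + 1)"
      by simp
    then show ?case by (rule run_mono) simp
  qed
  have 3: "run (Push 0 Zero) [[], [], w, []] [tcode ([] :: bool list), [], w, []] 1" for w
    by (rule run_push) simp_all
  have "rev (map (\<lambda>s. s = One) (rev (map to_bit x) @ [])) @ [] = map (\<lambda>s. s = One) x"
    by (simp add: rev_map to_bit_def comp_def)
  then have "run (Loop 2 ?f) [tcode ([] :: bool list), [], rev (map to_bit x) @ [], []] [tcode (map (\<lambda>s. s = One) x), [], [], []] (10 * length x + 1)"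
    using 2[of "[]" "rev (map to_bit x) @ []"] by simp
  then have "run read_input [x, [], [], []] [tcode (map (\<lambda>s. s = One) x), [], [], []] (2 * length x + 1 + (1 + (10 * length x + 1) + 1) + 1)"
    unfolding read_input_def by (rule run_seq[OF 1 run_seq[OF 3]])
  then show ?thesis by (rule run_mono) simp
qed

theorem ptime_decidable_by_tm:
  fixes f :: "bool list \<Rightarrow> bool"
  assumes "ptime f"
  obtains M c d where "tm_wf M"
    "\<And>x. Blank \<notin> set x \<Longrightarrow> decides_within M (c * length x ^ d + c) x (f (map (\<lambda>s. s = One) x))"
proof -
  obtain b t where b: "wfc b" "\<And>x r0 r1. run b [tcode x @ r0, r1, [], []] [tcode (f x) @ r0, r1, [], []] (t x)" "pb sz t"
    using ptimeE[OF assms] by metis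
  let ?m = "\<lambda>x. map (\<lambda>s. s = One) x"
  have "sz (?m x) \<le> 4 * length x + 1" for x
    by (induction x) (auto simp: sz_def enc_bool_def)
  then have "pb length (\<lambda>x. sz (?m x))"
    by (rule pb_mono[rotated]) (intro pb_add pb_mult pb_const pb_self)
  then have "pb length (\<lambda>x. t (?m x))" using b(3) by (rule pb_comp)
  then have "pb length (\<lambda>x. 13 * length x + 5 + t (?m x) + 1)" by (intro pb_add pb_mult pb_const pb_self)
  then obtain k where k: "\<And>x. 13 * length x + 5 + t (?m x) + 1 \<le> (length x + 2) ^ k" unfolding pb_def by blast
  have "computes_bool (Seq read_input b) (\<lambda>x. f (?m x))"
    unfolding computes_bool_def
  proof (rule conjI, goal_cases)
    case 1
    show ?case using b by (simp add: read_input_def)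
  next
    case 2
    show ?case
    proof (rule exI[of _ k], intro allI impI)
    fix x :: "sym list"
    have "run (Seq read_input b) [x, [], [], []] [tcode (f (?m x)) @ [], [], [], []] (13 * length x + 5 + t (?m x) + 1)"
      by (rule run_seq[OF run_read_input]) (use b(2)[of "?m x" "[]" "[]"] in simp)
    then have "run (Seq read_input b) [x, [], [], []] [tcode (f (?m x)), [], [], []] ((length x + 2) ^ k)"
      using run_mono[OF _ k] by simp
    then obtain n where "n \<le> (length x + 2) ^ k" "exec (Seq read_input b) [x, [], [], []] n [tcode (f (?m x)), [], [], []]"
      unfolding run_def by blast
    moreover have "f (?m x) \<longleftrightarrow> peek ([tcode (f (?m x)), [], [], []] ! 0) = One"
      by (simp add: enc_bool_def)
    ultimately show "\<exists>n s. n \<le> (length x + 2) ^ k \<and> exec (Seq read_input b) [x, [], [], []] n s \<and> (f (?m x) \<longleftrightarrow> peek (s ! 0) = One)"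
      by blast
    qed
  qed
  then show ?thesis using stack_program_to_tm that by blast
qed

section \<open>Maximum matchings by local search\<close>

text \<open>A matching is represented by the involution that maps every vertex to its partner, unmatched
vertices being fixed.\<close>

definition mt :: "nat set \<Rightarrow> (nat \<Rightarrow> nat \<Rightarrow> bool) \<Rightarrow> (nat \<Rightarrow> nat) \<Rightarrow> bool" where
  "mt V E X \<longleftrightarrow> (\<forall>v\<in>V. X v \<in> V \<and> X (X v) = v \<and> (X v \<noteq> v \<longrightarrow> E v (X v)))"

definition msz :: "nat set \<Rightarrow> (nat \<Rightarrow> nat) \<Rightarrow> nat" where
  "msz V X = card {v \<in> V. v < X v}"

definition restr :: "nat set \<Rightarrow> (nat \<Rightarrow> nat) \<Rightarrow> nat \<Rightarrow> nat" where
  "restr s X = (\<lambda>w. if w \<in> s \<or> X w \<in> s then w else X w)"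

definition addp :: "nat \<Rightarrow> nat \<Rightarrow> (nat \<Rightarrow> nat) \<Rightarrow> nat \<Rightarrow> nat" where
  "addp u v X = (\<lambda>w. if w = u then v else if w = v then u else X w)"

definition swp :: "nat set \<Rightarrow> (nat \<Rightarrow> nat) \<Rightarrow> (nat \<Rightarrow> nat) \<Rightarrow> nat \<Rightarrow> nat" where
  "swp K X Y = (\<lambda>w. if w \<in> K then Y w else X w)"

text \<open>The component of the symmetric difference of two matchings that contains \<open>t\<close>.\<close>

definition orb :: "(nat \<Rightarrow> nat) \<Rightarrow> (nat \<Rightarrow> nat) \<Rightarrow> nat \<Rightarrow> nat set" where
  "orb X Y t = (\<Union>j. {((Y \<circ> X) ^^ j) t, X (((Y \<circ> X) ^^ j) t)})"

section \<open>Elementary operations on matchings\<close>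

lemma msz_cong: "(\<And>v. v \<in> V \<Longrightarrow> X v = Y v) \<Longrightarrow> msz V X = msz V Y"
  unfolding msz_def by (metis (mono_tags, lifting) Collect_cong)

lemma restr_restr: "restr s (restr r X) = restr (s \<union> r) X"
  by (auto simp: restr_def)

lemma restr_missed: "mt V E X \<Longrightarrow> (\<And>w. w \<in> s \<Longrightarrow> X w = w) \<Longrightarrow> v \<in> V \<Longrightarrow> restr s X v = X v"
  by (auto simp: restr_def mt_def)

lemma mt_restr: "mt V E X \<Longrightarrow> mt V E (restr s X)"
  by (auto simp: mt_def restr_def)

lemma msz_restr_single:
  assumes "finite V" "mt V E X" "v \<in> V"
  shows "msz V X \<le> msz V (restr {v} X) + 1"
proof -
  \<comment> \<open>Edges are counted at their smaller end, and only the edge at \<open>v\<close>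
    disappears.\<close>
  have "{w \<in> V. w < X w} \<subseteq> {w \<in> V. w < restr {v} X w} \<union> {min v (X v)}"
    using assms by (auto simp: mt_def restr_def min_def)
  then have "msz V X \<le> card ({w \<in> V. w < restr {v} X w} \<union> {min v (X v)})"
    unfolding msz_def using assms by (intro card_mono) auto
  also have "\<dots> \<le> msz V (restr {v} X) + 1"
    unfolding msz_def using card_Un_le[of "{w \<in> V. w < restr {v} X w}" "{min v (X v)}"] by simp
  finally show ?thesis .
qed

lemma msz_restr:
  assumes "finite V" "mt V E X" "s \<subseteq> V"
  shows "msz V X \<le> msz V (restr s X) + card s"
proof -
  have "finite s" using assms finite_subset by blast
  then show ?thesis using assms(3)
  proof (induction s rule: finite_induct)
    case empty
    then show ?case using msz_cong[of V "restr {} X" X] by (simp add: restr_def)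
  next
    case (insert v s)
    then show ?case
      using msz_restr_single[OF assms(1) mt_restr[OF assms(2)], of v s] by (simp add: restr_restr)
  qed
qed

lemma mt_addp:
  assumes "mt V E X" "u \<in> V" "v \<in> V" "u \<noteq> v" "E u v" "E v u" "X u = u" "X v = v"
  shows "mt V E (addp u v X)"
  using assms unfolding mt_def addp_def by auto

lemma msz_addp:
  assumes "finite V" "mt V E X" "u \<in> V" "v \<in> V" "u \<noteq> v" "X u = u" "X v = v"
  shows "msz V (addp u v X) = msz V X + 1"
proof -
  have "{w \<in> V. w < addp u v X w} = insert (min u v) {w \<in> V. w < X w}"
    using assms by (auto simp: addp_def min_def)
  moreover have "min u v \<notin> {w \<in> V. w < X w}" using assms by (auto simp: min_def)
  ultimately show ?thesis unfolding msz_def using assms(1) by simp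
qed

lemma mt_swp:
  assumes "mt V E X" "mt V E Y" "K \<subseteq> V" "\<And>v. v \<in> K \<Longrightarrow> X v \<in> K" "\<And>v. v \<in> K \<Longrightarrow> Y v \<in> K"
  shows "mt V E (swp K X Y)"
proof -
  have "X v \<notin> K" if "v \<in> V" "v \<notin> K" for v
    using assms(4)[of "X v"] that assms(1) by (auto simp: mt_def)
  then show ?thesis using assms unfolding mt_def swp_def by auto
qed

lemma msz_swp:
  assumes "finite V" "K \<subseteq> V"
  shows "msz V (swp K X Y) + msz V (swp K Y X) = msz V X + msz V Y"
proof -
  have split: "msz V Z = card {v \<in> K. v < Z v} + card {v \<in> V - K. v < Z v}" for Z
    unfolding msz_def using assms finite_subset[OF assms(2)]
    by (subst card_Un_disjoint[symmetric]) (auto intro!: arg_cong[where f = card])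
  have "{v \<in> K. v < swp K X Y v} = {v \<in> K. v < Y v}" "{v \<in> V - K. v < swp K X Y v} = {v \<in> V - K. v < X v}" for X Y
    by (auto simp: swp_def)
  then show ?thesis by (simp add: split)
qed

text \<open>The map \<open>p\<close>, first \<open>X\<close> and then \<open>Y\<close>, permutes
  \<open>V\<close>. So the component of \<open>t\<close> consists of the orbit of \<open>t\<close>
  under \<open>p\<close>, whose length \<open>r\<close> is at most \<open>card V\<close>, and of the
  image of this orbit under \<open>X\<close>. The last fact says that a path starting at a vertex
  missed by \<open>Y\<close> has at most one end missed by \<open>X\<close>.\<close>

lemma orb_facts:
  assumes V: "finite V" and X: "mt V E X" and Y: "mt V E Y" and t: "t \<in> V"
  shows "orb X Y t \<subseteq> V" "v \<in> orb X Y t \<Longrightarrow> X v \<in> orb X Y t" "v \<in> orb X Y t \<Longrightarrow> Y v \<in> orb X Y t"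
    "orb X Y t = (\<Union>j<card V. {((Y \<circ> X) ^^ j) t, X (((Y \<circ> X) ^^ j) t)})"
    "\<lbrakk>Y t = t; u \<in> orb X Y t; v \<in> orb X Y t; X u = u; X v = v\<rbrakk> \<Longrightarrow> u = v"
proof -
  define p where "p = Y \<circ> X"
  have XV: "X v \<in> V" "X (X v) = v" and YV: "Y v \<in> V" "Y (Y v) = v" if "v \<in> V" for v
    using X Y that by (auto simp: mt_def)
  have pV: "(p ^^ i) v \<in> V" if "v \<in> V" for i v
    by (induction i) (auto simp: p_def XV YV that)
  have p_inj: "p v = p w \<Longrightarrow> v = w" if "v \<in> V" "w \<in> V" for v w
    using that XV YV unfolding p_def comp_def by metis
  have pi_inj: "(p ^^ i) v = (p ^^ i) w \<Longrightarrow> v = w" if "v \<in> V" "w \<in> V" for v w i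
    by (induction i) (auto dest!: p_inj[rotated 2] simp: pV that)
  have "\<not> inj_on (\<lambda>i. (p ^^ i) t) {..card V}"
  proof
    assume "inj_on (\<lambda>i. (p ^^ i) t) {..card V}"
    then have "card {..card V} \<le> card V"
      using card_inj_on_le[OF _ _ V, of "\<lambda>i. (p ^^ i) t" "{..card V}"] pV[OF t] by blast
    then show False by simp
  qed
  then obtain i j where ij: "i < j" "j \<le> card V" "(p ^^ i) t = (p ^^ j) t"
    unfolding inj_on_def by (metis atMost_iff linorder_neqE_nat)
  have "(p ^^ (i + (j - i))) t = (p ^^ i) ((p ^^ (j - i)) t)"
    by (simp only: funpow_add comp_def)
  then have "(p ^^ (j - i)) t = t"
    using ij pi_inj[OF t pV[OF t]] by (metis le_add_diff_inverse less_imp_le)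
  then have ex: "\<exists>r. 0 < r \<and> r \<le> card V \<and> (p ^^ r) t = t" using ij by (intro exI[of _ "j - i"]) auto
  define r where "r = (LEAST r. 0 < r \<and> (p ^^ r) t = t)"
  have r: "0 < r" "(p ^^ r) t = t"
    using LeastI_ex[of "\<lambda>r. 0 < r \<and> (p ^^ r) t = t"] ex unfolding r_def by auto
  have r_le: "r \<le> card V" using ex Least_le[of "\<lambda>r. 0 < r \<and> (p ^^ r) t = t"] unfolding r_def by fastforce
  have r_mult: "(p ^^ (r * q)) t = t" for q
    by (induction q) (simp_all add: funpow_add r)
  have pmod: "(p ^^ i) t = (p ^^ (i mod r)) t" for i
  proof -
    have "(p ^^ (i mod r + r * (i div r))) t = (p ^^ (i mod r)) t"
      by (simp only: funpow_add comp_def r_mult)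
    then show ?thesis by simp
  qed
  have dvd: "r dvd i" if "(p ^^ i) t = t" for i
  proof -
    have "(p ^^ (i mod r)) t = t" using that pmod by metis
    moreover have "i mod r < r" using r by simp
    moreover have "\<not> (0 < i mod r \<and> (p ^^ (i mod r)) t = t)" if "i mod r < r"
      using not_less_Least[of "i mod r" "\<lambda>r. 0 < r \<and> (p ^^ r) t = t", folded r_def] that by blast
    ultimately have "\<not> 0 < i mod r" by simp
    then show ?thesis by (simp add: mod_eq_0_iff_dvd)
  qed
  have orb: "orb X Y t = (\<Union>j. {(p ^^ j) t, X ((p ^^ j) t)})" unfolding orb_def p_def ..
  show "orb X Y t \<subseteq> V" unfolding orb using pV[OF t] XV by auto
  show "v \<in> orb X Y t \<Longrightarrow> X v \<in> orb X Y t" unfolding orb using XV(2)[OF pV[OF t]] by auto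
  show "Y v \<in> orb X Y t" if v: "v \<in> orb X Y t"
  proof -
    obtain j where "v = (p ^^ j) t \<or> v = X ((p ^^ j) t)" using v unfolding orb by auto
    then show ?thesis
    proof
      assume "v = X ((p ^^ j) t)"
      then have "Y v = (p ^^ Suc j) t" by (simp add: p_def)
      then show ?thesis unfolding orb by blast
    next
      assume v: "v = (p ^^ j) t"
      have "(p ^^ (j + r)) t = v" using v r by (simp only: funpow_add comp_def)
      then have "v = (p ^^ Suc (j + r - 1)) t" using r by simp
      then have "v = Y (X ((p ^^ (j + r - 1)) t))" by (simp add: p_def)
      then have "Y v = X ((p ^^ (j + r - 1)) t)" using YV(2)[OF XV(1)[OF pV[OF t]]] by simp
      then show ?thesis unfolding orb by blast
    qed
  qed
  have "orb X Y t \<subseteq> (\<Union>j<card V. {(p ^^ j) t, X ((p ^^ j) t)})"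
  proof
    fix v assume "v \<in> orb X Y t"
    then obtain j where "v = (p ^^ j) t \<or> v = X ((p ^^ j) t)" unfolding orb by auto
    moreover have "j mod r < card V" using r r_le by (metis mod_less_divisor order_less_le_trans)
    ultimately show "v \<in> (\<Union>j<card V. {(p ^^ j) t, X ((p ^^ j) t)})" using pmod[of j] by auto
  qed
  then show "orb X Y t = (\<Union>j<card V. {((Y \<circ> X) ^^ j) t, X (((Y \<circ> X) ^^ j) t)})"
    unfolding p_def by (auto simp: orb_def)
  assume Yt: "Y t = t" and uv: "u \<in> orb X Y t" "v \<in> orb X Y t" "X u = u" "X v = v"
  \<comment> \<open>As \<open>Y t = t\<close>, the map \<open>X\<close> reflects the orbit: it takes
    the point with index \<open>i\<close> to the one with index \<open>- i - 1\<close> modulo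
    \<open>r\<close>. For a point fixed by \<open>X\<close> it follows that \<open>r\<close> divides
    \<open>2 * i + 1\<close>.\<close>
  have refl: "(p ^^ Suc i) (X ((p ^^ i) t)) = t" for i
  proof (induction i)
    case 0
    then show ?case using Yt XV t by (simp add: p_def)
  next
    case (Suc i)
    have "p (X (p ((p ^^ i) t))) = X ((p ^^ i) t)" using XV YV pV[OF t, of i] by (simp add: p_def)
    then have "(p ^^ Suc (Suc i)) (X ((p ^^ Suc i) t)) = (p ^^ Suc i) (X ((p ^^ i) t))"
      by (simp only: funpow_Suc_right comp_def) (simp add: funpow_swap1)
    then show ?case using Suc by simp
  qed
  have pos: "\<exists>i. w = (p ^^ i) t \<and> r dvd 2 * i + 1" if w: "w \<in> orb X Y t" "X w = w" for w
  proof -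
    obtain i where "w = (p ^^ i) t \<or> w = X ((p ^^ i) t)" using w unfolding orb by auto
    then have wi: "w = (p ^^ i) t" using w XV(2)[OF pV[OF t]] by metis
    then have "(p ^^ Suc i) ((p ^^ i) t) = t" using refl[of i] w by simp
    then have "(p ^^ (Suc i + i)) t = t" by (simp only: funpow_add comp_def)
    then have "r dvd Suc i + i" by (rule dvd)
    then show ?thesis using wi by (intro exI[of _ i]) (simp add: mult_2)
  qed
  obtain i j where ij: "u = (p ^^ i) t" "r dvd 2 * i + 1" "v = (p ^^ j) t" "r dvd 2 * j + 1"
    using pos uv by metis
  have "(p ^^ i) t = (p ^^ j) t" if "i \<le> j" "r dvd 2 * i + 1" "r dvd 2 * j + 1" for i j
  proof -
    have "r dvd (2 * j + 1) - (2 * i + 1)" using that by (intro dvd_diff_nat)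
    then have "r dvd 2 * (j - i)" by (simp add: algebra_simps)
    \<comment> \<open>A divisor of an odd number is odd. So the factor 2 can be cancelled, and the
      index of a point fixed by \<open>X\<close> is determined modulo \<open>r\<close>.\<close>
    moreover have "odd r"
    proof
      assume "even r"
      then have "even (2 * i + 1)" using that(2) by (rule dvd_trans)
      then show False by simp
    qed
    ultimately have "r dvd j - i" using coprime_dvd_mult_right_iff[of r 2 "j - i"] by simp
    then obtain q where "j - i = r * q" by (rule dvdE)
    then have "j = i + r * q" using that(1) by linarith
    then show ?thesis using r_mult by (simp only: funpow_add comp_def)
  qed
  then show "u = v" using ij by (metis nat_le_linear)
qed

lemma card_involution:
  assumes "finite V" "\<And>v. v \<in> V \<Longrightarrow> X v \<in> V \<and> X (X v) = (v :: nat)"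
  shows "card V = card {v \<in> V. X v = v} + 2 * card {v \<in> V. v < X v}"
proof -
  have "{v \<in> V. X v < v} = X ` {v \<in> V. v < X v}"
    using assms(2) by (auto simp: image_iff) metis
  moreover have "inj_on X {v \<in> V. v < X v}"
    using assms(2) by (metis (mono_tags, lifting) inj_onI mem_Collect_eq)
  ultimately have "card {v \<in> V. X v < v} = card {v \<in> V. v < X v}" by (simp add: card_image)
  moreover have "V = {v \<in> V. X v = v} \<union> ({v \<in> V. v < X v} \<union> {v \<in> V. X v < v})" by auto
  then have "card V = card ({v \<in> V. X v = v} \<union> ({v \<in> V. v < X v} \<union> {v \<in> V. X v < v}))" by simp
  then have "card V = card {v \<in> V. X v = v} + (card {v \<in> V. v < X v} + card {v \<in> V. X v < v})"
    using assms(1) by (simp add: card_Un_disjoint disjoint_iff)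
  ultimately show ?thesis by simp
qed

text \<open>A family of matchings that cannot be improved by adding an edge or by exchanging two members
along a component of their symmetric difference; \<open>f s\<close> is the size of the largest member that
leaves the vertices in \<open>s\<close> unmatched.\<close>

locale local_optimum =
  fixes V :: "nat set" and E :: "nat \<Rightarrow> nat \<Rightarrow> bool" and P :: "(nat \<Rightarrow> nat) set" and f :: "nat set \<Rightarrow> nat"
  assumes finV: "finite V" and symE: "\<And>u v. u \<in> V \<Longrightarrow> v \<in> V \<Longrightarrow> E u v \<Longrightarrow> E v u"
    and mtP: "\<And>X. X \<in> P \<Longrightarrow> mt V E X"
    and best: "\<And>s. s \<subseteq> V \<Longrightarrow> card s \<le> 5 \<Longrightarrow> \<exists>X\<in>P. (\<forall>v\<in>s. X v = v) \<and> msz V X = f s"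
    and opt: "\<And>X s. X \<in> P \<Longrightarrow> s \<subseteq> V \<Longrightarrow> card s \<le> 5 \<Longrightarrow> msz V (restr s X) \<le> f s"
    and opt_add: "\<And>X s u v. X \<in> P \<Longrightarrow> s \<subseteq> V \<Longrightarrow> card s \<le> 5 \<Longrightarrow> u \<in> V \<Longrightarrow> v \<in> V \<Longrightarrow> u \<noteq> v \<Longrightarrow> E u v \<Longrightarrow> X u = u \<Longrightarrow> X v = v \<Longrightarrow>
      msz V (restr s (addp u v X)) \<le> f s"
    and opt_swp: "\<And>X Y s t. X \<in> P \<Longrightarrow> Y \<in> P \<Longrightarrow> s \<subseteq> V \<Longrightarrow> card s \<le> 5 \<Longrightarrow> t \<in> V \<Longrightarrow>
      msz V (restr s (swp (orb X Y t) X Y)) \<le> f s \<and> msz V (restr s (swp (orb X Y t) Y X)) \<le> f s"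
begin

lemma f_missed:
  assumes "mt V E Z" "\<And>v. v \<in> s \<Longrightarrow> Z v = v" "msz V (restr s Z) \<le> f s" shows "msz V Z \<le> f s"
proof -
  have "msz V (restr s Z) = msz V Z" by (rule msz_cong) (rule restr_missed[OF assms(1,2)])
  then show ?thesis using assms(3) by simp
qed

lemma f_mono:
  assumes "s \<subseteq> r" "r \<subseteq> V" "card r \<le> 5" shows "f r \<le> f s"
proof -
  have "card s \<le> 5" using assms card_mono[OF finite_subset[OF assms(2) finV] assms(1)] by simp
  moreover obtain X where X: "X \<in> P" "\<forall>v\<in>r. X v = v" "msz V X = f r" using best assms by blast
  moreover have "s \<subseteq> V" using assms by auto
  ultimately show ?thesis using f_missed[OF mtP[OF X(1)], of s] opt[OF X(1), of s] assms(1) by auto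
qed

lemma f_insert: "insert v s \<subseteq> V \<Longrightarrow> card (insert v s) \<le> 5 \<Longrightarrow> f s \<le> f (insert v s) + 1"
proof -
  assume *: "insert v s \<subseteq> V" "card (insert v s) \<le> 5"
  have c: "card s \<le> 5" by (rule order_trans[OF card_mono[OF finite_subset[OF *(1) finV]] *(2)]) auto
  obtain X where X: "X \<in> P" "\<forall>v\<in>s. X v = v" "msz V X = f s" using best[of s] * c by auto
  have 1: "msz V X \<le> msz V (restr {v} X) + 1" using * by (intro msz_restr_single[OF finV mtP[OF X(1)]]) auto
  have "msz V (restr (insert v s) X) = msz V (restr {v} (restr s X))" by (simp add: restr_restr)
  also have "\<dots> = msz V (restr {v} X)"
    by (rule msz_cong) (use restr_missed[OF mtP[OF X(1)], of s] X(2) mtP[OF X(1)] in \<open>auto simp: restr_def mt_def\<close>)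
  finally show ?thesis using 1 X(3) opt[OF X(1) *] by simp
qed

lemma f_edge:
  assumes "insert u (insert v s) \<subseteq> V" "card (insert u (insert v s)) \<le> 5" "u \<noteq> v" "E u v" "u \<notin> s" "v \<notin> s"
  shows "f (insert u (insert v s)) + 1 \<le> f s"
proof -
  obtain X where X: "X \<in> P" "\<forall>w\<in>insert u (insert v s). X w = w" "msz V X = f (insert u (insert v s))"
    using best assms by blast
  have c: "card s \<le> 5" by (rule order_trans[OF card_mono[OF finite_subset[OF assms(1) finV]] assms(2)]) auto
  have "E v u" using symE assms by auto
  then have Z: "mt V E (addp u v X)" using assms X by (intro mt_addp mtP) auto
  have "msz V (addp u v X) \<le> f s"
    using opt_add[OF X(1) _ c, of u v] assms X by (intro f_missed[OF Z]) (auto simp: addp_def[of u v X])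
  then show ?thesis using msz_addp[OF finV mtP[OF X(1)], of u v] X assms by auto
qed

text \<open>Take a best \<open>X\<close> that misses \<open>u\<close>, \<open>v\<close>,
  \<open>s\<close> and a best \<open>Y\<close> that misses \<open>t\<close>, \<open>s\<close>, and
  exchange them along the component of \<open>t\<close>, which keeps the total size. Since
  \<open>Y\<close> misses \<open>t\<close>, at most one of \<open>u\<close> and \<open>v\<close>
  lies in this component; the three alternatives belong to neither, only \<open>u\<close>, and only
  \<open>v\<close>.\<close>

lemma f_exchange:
  assumes s: "insert u (insert v (insert t s)) \<subseteq> V" "card (insert u (insert v (insert t s))) \<le> 5" and uv: "u \<noteq> v"
  shows "f (insert u (insert v s)) + f (insert t s) \<le> f s + f (insert u (insert v (insert t s))) \<or>
    f (insert u (insert v s)) + f (insert t s) \<le> f (insert u s) + f (insert v (insert t s)) \<or>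
    f (insert u (insert v s)) + f (insert t s) \<le> f (insert v s) + f (insert u (insert t s))"
proof -
  have fin: "finite (insert u (insert v (insert t s)))" by (rule finite_subset[OF s(1) finV])
  have card: "card r \<le> 5" if "r \<subseteq> insert u (insert v (insert t s))" for r
    using card_mono[OF fin that] s(2) by simp
  have s1: "insert u (insert v s) \<subseteq> V" and c1: "card (insert u (insert v s)) \<le> 5" using s(1) by (auto intro: card)
  have s2: "insert t s \<subseteq> V" and c2: "card (insert t s) \<le> 5" using s(1) by (auto intro: card)
  obtain X where X: "X \<in> P" "\<forall>w\<in>insert u (insert v s). X w = w" "msz V X = f (insert u (insert v s))"
    using best[OF s1 c1] by blast
  obtain Y where Y: "Y \<in> P" "\<forall>w\<in>insert t s. Y w = w" "msz V Y = f (insert t s)"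
    using best[OF s2 c2] by blast
  let ?K = "orb X Y t"
  have t: "t \<in> V" "Y t = t" using s Y by auto
  note orbK = orb_facts[OF finV mtP[OF X(1)] mtP[OF Y(1)] t(1)]
  have tK: "t \<in> ?K" unfolding orb_def by (intro UN_I[of 0]) auto
  have mX: "mt V E (swp ?K X Y)" and mY: "mt V E (swp ?K Y X)"
    by (rule mt_swp[OF mtP[OF X(1)] mtP[OF Y(1)] orbK(1) orbK(2) orbK(3)], assumption, assumption)
      (rule mt_swp[OF mtP[OF Y(1)] mtP[OF X(1)] orbK(1) orbK(3) orbK(2)], assumption, assumption)
  have fX: "msz V (swp ?K X Y) \<le> f r" if "r \<subseteq> insert u (insert v (insert t s))" "\<And>w. w \<in> r \<Longrightarrow> swp ?K X Y w = w" for r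
    using that(2) opt_swp[OF X(1) Y(1) subset_trans[OF that(1) s(1)] card[OF that(1)] t(1)]
    by (intro f_missed[OF mX]) auto
  have fY: "msz V (swp ?K Y X) \<le> f r" if "r \<subseteq> insert u (insert v (insert t s))" "\<And>w. w \<in> r \<Longrightarrow> swp ?K Y X w = w" for r
    using that(2) opt_swp[OF X(1) Y(1) subset_trans[OF that(1) s(1)] card[OF that(1)] t(1)]
    by (intro f_missed[OF mY]) auto
  have sum: "msz V (swp ?K X Y) + msz V (swp ?K Y X) = f (insert u (insert v s)) + f (insert t s)"
    using msz_swp[OF finV orbK(1)] X Y by simp
  consider "u \<notin> ?K" "v \<notin> ?K" | "u \<in> ?K" "v \<notin> ?K" | "u \<notin> ?K" "v \<in> ?K"
    using orbK(5)[OF t(2), of u v] X(2) uv by auto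
  then show ?thesis
  proof cases
    case 1
    have "msz V (swp ?K X Y) \<le> f (insert u (insert v (insert t s)))"
      by (rule fX) (use 1 X Y tK in \<open>auto simp: swp_def\<close>)
    moreover have "msz V (swp ?K Y X) \<le> f s"
      by (rule fY) (use X Y tK in \<open>auto simp: swp_def\<close>)
    ultimately show ?thesis using sum by linarith
  next
    case 2
    have "msz V (swp ?K X Y) \<le> f (insert v (insert t s))"
      by (rule fX) (use 2 X Y tK in \<open>auto simp: swp_def\<close>)
    moreover have "msz V (swp ?K Y X) \<le> f (insert u s)"
      by (rule fY) (use 2 X Y tK in \<open>auto simp: swp_def\<close>)
    ultimately show ?thesis using sum by linarith
  next
    case 3
    have "msz V (swp ?K X Y) \<le> f (insert u (insert t s))"
      by (rule fX) (use 3 X Y tK in \<open>auto simp: swp_def\<close>)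
    moreover have "msz V (swp ?K Y X) \<le> f (insert v s)"
      by (rule fY) (use 3 X Y tK in \<open>auto simp: swp_def\<close>)
    ultimately show ?thesis using sum by linarith
  qed
qed

theorem optimal:
  assumes Y: "mt V E Y"
  shows "msz V Y \<le> f {}"
proof -
  define m where "m = f {}"
  define D where "D = {v \<in> V. f {v} = m}"
  define A where "A = {a \<in> V - D. \<exists>z\<in>D. E z a}"
  have DV: "D \<subseteq> V" and AV: "A \<subseteq> V" and AD: "A \<inter> D = {}" by (auto simp: D_def A_def)
  have finD: "finite D" "finite A" using DV AV finV finite_subset by auto
  have le_m: "f {v} \<le> m" "m \<le> f {v} + 1" if "v \<in> V" for v
    using f_mono[of "{}" "{v}"] f_insert[of v "{}"] that by (auto simp: m_def)
  have fA: "f {a} + 1 = m" if "a \<in> A" for a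
    using le_m[of a] that by (auto simp: A_def D_def)
  obtain X where X: "X \<in> P" "msz V X = m" using best[of "{}"] by (auto simp: m_def)
  have XV: "X v \<in> V" "X (X v) = v" if "v \<in> V" for v using mtP[OF X(1)] that by (auto simp: mt_def)
  have XE: "E v (X v)" if "v \<in> V" "X v \<noteq> v" for v using mtP[OF X(1)] that by (auto simp: mt_def)
  have missed_D: "v \<in> D" if "v \<in> V" "X v = v" for v
  proof -
    have "msz V (restr {v} X) = msz V X" by (rule msz_cong) (rule restr_missed[OF mtP[OF X(1)]], use that in auto)
    then show ?thesis using opt[OF X(1), of "{v}"] le_m[OF that(1)] that X(2) by (auto simp: D_def)
  qed
  \<comment> \<open>The exchange inequality is applied to \<open>a\<close>, \<open>X a\<close> and a
    neighbour \<open>z\<close> of \<open>a\<close> in \<open>D\<close>. Every alternative gives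
    \<open>f {X a} = m\<close>: missing \<open>a\<close> costs an edge by \<open>fA\<close>, and
    missing both \<open>a\<close> and \<open>z\<close> costs one because the edge between them could
    be added.\<close>
  have XA: "X a \<in> D" if a: "a \<in> A" for a
  proof -
    have aV: "a \<in> V" "a \<notin> D" using a by (auto simp: A_def)
    then have Xa: "X a \<noteq> a" "X a \<in> V" using missed_D XV by auto
    obtain z where z: "z \<in> D" "E z a" "z \<in> V" "z \<noteq> a" using a AD by (auto simp: A_def D_def)
    have Ea: "E a z" using symE z aV by blast
    show ?thesis
    proof (cases "z = X a")
      case False
      have "msz V X \<le> msz V (restr {a} X) + 1" by (rule msz_restr_single[OF finV mtP[OF X(1)] aV(1)])
      also have "msz V (restr {a} X) = msz V (restr {a, X a} X)"
        by (rule msz_cong) (use XV aV in \<open>auto simp: restr_def\<close>, metis)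
      also have "\<dots> \<le> f {a, X a}" by (rule opt[OF X(1)]) (use aV Xa in \<open>auto simp: card_insert_if\<close>)
      finally have 1: "m \<le> f {a, X a} + 1" using X(2) by simp
      have 2: "f {a, X a} + f {z} \<le> f {} + f {a, X a, z} \<or> f {a, X a} + f {z} \<le> f {a} + f {X a, z} \<or>
        f {a, X a} + f {z} \<le> f {X a} + f {a, z}"
        by (rule f_exchange) (use aV Xa z in \<open>auto simp: card_insert_if\<close>)
      have 3: "f {a, z, X a} + 1 \<le> f {X a}" "f {a, z} + 1 \<le> f {}"
        by (rule f_edge; use aV Xa z False Ea in \<open>auto simp: card_insert_if\<close>)+
      have 4: "f {X a, z} \<le> f {X a}" by (rule f_mono) (use Xa z in \<open>auto simp: card_insert_if\<close>)
      have "f {z} = m" using z by (simp add: D_def)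
      then have "m \<le> f {X a}" using 1 2 3 4 fA[OF a] by (auto simp: insert_commute m_def[symmetric])
      then show ?thesis using le_m(1)[OF Xa(2)] Xa(2) by (simp add: D_def)
    qed (use z in simp)
  qed
  \<comment> \<open>The same exchange with a second vertex \<open>b\<close> of \<open>A\<close> in
    place of \<open>X a\<close>: if \<open>f {a, b}\<close> were \<open>m - 1\<close>, every
    alternative would give \<open>f {b} = m\<close>, contrary to \<open>fA\<close>.\<close>
  have fAA: "f {a, b} + 2 = m" if a: "a \<in> A" "b \<in> A" "a \<noteq> b" for a b
  proof -
    have V: "a \<in> V" "b \<in> V" using a AV by auto
    obtain z where z: "z \<in> D" "E z a" "z \<in> V" using a by (auto simp: A_def D_def)
    have Ea: "E a z" using symE z V by blast
    have neq: "z \<noteq> a" "z \<noteq> b" using z a AD by auto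
    have 1: "f {b} \<le> f {a, b} + 1" "f {a, b} \<le> f {b}"
      using f_insert[of a "{b}"] f_mono[of "{b}" "{a, b}"] V a by (auto simp: card_insert_if)
    have 2: "f {a, b} + f {z} \<le> f {} + f {a, b, z} \<or> f {a, b} + f {z} \<le> f {a} + f {b, z} \<or>
        f {a, b} + f {z} \<le> f {b} + f {a, z}"
      by (rule f_exchange) (use V z a in \<open>auto simp: card_insert_if\<close>)
    have 3: "f {a, z, b} + 1 \<le> f {b}" "f {a, z} + 1 \<le> f {}"
      by (rule f_edge; use V z neq a Ea in \<open>auto simp: card_insert_if\<close>)+
    have 4: "f {b, z} \<le> f {b}" by (rule f_mono) (use V z in \<open>auto simp: card_insert_if\<close>)
    have "f {z} = m" using z by (simp add: D_def)
    then show ?thesis using 1 2 3 4 fA[OF a(1)] fA[OF a(2)] by (auto simp: insert_commute m_def[symmetric])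
  qed
  (* \<open>eq\<close> contains adjacency in \<open>D\<close> and is transitive by the exchange inequality, so that it
     plays the role of being in the same Gallai-Edmonds component. *)
  define S where "S = {s. s \<subseteq> A \<and> card s \<le> 2}"
  have fS: "f s + card s = m" if "s \<in> S" for s
  proof -
    have s: "s \<subseteq> A" "finite s" "card s \<le> 2" using that finD finite_subset by (auto simp: S_def)
    consider "card s = 0" | "card s = 1" | "card s = 2" using s(3) by linarith
    then show ?thesis
    proof cases
      case 1
      then show ?thesis using s by (simp add: m_def)
    next
      case 2
      then obtain a where "s = {a}" using card_1_singletonE by metis
      then show ?thesis using fA s by simp
    next
      case 3
      then obtain a b where "s = {a, b}" "a \<noteq> b" unfolding card_2_iff by blast
      then show ?thesis using fAA s by simp
    qed
  qed
  have Sc: "finite s" "s \<subseteq> V" "s \<inter> D = {}" "card (insert u s) \<le> 5" "card (insert u (insert v s)) \<le> 5"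
    "card (insert u (insert v (insert w s))) \<le> 5" if "s \<in> S" for s u v w
  proof -
    show "finite s" "s \<subseteq> V" "s \<inter> D = {}" using that finD AV AD finite_subset by (auto simp: S_def)
    then show "card (insert u s) \<le> 5" "card (insert u (insert v s)) \<le> 5"
      "card (insert u (insert v (insert w s))) \<le> 5"
      using that by (auto simp: S_def card_insert_if)
  qed
  \<comment> \<open>A matching of size \<open>m\<close> that misses \<open>t\<close> loses at most
    one edge for each vertex of \<open>s\<close>, and by \<open>fS\<close> it cannot do better than
    that.\<close>
  have fSD: "f (insert t s) + card s = m" if "s \<in> S" "t \<in> D" for s t
  proof -
    have "f (insert t s) \<le> f s" using that Sc[OF that(1)] DV by (intro f_mono) (auto intro: order_trans)
    moreover have "m \<le> f (insert t s) + card s"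
    proof -
      have tV: "t \<in> V" "f {t} = m" using that by (auto simp: D_def)
      then obtain Z where Z: "Z \<in> P" "Z t = t" "msz V Z = m" using best[of "{t}"] by auto
      have "msz V Z \<le> msz V (restr s Z) + card s" by (rule msz_restr[OF finV mtP[OF Z(1)] Sc(2)[OF that(1)]])
      also have "msz V (restr s Z) = msz V (restr (insert t s) Z)"
        by (rule msz_cong) (use Z tV mtP[OF Z(1)] in \<open>auto simp: restr_def mt_def\<close>)
      also have "\<dots> \<le> f (insert t s)"
        by (rule opt[OF Z(1)]) (use Sc[OF that(1)] tV in \<open>auto intro: order_trans\<close>)
      finally show ?thesis using Z by simp
    qed
    ultimately show ?thesis using fS[OF that(1)] by linarith
  qed
  define eq where "eq u v \<longleftrightarrow> u = v \<or> (\<forall>s\<in>S. f (insert u (insert v s)) + card s < m)" for u v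
  have eq_sym: "eq u v \<Longrightarrow> eq v u" for u v unfolding eq_def by (auto simp: insert_commute)
  \<comment> \<open>Adding one of \<open>t\<close>, \<open>u\<close>, \<open>v\<close> to
    \<open>s\<close> does not change the value of \<open>f\<close>, by \<open>fS\<close> and
    \<open>fSD\<close>. So each alternative of the exchange inequality bounds the value for
    \<open>u\<close>, \<open>v\<close> by the value for a pair that contains
    \<open>t\<close>.\<close>
  have eq_trans: "eq u v" if "eq u t" "eq t v" "u \<in> D" "t \<in> D" "v \<in> D" for u t v
  proof (cases "u = v \<or> u = t \<or> t = v")
    case False
    have "f (insert u (insert v s)) + card s < m" if s: "s \<in> S" for s
    proof -
      have V: "u \<in> V" "v \<in> V" "t \<in> V" using \<open>u \<in> D\<close> \<open>v \<in> D\<close> \<open>t \<in> D\<close> DV by auto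
      have ut: "f (insert u (insert t s)) + card s < m" "f (insert v (insert t s)) + card s < m"
        using \<open>eq u t\<close> \<open>eq t v\<close> False s by (auto simp: eq_def insert_commute)
      have "f (insert u (insert v s)) + f (insert t s) \<le> f s + f (insert u (insert v (insert t s))) \<or>
        f (insert u (insert v s)) + f (insert t s) \<le> f (insert u s) + f (insert v (insert t s)) \<or>
        f (insert u (insert v s)) + f (insert t s) \<le> f (insert v s) + f (insert u (insert t s))"
        by (rule f_exchange) (use V Sc[OF s] False in auto)
      moreover have "f (insert u (insert v (insert t s))) \<le> f (insert u (insert t s))"
        by (rule f_mono) (use V Sc[OF s] in auto)
      ultimately show ?thesis
        using fS[OF s] fSD[OF s \<open>t \<in> D\<close>] fSD[OF s \<open>u \<in> D\<close>] fSD[OF s \<open>v \<in> D\<close>] ut by linarith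
    qed
    then show ?thesis by (simp add: eq_def)
  qed (use that in \<open>auto simp: eq_def\<close>)
  have eq_adj: "eq u v" if "u \<in> D" "v \<in> D" "E u v" for u v
  proof (cases "u = v")
    case False
    have "f (insert u (insert v s)) + 1 \<le> f s" if "s \<in> S" for s
      by (rule f_edge) (use Sc[OF that] False \<open>u \<in> D\<close> \<open>v \<in> D\<close> \<open>E u v\<close> DV in auto)
    then have "f (insert u (insert v s)) + card s < m" if "s \<in> S" for s using fS[OF that] that by fastforce
    then show ?thesis by (simp add: eq_def)
  qed (simp add: eq_def)
  define R where "R = {v \<in> D. X v = v \<or> X v \<in> A}"
  \<comment> \<open>Removing from \<open>X\<close> its edges between \<open>{u, v}\<close> and
    \<open>A\<close> leaves a matching of size at least \<open>m - card s\<close> that misses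
    \<open>u\<close>, \<open>v\<close> and \<open>s\<close>, which \<open>eq u v\<close> forbids.
    This is why \<open>eq\<close> quantifies over sets of up to two vertices of
    \<open>A\<close>.\<close>
  have R_unique: "u = v" if u: "u \<in> R" and v: "v \<in> R" and uv: "eq u v" for u v
  proof (rule ccontr)
    assume neq: "u \<noteq> v"
    have V: "u \<in> V" "v \<in> V" and D: "u \<in> D" "v \<in> D" using u v DV by (auto simp: R_def)
    define s where "s = {X u, X v} \<inter> A"
    have "card s \<le> card {X u, X v}" unfolding s_def by (intro card_mono) auto
    then have s: "s \<in> S" by (auto simp: S_def s_def card_insert_if split: if_splits)
    have "msz V X \<le> msz V (restr s X) + card s" by (rule msz_restr[OF finV mtP[OF X(1)] Sc(2)[OF s]])
    also have "msz V (restr s X) = msz V (restr (insert u (insert v s)) X)"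
    proof (rule msz_cong)
      fix w assume w: "w \<in> V"
      have "X u = u \<or> X u \<in> s" "X v = v \<or> X v \<in> s" using u v by (auto simp: R_def s_def)
      then show "restr s X w = restr (insert u (insert v s)) X w"
        using XV[OF w] by (auto simp: restr_def)
    qed
    also have "\<dots> \<le> f (insert u (insert v s))"
      by (rule opt[OF X(1)]) (use V Sc[OF s] in auto)
    finally have "m \<le> f (insert u (insert v s)) + card s" using X(2) by simp
    then show False using uv neq s by (auto simp: eq_def not_less[symmetric])
  qed
  (* Hence the class of a vertex of \<open>R\<close> is odd, and every matching leaves one of its vertices
     unmatched or matches it into \<open>A\<close>. *)
  define K where "K r = {v \<in> D. eq v r}" for r
  have YV: "Y v \<in> V" "Y (Y v) = v" if "v \<in> V" for v using Y that by (auto simp: mt_def)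
  have YE: "E v (Y v)" if "v \<in> V" "Y v \<noteq> v" for v using Y that by (auto simp: mt_def)
  have inD: "w \<in> D" if "v \<in> D" "w \<in> V" "E v w" "w \<notin> A" for v w
    using that by (auto simp: A_def)
  have ex: "\<exists>v\<in>K r. Y v = v \<or> Y v \<in> A" if r: "r \<in> R" for r
  proof (rule ccontr)
    assume no: "\<not> ?thesis"
    have rD: "r \<in> D" "r \<in> K r" using r by (auto simp: R_def K_def eq_def)
    have finK: "finite (K r)" using finD by (auto simp: K_def)
    have step: "Z v \<in> K r" if "v \<in> K r" "Z v \<in> V" "E v (Z v)" "Z v \<notin> A" for Z v
    proof -
      have vD: "v \<in> D" "eq v r" using that by (auto simp: K_def)
      then have ZD: "Z v \<in> D" using inD that by blast
      then have "eq v (Z v)" using eq_adj vD that by blast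
      then have "eq (Z v) r" using eq_trans[OF eq_sym vD(2)] ZD vD rD by blast
      then show ?thesis using ZD by (simp add: K_def)
    qed
    have KV: "K r \<subseteq> V" using DV by (auto simp: K_def)
    have 1: "Y v \<in> K r \<and> Y (Y v) = v" if "v \<in> K r" for v
    proof -
      have "v \<in> V" "Y v \<noteq> v" "Y v \<notin> A" using that KV no by auto
      then show ?thesis using step[OF that, of Y] YV[of v] YE[of v] by simp
    qed
    have e0: "{v \<in> K r. Y v = v} = {}" using no by auto
    have even: "even (card (K r))" using card_involution[OF finK 1] unfolding e0 by simp
    have 2: "X v \<in> K r - {r} \<and> X (X v) = v" and 3: "X v \<noteq> v" if v: "v \<in> K r - {r}" for v
    proof -
      have vV: "v \<in> V" "v \<in> D" using v KV by (auto simp: K_def)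
      have nR: "v \<notin> R" using v R_unique[OF _ r] by (auto simp: K_def)
      then have Xv: "X v \<noteq> v" "X v \<notin> A" using vV by (auto simp: R_def)
      have "X v \<noteq> r"
      proof
        assume "X v = r"
        then have "X r = v" using XV(2)[OF vV(1)] by simp
        then show False using r Xv vV AD v by (auto simp: R_def)
      qed
      moreover have "X v \<in> K r" using step[of v X] v XV(1)[OF vV(1)] XE[OF vV(1) Xv(1)] Xv(2) by blast
      ultimately show "X v \<in> K r - {r} \<and> X (X v) = v" using XV(2)[OF vV(1)] by simp
      show "X v \<noteq> v" by (rule Xv)
    qed
    have e0: "{v \<in> K r - {r}. X v = v} = {}" using 3 by auto
    have "even (card (K r - {r}))" using card_involution[of "K r - {r}" X] 2 finK unfolding e0 by simp
    moreover have "card (K r) = Suc (card (K r - {r}))" by (rule card.remove[OF finK rD(2)])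
    ultimately show False using even by simp
  qed
  then obtain c where c: "\<And>r. r \<in> R \<Longrightarrow> c r \<in> K r \<and> (Y (c r) = c r \<or> Y (c r) \<in> A)" by metis
  have RD: "R \<subseteq> D" by (auto simp: R_def)
  \<comment> \<open>Final count: distinct elements of \<open>R\<close> have distinct representatives
    \<open>c r\<close>, so \<open>card R\<close> is at most the number of vertices missed by
    \<open>Y\<close> plus \<open>card A\<close>. On the other hand the vertices missed by
    \<open>X\<close> and the partners of \<open>A\<close> under \<open>X\<close> are disjoint parts
    of \<open>R\<close>. Hence \<open>X\<close> misses no more vertices than
    \<open>Y\<close>.\<close>
  have "inj_on c R"
  proof (rule inj_onI)
    fix r q assume rq: "r \<in> R" "q \<in> R" "c r = c q"
    then have "eq (c r) r" "eq (c r) q" "c r \<in> D" using c[of r] c[of q] by (auto simp: K_def)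
    then have "eq r q" using eq_trans[OF eq_sym] rq RD by blast
    then show "r = q" using R_unique rq by blast
  qed
  moreover have "c ` R \<subseteq> {v \<in> V. Y v = v} \<union> {v \<in> V. Y v \<in> A}" using c DV by (force simp: K_def)
  ultimately have "card R \<le> card ({v \<in> V. Y v = v} \<union> {v \<in> V. Y v \<in> A})"
    using finV by (intro card_inj_on_le[of c]) auto
  also have "\<dots> \<le> card {v \<in> V. Y v = v} + card {v \<in> V. Y v \<in> A}" by (rule card_Un_le)
  also have "card {v \<in> V. Y v \<in> A} \<le> card A"
    by (rule card_inj_on_le[of Y]) (use finD in \<open>auto intro!: inj_onI\<close>, metis YV(2))
  finally have RY: "card R \<le> card {v \<in> V. Y v = v} + card A" by simp
  have "X ` A \<inter> {v \<in> V. X v = v} = {}" using XV AV missed_D AD by (auto, metis disjoint_iff subsetD)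
  moreover have "X ` A \<union> {v \<in> V. X v = v} \<subseteq> R" using XA missed_D XV AV by (auto simp: R_def)
  moreover have "card (X ` A) = card A" by (rule card_image) (metis AV XV(2) inj_onI subsetD)
  ultimately have "card A + card {v \<in> V. X v = v} \<le> card R"
    using card_mono[of R "X ` A \<union> {v \<in> V. X v = v}"] finD finV finite_subset[OF RD] by (simp add: card_Un_disjoint)
  then have "card {v \<in> V. X v = v} \<le> card {v \<in> V. Y v = v}" using RY by simp
  moreover have "card V = card {v \<in> V. X v = v} + 2 * msz V X" unfolding msz_def
    by (rule card_involution[OF finV]) (use XV in auto)
  moreover have "card V = card {v \<in> V. Y v = v} + 2 * msz V Y" unfolding msz_def
    by (rule card_involution[OF finV]) (use YV in auto)
  ultimately show ?thesis using X(2) by (simp add: m_def)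
qed

end

section \<open>Reduction of disjoint paths to matching\<close>

definition terms :: "(nat \<times> nat) list \<Rightarrow> nat list" where
  "terms ts = concat (map (\<lambda>p. [fst p, snd p]) ts)"

definition nonadj :: "(nat \<Rightarrow> nat \<Rightarrow> bool) \<Rightarrow> (nat \<times> nat) list \<Rightarrow> (nat \<times> nat) list" where
  "nonadj E ts = filter (\<lambda>p. \<not> E (fst p) (snd p)) ts"

text \<open>An edge of \<open>hedge\<close> is what a path between nonadjacent terminals \<open>s\<close>, \<open>t\<close> needs: a common
neighbour of \<open>s\<close> and \<open>t\<close>, recorded as an edge at \<open>s\<close>, or an edge between the two cliques. The
latter is usable for every nonadjacent pair, and only this property of it is asked for, so that
the cliques need not be known.\<close>

definition hfree :: "(nat \<Rightarrow> nat \<Rightarrow> bool) \<Rightarrow> (nat \<times> nat) list \<Rightarrow> nat \<Rightarrow> nat \<Rightarrow> bool" where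
  "hfree E ts x y \<longleftrightarrow> x \<notin> set (terms ts) \<and> y \<notin> set (terms ts) \<and> E x y \<and>
     (\<forall>p\<in>set (nonadj E ts). E (fst p) x \<and> E (snd p) y \<or> E (fst p) y \<and> E (snd p) x)"

definition hterm :: "(nat \<Rightarrow> nat \<Rightarrow> bool) \<Rightarrow> (nat \<times> nat) list \<Rightarrow> nat \<Rightarrow> nat \<Rightarrow> bool" where
  "hterm E ts x y \<longleftrightarrow> (\<exists>p\<in>set (nonadj E ts). x = fst p \<and> y \<notin> set (terms ts) \<and> E (fst p) y \<and> E (snd p) y)"

definition hedge :: "nat \<Rightarrow> (nat \<Rightarrow> nat \<Rightarrow> bool) \<Rightarrow> (nat \<times> nat) list \<Rightarrow> nat \<Rightarrow> nat \<Rightarrow> bool" where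
  "hedge n E ts x y \<longleftrightarrow> x < n \<and> y < n \<and> (hfree E ts x y \<or> hterm E ts x y \<or> hterm E ts y x)"

lemma distinct_terms:
  assumes "distinct (terms ts)" "i < length ts" "j < length ts"
  shows "fst (ts ! i) = fst (ts ! j) \<longleftrightarrow> i = j" "snd (ts ! i) = snd (ts ! j) \<longleftrightarrow> i = j" "fst (ts ! i) \<noteq> snd (ts ! j)"
proof -
  have mem: "i < length ts \<Longrightarrow> fst (ts ! i) \<in> set (terms ts) \<and> snd (ts ! i) \<in> set (terms ts)" for i ts
    by (auto simp: terms_def dest: nth_mem)
  have "(fst (ts ! i) = fst (ts ! j) \<longleftrightarrow> i = j) \<and> (snd (ts ! i) = snd (ts ! j) \<longleftrightarrow> i = j) \<and> fst (ts ! i) \<noteq> snd (ts ! j)"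
    using assms
  proof (induction ts arbitrary: i j)
    case (Cons p ts)
    have d: "distinct (terms ts)" "fst p \<noteq> snd p" "fst p \<notin> set (terms ts)" "snd p \<notin> set (terms ts)"
      using Cons.prems(1) by (auto simp: terms_def)
    show ?case
    proof (cases i; cases j)
      fix i' j' assume "i = Suc i'" "j = Suc j'"
      then show ?thesis using Cons.IH[OF d(1), of i' j'] Cons.prems by simp
    next
      fix i' assume "i = Suc i'" "j = 0"
      then show ?thesis using mem[of i' ts] Cons.prems d by auto
    next
      fix j' assume "i = 0" "j = Suc j'"
      then show ?thesis using mem[of j' ts] Cons.prems d by auto
    qed (use d in auto)
  qed simp
  then show "fst (ts ! i) = fst (ts ! j) \<longleftrightarrow> i = j" "snd (ts ! i) = snd (ts ! j) \<longleftrightarrow> i = j" "fst (ts ! i) \<noteq> snd (ts ! j)"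
    by auto
qed

lemma list_crossing:
  "p \<noteq> [] \<Longrightarrow> hd p \<in> A \<Longrightarrow> last p \<notin> A \<Longrightarrow> \<exists>i. Suc i < length p \<and> p ! i \<in> A \<and> p ! Suc i \<notin> A"
proof (induction p)
  case (Cons x p)
  then have p: "p \<noteq> []" by auto
  show ?case
  proof (cases "hd p \<in> A")
    case True
    then obtain i where "Suc i < length p" "p ! i \<in> A" "p ! Suc i \<notin> A" using Cons p by auto
    then show ?thesis by (intro exI[of _ "Suc i"]) auto
  next
    case False
    then show ?thesis using Cons.prems p by (intro exI[of _ 0]) (auto simp: hd_conv_nth)
  qed
qed simp

locale instance_graph =
  fixes n :: nat and E :: "nat \<Rightarrow> nat \<Rightarrow> bool" and ts :: "(nat \<times> nat) list"
  assumes valid: "valid_instance n E ts"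
begin

abbreviation "k \<equiv> length ts"
abbreviation "s i \<equiv> fst (ts ! i)"
abbreviation "t i \<equiv> snd (ts ! i)"
abbreviation "free v \<equiv> v \<notin> set (terms ts)"

definition I :: "nat set" where "I = {i. i < k \<and> \<not> E (s i) (t i)}"

lemma E_sym: "u < n \<Longrightarrow> v < n \<Longrightarrow> E u v \<Longrightarrow> E v u"
  using valid by (auto simp: valid_instance_def simple_graph_def)

lemma dist: "distinct (terms ts)"
proof -
  have "(\<lambda>(s, t). [s, t]) = (\<lambda>p. [fst p, snd p])" for s t :: nat by auto
  then show ?thesis using valid by (simp add: valid_instance_def terms_def case_prod_beta')
qed

lemmas st = distinct_terms[OF dist]

lemma st_n: "i < k \<Longrightarrow> s i < n" "i < k \<Longrightarrow> t i < n"
proof -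
  have "s i < n \<and> t i < n" if "i < k"
    using valid nth_mem[OF that] by (cases "ts ! i") (auto simp: valid_instance_def dest!: bspec)
  then show "i < k \<Longrightarrow> s i < n" "i < k \<Longrightarrow> t i < n" by auto
qed

lemma terms_iff: "v \<in> set (terms ts) \<longleftrightarrow> (\<exists>i<k. v = s i \<or> v = t i)"
proof -
  have "v \<in> set (terms ts) \<longleftrightarrow> (\<exists>p. p \<in> set ts \<and> (v = fst p \<or> v = snd p))"
    unfolding terms_def by (simp add: Bex_def)
  also have "\<dots> \<longleftrightarrow> (\<exists>i<k. v = s i \<or> v = t i)" unfolding in_set_conv_nth by blast
  finally show ?thesis .
qed

lemma set_nonadj: "p \<in> set (nonadj E ts) \<longleftrightarrow> (\<exists>i\<in>I. p = ts ! i)"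
  by (auto simp: nonadj_def I_def in_set_conv_nth)

lemma card_I: "card I = length (nonadj E ts)"
  by (simp add: I_def nonadj_def length_filter_conv_card)

lemma finite_I: "finite I"
  by (simp add: I_def)

lemma hedge_sym: "hedge n E ts u v \<Longrightarrow> hedge n E ts v u"
  using E_sym[of u v] unfolding hedge_def hfree_def by blast

lemma not_hterm: "free v \<Longrightarrow> \<not> hterm E ts v w"
proof
  assume "free v" "hterm E ts v w"
  then obtain p where p: "p \<in> set (nonadj E ts)" "v = fst p" unfolding hterm_def by blast
  then obtain i where "i \<in> I" "p = ts ! i" using set_nonadj by blast
  then show False using p \<open>free v\<close> by (auto simp: terms_iff I_def)
qed

text \<open>Nonadjacent terminals lie in different cliques, so the path has an edge
  \<open>x y\<close> that leaves \<open>A\<close>. If one of its ends is a terminal of the pair, the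
  other end is a common neighbour of the pair. Otherwise both ends are free, and the edge serves
  every nonadjacent pair because each has one terminal in either clique.\<close>

lemma paths_to_edge:
  assumes P: "\<And>i. i < k \<Longrightarrow> is_path n E (P i) (s i) (t i)"
    "\<And>i j. i < k \<Longrightarrow> j < k \<Longrightarrow> i \<noteq> j \<Longrightarrow> set (P i) \<inter> set (P j) = {}"
    and A: "is_clique E A" and B: "is_clique E B" and AB: "A \<union> B = {..<n}" "A \<inter> B = {}"
    and i: "i \<in> I" and iA: "s i \<in> A"
  shows "\<exists>x y. x \<in> set (P i) \<and> y \<in> set (P i) \<and> x \<noteq> y \<and> hedge n E ts x y"
proof -
  have ik: "i < k" using i by (simp add: I_def)
  have cA: "E u v" if "u \<in> A" "v \<in> A" "u \<noteq> v" for u v using A that by (auto simp: is_clique_def)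
  have cB: "E u v" if "u \<in> B" "v \<in> B" "u \<noteq> v" for u v using B that by (auto simp: is_clique_def)
  have split: "s j \<in> A \<and> t j \<in> B \<or> s j \<in> B \<and> t j \<in> A" if "j \<in> I" for j
  proof -
    have j: "j < k" "\<not> E (s j) (t j)" using that by (auto simp: I_def)
    have "s j \<in> A \<union> B" "t j \<in> A \<union> B" using st_n[OF j(1)] unfolding AB(1) by auto
    then show ?thesis using cA[of "s j" "t j"] cB[of "s j" "t j"] j(2) st(3)[OF j(1) j(1)] by blast
  qed
  have tB: "t i \<in> B" "t i \<notin> A" using split[OF i] iA AB by auto
  have p: "P i \<noteq> []" "hd (P i) = s i" "last (P i) = t i" "set (P i) \<subseteq> {0..<n}"
    and pE: "\<And>j. Suc j < length (P i) \<Longrightarrow> E (P i ! j) (P i ! Suc j)" using P(1)[OF ik] by (auto simp: is_path_def)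
  obtain j where j: "Suc j < length (P i)" "P i ! j \<in> A" "P i ! Suc j \<notin> A"
    using list_crossing[of "P i" A] p iA tB by auto
  define x y where "x = P i ! j" and "y = P i ! Suc j"
  have xy: "x \<in> set (P i)" "y \<in> set (P i)" "E x y" "x \<in> A" "y \<notin> A" "x \<noteq> y"
    using j pE by (auto simp: x_def y_def)
  have xn: "x < n" "y < n" using xy p by auto
  then have "y \<in> A \<union> B" unfolding AB(1) by simp
  then have xn: "x < n" "y < n" "y \<in> B" using xn xy by auto
  have fr: "free v" if v: "v \<in> set (P i)" "v \<noteq> s i" "v \<noteq> t i" for v
  proof
    assume "v \<in> set (terms ts)"
    then obtain j where j: "j < k" "v = s j \<or> v = t j" unfolding terms_iff by blast
    have "P j \<noteq> []" "hd (P j) = s j" "last (P j) = t j" using P(1)[OF j(1)] by (auto simp: is_path_def)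
    then have "v \<in> set (P j)" using j(2) hd_in_set[of "P j"] last_in_set[of "P j"] by auto
    moreover have "j \<noteq> i" using j v by auto
    ultimately show False using P(2)[OF ik j(1)] v by auto
  qed
  have i_na: "ts ! i \<in> set (nonadj E ts)" using i set_nonadj by auto
  have nE: "\<not> E (s i) (t i)" using i by (simp add: I_def)
  note stn = st_n[OF ik]
  consider "x = s i" | "x \<noteq> s i" "y = t i" | "x \<noteq> s i" "y \<noteq> t i" by blast
  then show ?thesis
  proof cases
    case 1
    then have "y \<noteq> t i" "y \<noteq> s i" using xy nE by auto
    moreover have "E (t i) y" using cB tB xn \<open>y \<noteq> t i\<close> by auto
    ultimately have "hedge n E ts x y" using 1 xy xn fr[OF xy(2)] i_na unfolding hedge_def hterm_def by blast
    then show ?thesis using xy by blast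
  next
    case 2
    then have f: "free x" using fr xy tB by auto
    have "E (s i) x" using cA iA xy 2 by auto
    moreover have "E (t i) x" using E_sym xy 2 xn by blast
    ultimately have "hedge n E ts x (s i)" using f xn stn i_na unfolding hedge_def hterm_def by blast
    moreover have "s i \<in> set (P i)" using p hd_in_set by metis
    ultimately show ?thesis using xy 2 by blast
  next
    case 3
    then have f: "free x" "free y" using fr xy tB iA by auto
    have "E (fst p) x \<and> E (snd p) y \<or> E (fst p) y \<and> E (snd p) x" if p: "p \<in> set (nonadj E ts)" for p
    proof -
      obtain j where j: "j \<in> I" "p = ts ! j" using p unfolding set_nonadj by blast
      then have "j < k" by (simp add: I_def)
      then have "s j \<noteq> x" "s j \<noteq> y" "t j \<noteq> x" "t j \<noteq> y" using f unfolding terms_iff by blast+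
      then show ?thesis using split[OF j(1)] cA cB xy xn j(2) by blast
    qed
    then have "hedge n E ts x y" using f xy xn unfolding hedge_def hfree_def by blast
    then show ?thesis using xy by blast
  qed
qed

lemma paths_to_matching:
  assumes dp: "disjoint_paths n E ts" and cob: "cobipartite n E"
  shows "\<exists>Y. mt {..<Suc n} (hedge n E ts) Y \<and> card I \<le> msz {..<Suc n} Y"
proof -
  obtain P where P: "\<And>i. i < k \<Longrightarrow> is_path n E (P i) (s i) (t i)"
    "\<And>i j. i < k \<Longrightarrow> j < k \<Longrightarrow> i \<noteq> j \<Longrightarrow> set (P i) \<inter> set (P j) = {}"
    using dp unfolding disjoint_paths_def by blast
  obtain A where A: "A \<subseteq> {0..<n}" "is_clique E A" "is_clique E ({0..<n} - A)"
    using cob unfolding cobipartite_def by blast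
  \<comment> \<open>The two cliques are interchangeable, so the one that contains \<open>s i\<close>
    plays the part of \<open>A\<close>.\<close>
  have "\<exists>x y. x \<in> set (P i) \<and> y \<in> set (P i) \<and> x \<noteq> y \<and> hedge n E ts x y" if i: "i \<in> I" for i
  proof (cases "s i \<in> A")
    case True
    show ?thesis by (rule paths_to_edge[OF P A(2,3) _ _ i True]) (use A(1) in auto)
  next
    case False
    have "s i \<in> {0..<n} - A" using False st_n i by (auto simp: I_def)
    show ?thesis by (rule paths_to_edge[OF P A(3,2) _ _ i \<open>s i \<in> {0..<n} - A\<close>]) (use A(1) in auto)
  qed
  then obtain x y where xy: "\<And>i. i \<in> I \<Longrightarrow> x i \<in> set (P i)" "\<And>i. i \<in> I \<Longrightarrow> y i \<in> set (P i)"
     "\<And>i. i \<in> I \<Longrightarrow> x i \<noteq> y i" "\<And>i. i \<in> I \<Longrightarrow> hedge n E ts (x i) (y i)" by metis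
  \<comment> \<open>The chosen edges lie on disjoint paths and therefore form a matching.\<close>
  have uniq: "i = j" if "i \<in> I" "j \<in> I" "v \<in> {x i, y i}" "v \<in> {x j, y j}" for i j v
  proof (rule ccontr)
    assume "i \<noteq> j"
    moreover have "i < k" "j < k" using that(1,2) by (simp_all add: I_def)
    ultimately have "set (P i) \<inter> set (P j) = {}" using P(2) by simp
    moreover have "v \<in> set (P i)" "v \<in> set (P j)"
      using that(3,4) xy(1,2)[OF that(1)] xy(1,2)[OF that(2)] by auto
    ultimately show False by blast
  qed
  define Y where "Y v = (if \<exists>i\<in>I. v \<in> {x i, y i} then (let i = (THE i. i \<in> I \<and> v \<in> {x i, y i}) in if v = x i then y i else x i) else v)" for v
  have the: "(THE j. j \<in> I \<and> v \<in> {x j, y j}) = i" if "i \<in> I" "v \<in> {x i, y i}" for v i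
    by (rule the_equality) (use that uniq in blast)+
  have Yx: "Y (x i) = y i" "Y (y i) = x i" if "i \<in> I" for i
  proof -
    show "Y (x i) = y i" unfolding Y_def using the[OF that, of "x i"] that by (auto simp: Let_def)
    show "Y (y i) = x i" unfolding Y_def using the[OF that, of "y i"] that xy(3)[OF that] by (auto simp: Let_def)
  qed
  have "mt {..<Suc n} (hedge n E ts) Y"
    unfolding mt_def
  proof
    fix v assume v: "v \<in> {..<Suc n}"
    show "Y v \<in> {..<Suc n} \<and> Y (Y v) = v \<and> (Y v \<noteq> v \<longrightarrow> hedge n E ts v (Y v))"
    proof (cases "\<exists>i\<in>I. v \<in> {x i, y i}")
      case True
      then obtain i where i: "i \<in> I" "v = x i \<or> v = y i" by auto
      have "x i < n" "y i < n" using xy(4)[OF i(1)] by (auto simp: hedge_def)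
      then show ?thesis using i Yx[OF i(1)] xy(4)[OF i(1)] hedge_sym by auto
    next
      case False
      then have "Y v = v" by (simp add: Y_def)
      then show ?thesis using v by simp
    qed
  qed
  moreover have "card I \<le> msz {..<Suc n} Y"
    unfolding msz_def
  proof (rule card_inj_on_le)
    show "inj_on (\<lambda>i. min (x i) (y i)) I"
    proof (rule inj_onI)
      fix i j assume ij: "i \<in> I" "j \<in> I" "min (x i) (y i) = min (x j) (y j)"
      have "min (x i) (y i) \<in> {x i, y i}" "min (x j) (y j) \<in> {x j, y j}" by (auto simp: min_def)
      then show "i = j" using uniq[OF ij(1,2)] ij(3) by metis
    qed
    show "(\<lambda>i. min (x i) (y i)) ` I \<subseteq> {v \<in> {..<Suc n}. v < Y v}"
    proof
      fix v assume "v \<in> (\<lambda>i. min (x i) (y i)) ` I"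
      then obtain i where i: "i \<in> I" "v = min (x i) (y i)" by auto
      have "x i < n" "y i < n" using xy(4)[OF i(1)] by (auto simp: hedge_def)
      then show "v \<in> {v \<in> {..<Suc n}. v < Y v}" using i Yx[OF i(1)] xy(3)[OF i(1)] by (auto simp: min_def)
    qed
  qed simp
  ultimately show ?thesis by blast
qed

text \<open>A matching edge at \<open>s i\<close> supplies the pair \<open>i\<close> with a common
  neighbour; \<open>I1\<close> consists of these pairs. All other matching edges have both ends
  free, and there are at least as many of them as pairs left, so every remaining pair gets one of
  its own, traversed in the direction that fits. Adjacent terminals are joined directly.\<close>

lemma matching_to_paths:
  assumes Y: "mt {..<Suc n} (hedge n E ts) Y" and le: "card I \<le> msz {..<Suc n} Y"
  shows "disjoint_paths n E ts"
proof -
  let ?V = "{..<Suc n}"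
  have YY: "Y (Y v) = v" if "v \<in> ?V" for v using Y that by (auto simp: mt_def)
  have YV: "Y v \<in> ?V" if "v \<in> ?V" for v using Y that unfolding mt_def by blast
  have Yh: "hedge n E ts v (Y v)" if "v \<in> ?V" "Y v \<noteq> v" for v using Y that by (auto simp: mt_def)
  have Ik: "i < k" if "i \<in> I" for i using that by (simp add: I_def)
  have s_notfree: "\<not> free (s i)" "\<not> free (t i)" if "i < k" for i using that unfolding terms_iff by blast+
  have sV: "s i \<in> ?V" if "i < k" for i using st_n[OF that] by simp
  define I1 where "I1 = {i \<in> I. Y (s i) \<noteq> s i}"
  define F where "F = {v \<in> ?V. v < Y v \<and> free v \<and> free (Y v)}"
  have I1: "free (Y (s i)) \<and> E (s i) (Y (s i)) \<and> E (t i) (Y (s i)) \<and> Y (s i) < n" if i: "i \<in> I1" for i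
  proof -
    have ik: "i < k" and ne: "Y (s i) \<noteq> s i" using i Ik by (auto simp: I1_def)
    have h: "hedge n E ts (s i) (Y (s i))" using Yh[OF sV[OF ik] ne] .
    then have "hterm E ts (s i) (Y (s i))" using s_notfree[OF ik] by (auto simp: hedge_def hfree_def hterm_def)
    then obtain p where p: "p \<in> set (nonadj E ts)" "s i = fst p" "free (Y (s i))" "E (fst p) (Y (s i))" "E (snd p) (Y (s i))"
      unfolding hterm_def by blast
    obtain j where j: "j \<in> I" "p = ts ! j" using p set_nonadj by blast
    then have "j = i" using st(1)[OF ik Ik[OF j(1)]] p by simp
    then show ?thesis using p j h by (auto simp: hedge_def)
  qed
  have F: "E v (Y v) \<and> v < n \<and> Y v < n \<and> (\<forall>i\<in>I. E (s i) v \<and> E (t i) (Y v) \<or> E (s i) (Y v) \<and> E (t i) v)" if v: "v \<in> F" for v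
  proof -
    have h: "hedge n E ts v (Y v)" and f: "free v" "free (Y v)" using v Yh[of v] by (auto simp: F_def)
    have "hfree E ts v (Y v)" using h not_hterm[OF f(1)] not_hterm[OF f(2)] by (auto simp: hedge_def)
    then have "E v (Y v) \<and> (\<forall>p\<in>set (nonadj E ts). E (fst p) v \<and> E (snd p) (Y v) \<or> E (fst p) (Y v) \<and> E (snd p) v)"
      by (simp add: hfree_def)
    moreover have "v < n" "Y v < n" using h by (auto simp: hedge_def)
    ultimately show ?thesis using set_nonadj by blast
  qed
  have "{v \<in> ?V. v < Y v} \<subseteq> F \<union> (\<lambda>i. min (s i) (Y (s i))) ` I1"
  proof
    fix v assume v: "v \<in> {v \<in> ?V. v < Y v}"
    then have h: "hedge n E ts v (Y v)" using Yh[of v] by auto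
    show "v \<in> F \<union> (\<lambda>i. min (s i) (Y (s i))) ` I1"
    proof (cases "free v \<and> free (Y v)")
      case False
      then have "hterm E ts v (Y v) \<or> hterm E ts (Y v) v" using h by (auto simp: hedge_def hfree_def)
      then obtain p where p: "p \<in> set (nonadj E ts)" "v = fst p \<or> Y v = fst p" unfolding hterm_def by blast
      obtain i where ip: "i \<in> I" "p = ts ! i" using p(1) unfolding set_nonadj by blast
      then have i: "i \<in> I" "v = s i \<or> Y v = s i" using p(2) by simp_all
      then have "i \<in> I1 \<and> v = min (s i) (Y (s i))" using v YY[of v] by (auto simp: I1_def min_def)
      then show ?thesis by blast
    qed (use v in \<open>simp add: F_def\<close>)
  qed
  moreover have finI1: "finite I1" using finite_I by (simp add: I1_def)
  moreover have finF: "finite F" by (simp add: F_def)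
  ultimately have "card {v \<in> ?V. v < Y v} \<le> card (F \<union> (\<lambda>i. min (s i) (Y (s i))) ` I1)"
    by (intro card_mono) auto
  also have "\<dots> \<le> card F + card I1"
    using card_Un_le[of F "(\<lambda>i. min (s i) (Y (s i))) ` I1"] card_image_le[OF finI1, of "\<lambda>i. min (s i) (Y (s i))"] by linarith
  finally have "card I \<le> card F + card I1" using le by (simp add: msz_def)
  moreover have "card (I - I1) = card I - card I1" by (rule card_Diff_subset[OF finI1]) (auto simp: I1_def)
  ultimately have "card (I - I1) \<le> card F" by simp
  then obtain g where g: "inj_on g (I - I1)" "g ` (I - I1) \<subseteq> F"
    using card_le_inj[of "I - I1" F] finite_I finF by blast
  define Q where "Q i = (if i \<notin> I then [] else if i \<in> I1 then [Y (s i)] else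
    if E (s i) (g i) \<and> E (t i) (Y (g i)) then [g i, Y (g i)] else [Y (g i), g i])" for i
  have gF: "g i \<in> F" if "i \<in> I" "i \<notin> I1" for i using g that by auto
  have Qfree: "free v \<and> v < n" if "v \<in> set (Q i)" for v i
    using that I1[of i] gF[of i] F[of "g i"] by (auto simp: Q_def F_def split: if_splits)
  have path: "is_path n E (s i # Q i @ [t i]) (s i) (t i)" if i: "i < k" for i
  proof -
    have n: "s i < n" "t i < n" "s i \<noteq> t i" using st_n i st(3) by auto
    have d: "s i \<notin> set (Q i)" "t i \<notin> set (Q i)" using Qfree[of "s i" i] Qfree[of "t i" i] s_notfree[OF i] by auto
    have sub: "set (Q i) \<subseteq> {0..<n}" using Qfree by auto
    consider "i \<notin> I" | "i \<in> I1" | "i \<in> I" "i \<notin> I1" by (auto simp: I1_def)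
    then show ?thesis
    proof cases
      case 1
      then have "E (s i) (t i)" using i by (simp add: I_def)
      then show ?thesis using 1 n by (auto simp: Q_def is_path_def)
    next
      case 2
      then have "Q i = [Y (s i)]" by (auto simp: Q_def I1_def)
      then show ?thesis using I1[OF 2] n d E_sym[of "t i" "Y (s i)"] by (auto simp: is_path_def less_Suc_eq)
    next
      case 3
      define v where "v = g i"
      have v: "v \<in> F" using gF 3 by (simp add: v_def)
      have ne: "v \<noteq> Y v" using v by (auto simp: F_def)
      have Fv: "E v (Y v)" "E (Y v) v" "v < n" "Y v < n" using F[OF v] E_sym by auto
      have "(Q i = [v, Y v] \<and> E (s i) v \<and> E (t i) (Y v)) \<or> (Q i = [Y v, v] \<and> E (s i) (Y v) \<and> E (t i) v)"
        using F[OF v] 3 by (auto simp: Q_def v_def)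
      then obtain a b where ab: "Q i = [a, b]" "E (s i) a" "E (t i) b" "E a b" "a < n" "b < n" "a \<noteq> b" using Fv ne by metis
      then show ?thesis using n d E_sym[of "t i" b] by (auto simp: is_path_def less_Suc_eq)
    qed
  qed
  have disj: "set (Q i) \<inter> set (Q j) = {}" if "i \<noteq> j" for i j
  proof -
    have FF: "{v, Y v} \<inter> {w, Y w} = {}" if "v \<in> F" "w \<in> F" "v \<noteq> w" for v w
      using that YY[of v] YY[of w] by (auto simp: F_def)
    have IF: "Y (s i) \<notin> {v, Y v}" if "i \<in> I1" "v \<in> F" for i v
    proof -
      have ik: "i < k" using that Ik by (auto simp: I1_def)
      have vF: "free v" "free (Y v)" "v \<in> ?V" using that(2) by (simp_all add: F_def)
      have y: "Y (Y (s i)) = s i" "Y (Y v) = v" using YY[OF sV[OF ik]] YY[OF vF(3)] .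
      show ?thesis
      proof
        assume "Y (s i) \<in> {v, Y v}"
        then have "Y (s i) = v \<or> Y (s i) = Y v" by simp
        then have "s i = Y v \<or> s i = v" using y by metis
        then show False using s_notfree(1)[OF ik] vF(1,2) by metis
      qed
    qed
    have II: "Y (s i) \<noteq> Y (s j)" if "i \<in> I1" "j \<in> I1" "i \<noteq> j" for i j
    proof
      assume eq: "Y (s i) = Y (s j)"
      have ij: "i < k" "j < k" using that Ik by (auto simp: I1_def)
      have "s i = s j" using arg_cong[OF eq, of Y] YY[OF sV[OF ij(1)]] YY[OF sV[OF ij(2)]] by simp
      then show False using st(1)[OF ij] that by simp
    qed
    have Q1: "set (Q i) = {Y (s i)}" if "i \<in> I1" for i using that by (auto simp: Q_def I1_def)
    have Q2: "set (Q i) = {g i, Y (g i)}" if "i \<in> I" "i \<notin> I1" for i using that by (auto simp: Q_def)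
    have Q0: "set (Q i) = {}" if "i \<notin> I" for i using that by (auto simp: Q_def)
    have gg: "g i \<noteq> g j" if "i \<in> I" "i \<notin> I1" "j \<in> I" "j \<notin> I1" "i \<noteq> j" for i j
      using g(1) that by (auto simp: inj_on_def)
    consider "i \<notin> I \<or> j \<notin> I" | "i \<in> I1" "j \<in> I1" | "i \<in> I1" "j \<in> I" "j \<notin> I1" | "i \<in> I" "i \<notin> I1" "j \<in> I1"
      | "i \<in> I" "i \<notin> I1" "j \<in> I" "j \<notin> I1" by blast
    then show ?thesis
    proof cases
      case 1
      then show ?thesis using Q0[of i] Q0[of j] by auto
    next
      case 2
      then show ?thesis unfolding Q1[OF 2(1)] Q1[OF 2(2)] using II[OF 2 that] by simp
    next
      case 3
      then show ?thesis unfolding Q1[OF 3(1)] Q2[OF 3(2,3)] using IF[OF 3(1) gF[OF 3(2,3)]] by simp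
    next
      case 4
      then show ?thesis unfolding Q1[OF 4(3)] Q2[OF 4(1,2)] using IF[OF 4(3) gF[OF 4(1,2)]] by simp
    next
      case 5
      show ?thesis unfolding Q2[OF 5(1,2)] Q2[OF 5(3,4)] by (rule FF[OF gF[OF 5(1,2)] gF[OF 5(3,4)] gg[OF 5 that]])
    qed
  qed
  show ?thesis
    unfolding disjoint_paths_def
  proof (intro exI[of _ "\<lambda>i. s i # Q i @ [t i]"] conjI allI impI)
    show "is_path n E (s i # Q i @ [t i]) (s i) (t i)" if "i < k" for i using path[OF that] .
    fix i j assume ij: "i < k" "j < k" "i \<noteq> j"
    have nq: "s a \<notin> set (Q b)" "t a \<notin> set (Q b)" if "a < k" for a b
      using Qfree[of "s a" b] Qfree[of "t a" b] s_notfree[OF that] by auto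
    show "set (s i # Q i @ [t i]) \<inter> set (s j # Q j @ [t j]) = {}"
      using disj[OF ij(3)] st[OF ij(1,2)] st[OF ij(2,1)] ij(3) nq[OF ij(1), of j] nq[OF ij(2), of i] by auto
  qed
qed

theorem disjoint_paths_iff_matching:
  assumes "cobipartite n E"
  shows "disjoint_paths n E ts \<longleftrightarrow> (\<exists>Y. mt {..<Suc n} (hedge n E ts) Y \<and> length (nonadj E ts) \<le> msz {..<Suc n} Y)"
  using paths_to_matching[OF _ assms] matching_to_paths unfolding card_I by blast

end

section \<open>The matching algorithm\<close>

definition entry :: "nat list \<Rightarrow> nat \<Rightarrow> nat" where
  "entry xs i = (case drop i xs of [] \<Rightarrow> 0 | y # ys \<Rightarrow> y)"

text \<open>The test keeps every candidate a matching: if an end is already matched, the candidate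
  is \<open>X\<close> itself.\<close>

definition l_addp :: "nat \<Rightarrow> nat list \<Rightarrow> nat \<times> nat \<Rightarrow> nat list" where
  "l_addp N X e = (if entry X (fst e) = fst e \<and> entry X (snd e) = snd e
     then map (\<lambda>w. if w = fst e then snd e else if w = snd e then fst e else entry X w) [0..<N] else X)"

text \<open>By \<open>orb_facts\<close>, \<open>N\<close> iterations exhaust the component, since an
  orbit has at most \<open>N\<close> points.\<close>

definition l_orb :: "nat \<Rightarrow> nat list \<Rightarrow> nat list \<Rightarrow> nat \<Rightarrow> nat list" where
  "l_orb N X Y t = snd (((\<lambda>p. (entry Y (entry X (fst p)), fst p # entry X (fst p) # snd p)) ^^ N) (t, []))"

definition l_swp :: "nat \<Rightarrow> nat list \<Rightarrow> nat list \<Rightarrow> nat list \<Rightarrow> nat list" where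
  "l_swp N K X Y = map (\<lambda>w. if list_ex (\<lambda>z. z = w) K then entry Y w else entry X w) [0..<N]"

text \<open>The test \<open>N \<le> entry X w\<close> never succeeds; it bounds the size of the result.\<close>

definition l_restr :: "nat \<Rightarrow> nat list \<Rightarrow> nat list \<Rightarrow> nat list" where
  "l_restr N s X = map (\<lambda>w. if list_ex (\<lambda>z. z = w \<or> z = entry X w) s \<or> N \<le> entry X w then w else entry X w) [0..<N]"

definition l_msz :: "nat \<Rightarrow> nat list \<Rightarrow> nat" where
  "l_msz N X = length (filter (\<lambda>w. w < entry X w) [0..<N])"

text \<open>The pool itself is among the candidates, so that the best sizes never decrease.\<close>

definition l_cands :: "nat \<Rightarrow> (nat \<times> nat) list \<Rightarrow> nat list list \<Rightarrow> nat list list" where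
  "l_cands N es P = P @ concat (map (\<lambda>X. map (\<lambda>e. l_addp N X e) es) P) @
     concat (map (\<lambda>X. concat (map (\<lambda>Y. map (\<lambda>t. l_swp N (l_orb N X Y t) X Y) [0..<N] @
       map (\<lambda>t. l_swp N (l_orb N X Y t) Y X) [0..<N]) P)) P)"

text \<open>The search starts from the empty matching, which avoids every \<open>s\<close>.\<close>

definition l_best :: "nat \<Rightarrow> nat list list \<Rightarrow> nat list \<Rightarrow> nat list" where
  "l_best N C s = foldl (\<lambda>b Z. if l_msz N b < l_msz N (l_restr N s Z) then l_restr N s Z else b) [0..<N] C"

definition extend :: "nat \<Rightarrow> nat list list \<Rightarrow> nat list list" where
  "extend N L = concat (map (\<lambda>l. map (\<lambda>v. v # l) [0..<N]) L)"

definition tuples :: "nat \<Rightarrow> nat list list" where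
  "tuples N = extend N (extend N (extend N (extend N (extend N [[]]))))"

definition l_round :: "nat \<Rightarrow> (nat \<times> nat) list \<Rightarrow> nat list list \<Rightarrow> nat list list" where
  "l_round N es P = map (\<lambda>s. l_best N (l_cands N es P) s) (tuples N)"

text \<open>The sum of the best sizes over all tuples is at most
  \<open>length (tuples N) * N\<close> and grows strictly until some round improves nothing. Since
  sizes never decrease, a fixed number of rounds beyond this bound may be run instead of testing for
  stability.\<close>

definition l_match :: "nat \<Rightarrow> (nat \<times> nat) list \<Rightarrow> nat list list" where
  "l_match N es = (l_round N es ^^ (length (tuples N) * N + 2)) [[0..<N]]"

section \<open>Correctness of the list operations\<close>

lemma entry_nth: "i < length xs \<Longrightarrow> entry xs i = xs ! i"
  by (simp add: entry_def flip: Cons_nth_drop_Suc)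

lemma entry_map: "w < N \<Longrightarrow> entry (map f [0..<N]) w = f w"
  by (simp add: entry_nth)

lemma entry_upt: "w < N \<Longrightarrow> entry [0..<N] w = w"
  by (simp add: entry_nth)

lemma l_msz: "l_msz N X = msz {..<N} (entry X)"
proof -
  have "l_msz N X = card (set (filter (\<lambda>w. w < entry X w) [0..<N]))"
    unfolding l_msz_def by (rule distinct_card[symmetric]) simp
  also have "set (filter (\<lambda>w. w < entry X w) [0..<N]) = {v \<in> {..<N}. v < entry X v}" by auto
  finally show ?thesis by (simp add: msz_def)
qed

lemma set_extend: "s \<in> set (extend N L) \<longleftrightarrow> (\<exists>v l. s = v # l \<and> v < N \<and> l \<in> set L)"
  by (fastforce simp: extend_def image_iff)

lemma set_tuples: "s \<in> set (tuples N) \<longleftrightarrow> length s = 5 \<and> set s \<subseteq> {..<N}"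
proof -
  have "s \<in> set (tuples N) \<longleftrightarrow> (\<exists>a b c d e. s = [a, b, c, d, e] \<and> a < N \<and> b < N \<and> c < N \<and> d < N \<and> e < N)"
    unfolding tuples_def set_extend by auto
  also have "\<dots> \<longleftrightarrow> length s = 5 \<and> set s \<subseteq> {..<N}"
    by (auto simp: numeral_eq_Suc length_Suc_conv)
  finally show ?thesis .
qed

lemma set_l_orb:
  "set (l_orb N X Y t) = (\<Union>j<N. {((entry Y \<circ> entry X) ^^ j) t, entry X (((entry Y \<circ> entry X) ^^ j) t)})"
proof -
  let ?F = "\<lambda>p. (entry Y (entry X (fst p)), fst p # entry X (fst p) # snd p)"
  let ?p = "entry Y \<circ> entry X"
  have "fst ((?F ^^ N) (t, [])) = (?p ^^ N) t \<and>
      set (snd ((?F ^^ N) (t, []))) = (\<Union>j<N. {(?p ^^ j) t, entry X ((?p ^^ j) t)})"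
    by (induction N) (auto simp: lessThan_Suc)
  then show ?thesis by (simp add: l_orb_def)
qed

lemma mt_cong: "(\<And>v. v \<in> V \<Longrightarrow> X v = Y v) \<Longrightarrow> mt V E X = mt V E Y"
  unfolding mt_def by (metis (no_types, lifting))

text \<open>Vertex \<open>n\<close> has no edges. It fills up the tuple that represents a set of
  fewer than five vertices, even the empty set; avoiding it costs a matching nothing.\<close>

locale matching_alg =
  fixes n N :: nat and H :: "nat \<Rightarrow> nat \<Rightarrow> bool" and es :: "(nat \<times> nat) list"
  assumes N: "N = Suc n" and es: "\<And>e. e \<in> set es \<longleftrightarrow> H (fst e) (snd e)"
    and Hn: "\<And>u v. H u v \<Longrightarrow> u < n \<and> v < n" and Hsym: "\<And>u v. H u v \<Longrightarrow> H v u"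
begin

abbreviation "V \<equiv> {..<N}"

definition vl :: "nat list \<Rightarrow> bool" where
  "vl X \<longleftrightarrow> mt V H (entry X)"

lemma vlD: "vl X \<Longrightarrow> w < N \<Longrightarrow> entry X w < N"
  by (auto simp: vl_def mt_def)

lemma vl_dummy: "vl X \<Longrightarrow> entry X n = n"
proof -
  assume "vl X"
  moreover have "n \<in> V" by (simp add: N)
  ultimately have "entry X n \<noteq> n \<longrightarrow> H n (entry X n)" unfolding vl_def mt_def by blast
  then show ?thesis using Hn by blast
qed

lemma l_restr: assumes "vl X" shows "w < N \<Longrightarrow> entry (l_restr N s X) w = restr (set s) (entry X) w"
  using vlD[OF assms, of w] by (auto simp: l_restr_def entry_map restr_def list_ex_iff)

lemma vl_restr: "vl X \<Longrightarrow> vl (l_restr N s X)"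
  unfolding vl_def using mt_cong[of V "entry (l_restr N s X)" "restr (set s) (entry X)"] l_restr mt_restr
  by (auto simp: vl_def)

lemma msz_l_restr: "vl X \<Longrightarrow> l_msz N (l_restr N s X) = msz V (restr (set s) (entry X))"
  unfolding l_msz by (rule msz_cong) (use l_restr in auto)

lemma l_swp: assumes "vl X" "vl Y" "t < N"
  shows "w < N \<Longrightarrow> entry (l_swp N (l_orb N X Y t) X Y) w = swp (orb (entry X) (entry Y) t) (entry X) (entry Y) w"
    "w < N \<Longrightarrow> entry (l_swp N (l_orb N X Y t) Y X) w = swp (orb (entry X) (entry Y) t) (entry Y) (entry X) w"
proof -
  have "set (l_orb N X Y t) = orb (entry X) (entry Y) t"
    using orb_facts(4)[of V H "entry X" "entry Y" t] assms by (simp add: vl_def set_l_orb)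
  then show "w < N \<Longrightarrow> entry (l_swp N (l_orb N X Y t) X Y) w = swp (orb (entry X) (entry Y) t) (entry X) (entry Y) w"
    "w < N \<Longrightarrow> entry (l_swp N (l_orb N X Y t) Y X) w = swp (orb (entry X) (entry Y) t) (entry Y) (entry X) w"
    by (auto simp: l_swp_def entry_map swp_def list_ex_iff)
qed

lemma vl_swp: assumes "vl X" "vl Y" "t < N"
  shows "vl (l_swp N (l_orb N X Y t) X Y)" "vl (l_swp N (l_orb N X Y t) Y X)"
proof -
  have m: "mt V H (entry X)" "mt V H (entry Y)" "t \<in> V" using assms by (simp_all add: vl_def)
  have "mt V H (swp (orb (entry X) (entry Y) t) (entry X) (entry Y))"
    by (rule mt_swp[OF m(1,2) orb_facts(1)[OF _ m] orb_facts(2)[OF _ m] orb_facts(3)[OF _ m]]) auto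
  then show "vl (l_swp N (l_orb N X Y t) X Y)" unfolding vl_def
    using mt_cong[of V, OF l_swp(1)[OF assms]] by simp
  have "mt V H (swp (orb (entry X) (entry Y) t) (entry Y) (entry X))"
    by (rule mt_swp[OF m(2,1) orb_facts(1)[OF _ m] orb_facts(3)[OF _ m] orb_facts(2)[OF _ m]]) auto
  then show "vl (l_swp N (l_orb N X Y t) Y X)" unfolding vl_def
    using mt_cong[of V, OF l_swp(2)[OF assms]] by simp
qed

lemma l_addp: assumes "entry X u = u" "entry X v = v"
  shows "w < N \<Longrightarrow> entry (l_addp N X (u, v)) w = addp u v (entry X) w"
  using assms by (auto simp: l_addp_def addp_def entry_map)

lemma vl_addp: assumes "vl X" "(u, v) \<in> set es" shows "vl (l_addp N X (u, v))"
proof (cases "entry X u = u \<and> entry X v = v")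
  case True
  have uv: "H u v" "H v u" using assms(2) es[of "(u, v)"] Hsym by auto
  have "mt V H (addp u v (entry X))"
  proof (cases "u = v")
    case True
    then have "addp u v (entry X) = entry X" using \<open>entry X u = u \<and> entry X v = v\<close> by (auto simp: addp_def)
    then show ?thesis using assms by (simp add: vl_def)
  next
    case False
    have "u \<in> V" "v \<in> V" using Hn[OF uv(1)] by (simp_all add: N)
    then show ?thesis using assms True uv False by (intro mt_addp) (auto simp: vl_def)
  qed
  then show ?thesis unfolding vl_def using mt_cong[of V, OF l_addp[of X u v]] True by simp
qed (use assms in \<open>auto simp: l_addp_def\<close>)

lemma vl_cands: assumes "\<And>X. X \<in> set P \<Longrightarrow> vl X" "Z \<in> set (l_cands N es P)" shows "vl Z"
  using assms(2) vl_addp[OF assms(1)] vl_swp[OF assms(1) assms(1)] assms(1) unfolding l_cands_def by auto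

lemma cands_swp:
  assumes "X \<in> set P" "Y \<in> set P" "t < N"
  shows "l_swp N (l_orb N X Y t) X Y \<in> set (l_cands N es P)" "l_swp N (l_orb N X Y t) Y X \<in> set (l_cands N es P)"
proof -
  let ?L = "\<lambda>X Y. map (\<lambda>t. l_swp N (l_orb N X Y t) X Y) [0..<N] @ map (\<lambda>t. l_swp N (l_orb N X Y t) Y X) [0..<N]"
  have "set (?L X Y) \<subseteq> set (concat (map (?L X) P))" using assms(2) by (auto simp only: set_concat set_map)
  also have "\<dots> \<subseteq> set (concat (map (\<lambda>X. concat (map (?L X) P)) P))" 
    unfolding set_concat set_map image_image by (rule UN_upper[OF assms(1)])
  also have "\<dots> \<subseteq> set (l_cands N es P)"
    unfolding l_cands_def set_append by (rule le_supI2, rule le_supI2, rule order_refl)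
  finally have sub: "set (?L X Y) \<subseteq> set (l_cands N es P)" .
  show "l_swp N (l_orb N X Y t) X Y \<in> set (l_cands N es P)" "l_swp N (l_orb N X Y t) Y X \<in> set (l_cands N es P)"
    by (rule subsetD[OF sub]; use assms(3) in force)+
qed

lemma vl_id: "vl [0..<N]"
  by (auto simp: vl_def mt_def entry_upt)

lemma l_best:
  assumes "\<And>Z. Z \<in> set C \<Longrightarrow> vl Z"
  shows "vl (l_best N C s)" "v \<in> set s \<Longrightarrow> v < N \<Longrightarrow> entry (l_best N C s) v = v"
    "Z \<in> set C \<Longrightarrow> msz V (restr (set s) (entry Z)) \<le> l_msz N (l_best N C s)"
proof -
  define F where "F = (\<lambda>b Z. if l_msz N b < l_msz N (l_restr N s Z) then l_restr N s Z else b)"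
  let ?ok = "\<lambda>b. vl b \<and> (\<forall>v\<in>set s. v < N \<longrightarrow> entry b v = v)"
  have F_step: "?ok b \<Longrightarrow> vl Z \<Longrightarrow> ?ok (F b Z) \<and> l_msz N b \<le> l_msz N (F b Z) \<and> l_msz N (l_restr N s Z) \<le> l_msz N (F b Z)" for b Z
    using vl_restr[of Z s] l_restr[of Z _ s] by (auto simp: restr_def F_def)
  have "?ok b \<Longrightarrow> \<forall>Z\<in>set C. vl Z \<Longrightarrow> ?ok (foldl F b C) \<and> l_msz N b \<le> l_msz N (foldl F b C) \<and>
      (\<forall>Z\<in>set C. l_msz N (l_restr N s Z) \<le> l_msz N (foldl F b C))" for b
  proof (induction C arbitrary: b)
    case (Cons Z C)
    then have 1: "?ok (F b Z)" "l_msz N b \<le> l_msz N (F b Z)" "l_msz N (l_restr N s Z) \<le> l_msz N (F b Z)"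
      using F_step[of b Z] by simp_all
    have 2: "?ok (foldl F (F b Z) C)" "l_msz N (F b Z) \<le> l_msz N (foldl F (F b Z) C)"
      "\<forall>W\<in>set C. l_msz N (l_restr N s W) \<le> l_msz N (foldl F (F b Z) C)"
    proof -
      have "\<forall>Z\<in>set C. vl Z" using Cons.prems by simp
      note IH = Cons.IH[OF 1(1) this]
      show "?ok (foldl F (F b Z) C)" by (rule IH[THEN conjunct1])
      show "l_msz N (F b Z) \<le> l_msz N (foldl F (F b Z) C)" by (rule IH[THEN conjunct2, THEN conjunct1])
      show "\<forall>W\<in>set C. l_msz N (l_restr N s W) \<le> l_msz N (foldl F (F b Z) C)" by (rule IH[THEN conjunct2, THEN conjunct2])
    qed
    show ?case using 2(1,3) order_trans[OF 1(2) 2(2)] order_trans[OF 1(3) 2(2)] by simp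
  qed simp
  from this[of "[0..<N]"] have *: "?ok (l_best N C s)" "\<forall>Z\<in>set C. l_msz N (l_restr N s Z) \<le> l_msz N (l_best N C s)"
    using vl_id assms by (auto simp: l_best_def entry_upt F_def)
  show "vl (l_best N C s)" "v \<in> set s \<Longrightarrow> v < N \<Longrightarrow> entry (l_best N C s) v = v" using *(1) by auto
  show "Z \<in> set C \<Longrightarrow> msz V (restr (set s) (entry Z)) \<le> l_msz N (l_best N C s)"
    using *(2) msz_l_restr[OF assms] by simp
qed

section \<open>Rounds of the local search\<close>

definition pool :: "nat \<Rightarrow> nat list list" where
  "pool i = (l_round N es ^^ i) [[0..<N]]"

definition bst :: "nat \<Rightarrow> nat list \<Rightarrow> nat list" where
  "bst i s = l_best N (l_cands N es (pool i)) s"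

lemma pool_Suc: "pool (Suc i) = map (bst i) (tuples N)"
  by (simp add: pool_def l_round_def bst_def)

lemma vl_pool: "X \<in> set (pool i) \<Longrightarrow> vl X"
proof (induction i arbitrary: X)
  case 0
  then show ?case using vl_id by (simp add: pool_def)
next
  case (Suc i)
  then obtain s where "X = bst i s" by (auto simp: pool_Suc)
  then show ?case using l_best(1)[OF vl_cands[OF Suc.IH]] by (simp add: bst_def)
qed

lemma bst:
  shows "vl (bst i s)" "v \<in> set s \<Longrightarrow> v < N \<Longrightarrow> entry (bst i s) v = v"
    "Z \<in> set (l_cands N es (pool i)) \<Longrightarrow> msz V (restr (set s) (entry Z)) \<le> l_msz N (bst i s)"
  unfolding bst_def by (rule l_best[OF vl_cands[OF vl_pool]]; assumption)+

lemma bst_mono: assumes "s \<in> set (tuples N)" shows "l_msz N (bst i s) \<le> l_msz N (bst (Suc i) s)"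
proof -
  have "bst i s \<in> set (pool (Suc i))" using assms by (auto simp: pool_Suc)
  then have "bst i s \<in> set (l_cands N es (pool (Suc i)))" by (simp add: l_cands_def)
  from bst(3)[OF this, of s] have "msz V (restr (set s) (entry (bst i s))) \<le> l_msz N (bst (Suc i) s)" .
  moreover have "msz V (restr (set s) (entry (bst i s))) = msz V (entry (bst i s))"
    by (rule msz_cong) (rule restr_missed[of V H], use bst(1)[of i s] bst(2)[where i = i and s = s] assms in \<open>auto simp: vl_def set_tuples\<close>)
  ultimately show ?thesis by (simp add: l_msz)
qed

lemma stable_round: "\<exists>i \<le> length (tuples N) * N. \<forall>s\<in>set (tuples N). l_msz N (bst (Suc i) s) = l_msz N (bst i s)"
proof (rule ccontr)
  assume no: "\<not> ?thesis"
  define \<Phi> where "\<Phi> i = (\<Sum>s\<in>set (tuples N). l_msz N (bst i s))" for i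
  have "\<Phi> i < \<Phi> (Suc i)" if i: "i \<le> length (tuples N) * N" for i
    unfolding \<Phi>_def
  proof (rule sum_strict_mono_ex1)
    show "\<exists>s\<in>set (tuples N). l_msz N (bst i s) < l_msz N (bst (Suc i) s)"
      using no i bst_mono by (metis le_neq_implies_less)
  qed (use bst_mono in auto)
  then have "i \<le> length (tuples N) * N + 1 \<Longrightarrow> i \<le> \<Phi> i" for i
  proof (induction i)
    case (Suc i)
    then show ?case by fastforce
  qed simp
  from this[of "length (tuples N) * N + 1"] have "length (tuples N) * N < \<Phi> (length (tuples N) * N + 1)" by simp
  moreover have "\<Phi> i \<le> length (tuples N) * N" for i
  proof -
    have "l_msz N X \<le> N" for X unfolding l_msz_def using length_filter_le[of _ "[0..<N]"] by simp
    then have "\<Phi> i \<le> card (set (tuples N)) * N" unfolding \<Phi>_def using sum_bounded_above[of "set (tuples N)" _ N] by simp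
    also have "\<dots> \<le> length (tuples N) * N" using card_length by (rule mult_right_mono) simp
    finally show ?thesis .
  qed
  ultimately show False using not_less by blast
qed

text \<open>At a stable round \<open>i\<close> the pool of round \<open>Suc i\<close> is a
  \<open>local_optimum\<close>: its members attain \<open>f\<close>, and no candidate built from
  them does better. \<open>bst_mono\<close> carries the optimal size from there to the final
  round.\<close>

theorem l_match:
  "(\<exists>X\<in>set (l_match N es). k \<le> l_msz N X) \<longleftrightarrow> (\<exists>Y. mt V H Y \<and> k \<le> msz V Y)"
proof
  have P: "l_match N es = pool (length (tuples N) * N + 2)" by (simp add: l_match_def pool_def)
  assume "\<exists>X\<in>set (l_match N es). k \<le> l_msz N X"
  then obtain X where "X \<in> set (l_match N es)" "k \<le> l_msz N X" by blast
  then have "mt V H (entry X) \<and> k \<le> msz V (entry X)" using vl_pool[of X] P by (simp add: vl_def l_msz)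
  then show "\<exists>Y. mt V H Y \<and> k \<le> msz V Y" by blast
next
  have P: "l_match N es = pool (length (tuples N) * N + 2)" by (simp add: l_match_def pool_def)
  assume "\<exists>Y. mt V H Y \<and> k \<le> msz V Y"
  then obtain Y where Y: "mt V H Y" "k \<le> msz V Y" by blast
  obtain i where i: "i \<le> length (tuples N) * N"
    and stable: "\<And>s. s \<in> set (tuples N) \<Longrightarrow> l_msz N (bst (Suc i) s) = l_msz N (bst i s)"
    using stable_round by blast
  have "\<exists>xs. s \<subseteq> set xs \<and> set xs \<subseteq> insert n s \<and> length xs = 5" if s: "s \<subseteq> V" "card s \<le> 5" for s
  proof -
    obtain ys where ys: "set ys = s" "distinct ys" using finite_distinct_list[of s] s(1) finite_subset by blast
    then have "length ys \<le> 5" using s(2) distinct_card by metis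
    then show ?thesis using ys by (intro exI[of _ "ys @ replicate (5 - length ys) n"]) auto
  qed
  then obtain rep where rep: "\<And>s. s \<subseteq> V \<Longrightarrow> card s \<le> 5 \<Longrightarrow> s \<subseteq> set (rep s) \<and> set (rep s) \<subseteq> insert n s \<and> length (rep s) = 5"
    by metis
  have rep_t: "rep s \<in> set (tuples N)" if "s \<subseteq> V" "card s \<le> 5" for s
    using rep[OF that] that(1) by (auto simp: set_tuples N)
  define f where "f s = l_msz N (bst i (rep s))" for s
  have ub: "msz V (restr s (entry Z)) \<le> f s" if Z: "Z \<in> set (l_cands N es (pool (Suc i)))" and s: "s \<subseteq> V" "card s \<le> 5" for Z s
  proof -
    have "vl Z" using vl_cands[OF vl_pool Z] .
    have "msz V (restr s (entry Z)) = msz V (restr (set (rep s)) (entry Z))"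
    proof (rule msz_cong)
      fix v assume v: "v \<in> V"
      have "entry Z (entry Z v) = v" using \<open>vl Z\<close> v by (auto simp: vl_def mt_def)
      then show "restr s (entry Z) v = restr (set (rep s)) (entry Z) v"
        using rep[OF s] vl_dummy[OF \<open>vl Z\<close>] by (auto simp: restr_def)
    qed
    also have "\<dots> \<le> l_msz N (bst (Suc i) (rep s))" by (rule bst(3)[OF Z])
    also have "\<dots> = f s" using stable[OF rep_t[OF s]] by (simp add: f_def)
    finally show ?thesis .
  qed
  interpret local_optimum V H "entry ` set (pool (Suc i))" f
  proof
    show "finite V" by simp
    show "H v u" if "H u v" for u v using Hsym that .
    show "mt V H X" if "X \<in> entry ` set (pool (Suc i))" for X using that vl_pool[of _ "Suc i"] by (auto simp: vl_def)
    fix s assume s: "s \<subseteq> V" "card s \<le> 5"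
    show "\<exists>X\<in>entry ` set (pool (Suc i)). (\<forall>v\<in>s. X v = v) \<and> msz V X = f s"
    proof (rule bexI[of _ "entry (bst i (rep s))"])
      show "entry (bst i (rep s)) \<in> entry ` set (pool (Suc i))" using rep_t[OF s] by (auto simp: pool_Suc)
      show "(\<forall>v\<in>s. entry (bst i (rep s)) v = v) \<and> msz V (entry (bst i (rep s))) = f s"
        using bst(2)[of _ "rep s" i] rep[OF s] s(1) by (auto simp: f_def l_msz)
    qed
    fix X assume "X \<in> entry ` set (pool (Suc i))"
    then obtain X' where X: "X = entry X'" "X' \<in> set (pool (Suc i))" by auto
    have "X' \<in> set (l_cands N es (pool (Suc i)))" using X by (simp add: l_cands_def)
    then show "msz V (restr s X) \<le> f s" using ub s X by blast
    show "msz V (restr s (addp u v X)) \<le> f s" if "H u v" "X u = u" "X v = v" for u v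
    proof -
      have "(u, v) \<in> set es" using es[of "(u, v)"] that by simp
      then have "l_addp N X' (u, v) \<in> set (l_cands N es (pool (Suc i)))" using X by (auto simp: l_cands_def)
      from ub[OF this s] have "msz V (restr s (entry (l_addp N X' (u, v)))) \<le> f s" .
      moreover have "mt V H (entry (l_addp N X' (u, v)))" using vl_addp[OF vl_pool[OF X(2)] \<open>(u, v) \<in> set es\<close>] by (simp add: vl_def)
      ultimately show ?thesis
        using msz_cong[of V "restr s (entry (l_addp N X' (u, v)))" "restr s (addp u v X)"] l_addp[of X' u v] that X
        by (simp add: restr_def)
    qed
    fix Y t assume "Y \<in> entry ` set (pool (Suc i))" and t: "t \<in> V"
    then obtain Y' where Y: "Y = entry Y'" "Y' \<in> set (pool (Suc i))" by auto
    have t': "t < N" using t by simp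
    have "l_swp N (l_orb N X' Y' t) X' Y' \<in> set (l_cands N es (pool (Suc i)))"
      "l_swp N (l_orb N X' Y' t) Y' X' \<in> set (l_cands N es (pool (Suc i)))"
      by (rule cands_swp[OF X(2) Y(2) t'])+
    from ub[OF this(1) s] ub[OF this(2) s]
    show "msz V (restr s (swp (orb X Y t) X Y)) \<le> f s \<and> msz V (restr s (swp (orb X Y t) Y X)) \<le> f s"
      using msz_cong[of V "restr s (entry (l_swp N (l_orb N X' Y' t) X' Y'))" "restr s (swp (orb X Y t) X Y)"]
        msz_cong[of V "restr s (entry (l_swp N (l_orb N X' Y' t) Y' X'))" "restr s (swp (orb X Y t) Y X)"]
        l_swp[OF vl_pool[OF X(2)] vl_pool[OF Y(2)] t'] X Y
      by (simp add: restr_def)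
  qed
  have "k \<le> f {}" using optimal[OF Y(1)] Y(2) by simp
  also have "\<dots> \<le> l_msz N (bst (i + j) (rep {}))" for j
    unfolding f_def by (induction j) (use order_trans[OF _ bst_mono[OF rep_t[of "{}"]]] in auto)
  finally have k: "k \<le> l_msz N (bst (length (tuples N) * N + 1) (rep {}))" using i
    by (metis le_add_diff_inverse trans_le_add1)
  have "bst (length (tuples N) * N + 1) (rep {}) \<in> set (l_match N es)"
    using rep_t[of "{}"] unfolding P by (auto simp: pool_Suc numeral_2_eq_2)
  then show "\<exists>X\<in>set (l_match N es). k \<le> l_msz N X" using k by blast
qed

end

subsection \<open>Running time of the matching algorithm\<close>

lemma ptime_entry [ptime_intros]: "ptime X \<Longrightarrow> ptime i \<Longrightarrow> ptime (\<lambda>x. entry (X x) (i x))"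
  unfolding entry_def by (intro ptime_intros)

lemma ptime_l_addp [ptime_intros]:
  assumes "ptime N" "ptime X" "ptime e" shows "ptime (\<lambda>x. l_addp (N x) (X x) (e x))"
  unfolding l_addp_def by (intro ptime_intros assms assms[THEN ptime_comp])

lemma ptime_l_swp [ptime_intros]:
  assumes "ptime N" "ptime K" "ptime X" "ptime Y" shows "ptime (\<lambda>x. l_swp (N x) (K x) (X x) (Y x))"
  unfolding l_swp_def by (intro ptime_intros assms assms[THEN ptime_comp])

lemma ptime_l_restr [ptime_intros]:
  assumes "ptime N" "ptime s" "ptime X" shows "ptime (\<lambda>x. l_restr (N x) (s x) (X x))"
  unfolding l_restr_def by (intro ptime_intros assms assms[THEN ptime_comp])

lemma ptime_l_msz [ptime_intros]:
  assumes "ptime N" "ptime X" shows "ptime (\<lambda>x. l_msz (N x) (X x))"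
  unfolding l_msz_def by (intro ptime_intros assms assms[THEN ptime_comp])

lemma sz_entry: "sz (entry X i) \<le> sz X"
proof (cases "i < length X")
  case True
  then show ?thesis using sz_mem[of "X ! i" X] by (simp add: entry_nth)
next
  case False
  then show ?thesis by (simp add: entry_def)
qed

lemma ptime_l_orb [ptime_intros]:
  assumes "ptime N" "ptime X" "ptime Y" "ptime t" shows "ptime (\<lambda>x. l_orb (N x) (X x) (Y x) (t x))"
proof -
  have "ptime (\<lambda>x. ((\<lambda>p. (entry (Y x) (entry (X x) (fst p)), fst p # entry (X x) (fst p) # snd p)) ^^ N x) (t x, []))"
  proof (rule ptime_funpow_grow[where G = "\<lambda>x. sz (X x) + sz (Y x) + 2"])
    show "sz (entry (Y x) (entry (X x) (fst p)), fst p # entry (X x) (fst p) # snd p) \<le> sz p + (sz (X x) + sz (Y x) + 2)" for x p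
      using sz_entry[of "Y x" "entry (X x) (fst p)"] sz_entry[of "X x" "fst p"] by (cases p) simp
    show "pb sz (\<lambda>x. sz (X x) + sz (Y x) + 2)" by (intro pb_add pb_const ptime_sz assms)
  qed (intro ptime_intros assms assms[THEN ptime_comp])+
  then show ?thesis unfolding l_orb_def by (rule ptime_snd)
qed

lemma ptime_l_cands [ptime_intros]:
  assumes "ptime N" "ptime es" "ptime P" shows "ptime (\<lambda>x. l_cands (N x) (es x) (P x))"
  unfolding l_cands_def by (intro ptime_intros assms assms[THEN ptime_comp])

lemma sz_map_upt: "(\<And>w. w < N \<Longrightarrow> f w \<le> N) \<Longrightarrow> sz (map f [0..<N]) \<le> 1 + N * (2 * N + 2)"
proof -
  assume f: "\<And>w. w < N \<Longrightarrow> f w \<le> N"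
  have "\<forall>w\<in>set ws. g w \<le> N \<Longrightarrow> sz (map g ws) \<le> 1 + length ws * (2 * N + 2)" for ws and g :: "nat \<Rightarrow> nat"
    by (induction ws) (auto simp: sz_nat)
  from this[of "[0..<N]" f] show ?thesis using f by simp
qed

lemma sz_l_restr: "sz (l_restr N s X) \<le> 1 + N * (2 * N + 2)"
  unfolding l_restr_def by (rule sz_map_upt) auto

lemma ptime_l_best [ptime_intros]:
  assumes "ptime N" "ptime C" "ptime s" shows "ptime (\<lambda>x. l_best (N x) (C x) (s x))"
  unfolding l_best_def
proof (rule ptime_foldl[where G = "\<lambda>x. 1 + sz (N x) * (2 * sz (N x) + 2)"])
  show "pb sz (\<lambda>x. 1 + sz (N x) * (2 * sz (N x) + 2))" by (intro pb_add pb_mult pb_const ptime_sz assms)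
  show "sz (if l_msz (N x) b < l_msz (N x) (l_restr (N x) (s x) Z) then l_restr (N x) (s x) Z else b)
    \<le> sz b + (1 + sz (N x) * (2 * sz (N x) + 2))" for x Z b
  proof -
    have "N x * (2 * N x + 2) \<le> sz (N x) * (2 * sz (N x) + 2)" by (intro mult_mono) (auto simp: sz_nat)
    then show ?thesis using sz_l_restr[of "N x" "s x" Z] by auto
  qed
qed (intro ptime_intros assms assms[THEN ptime_comp])+

lemma ptime_extend [ptime_intros]:
  assumes "ptime N" "ptime L" shows "ptime (\<lambda>x. extend (N x) (L x))"
  unfolding extend_def by (intro ptime_intros assms assms[THEN ptime_comp])

lemma ptime_tuples [ptime_intros]: "ptime N \<Longrightarrow> ptime (\<lambda>x. tuples (N x))"
  unfolding tuples_def by (intro ptime_intros)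

lemma ptime_l_round [ptime_intros]:
  assumes "ptime N" "ptime es" "ptime P" shows "ptime (\<lambda>x. l_round (N x) (es x) (P x))"
  unfolding l_round_def by (intro ptime_intros assms assms[THEN ptime_comp])

lemma sz_l_best: "sz (l_best N C s) \<le> 1 + N * (2 * N + 2)"
proof -
  have *: "sz b \<le> B \<Longrightarrow> (\<And>Z. sz (l_restr N s Z) \<le> B) \<Longrightarrow>
    sz (foldl (\<lambda>b Z. if l_msz N b < l_msz N (l_restr N s Z) then l_restr N s Z else b) b C) \<le> B" for b B
    by (induction C arbitrary: b) auto
  have "sz b \<le> 1 + N * (2 * N + 2) \<Longrightarrow>
    sz (foldl (\<lambda>b Z. if l_msz N b < l_msz N (l_restr N s Z) then l_restr N s Z else b) b C) \<le> 1 + N * (2 * N + 2)" for b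
    by (rule *[OF _ sz_l_restr])
  moreover have "sz (map (\<lambda>w. w) [0..<N]) \<le> 1 + N * (2 * N + 2)" by (rule sz_map_upt) auto
  ultimately show ?thesis unfolding l_best_def by simp
qed

text \<open>The bound does not depend on \<open>P\<close>: every round rebuilds the pool from tables
  of length \<open>N\<close> with entries at most \<open>N\<close>. So sizes do not accumulate over
  the rounds, as \<open>ptime_funpow\<close> requires.\<close>

lemma sz_l_round: "sz (l_round N es P) \<le> 1 + length (tuples N) * (2 + N * (2 * N + 2))"
proof -
  have "sz (map (\<lambda>s. l_best N C s) L) \<le> 1 + length L * (2 + N * (2 * N + 2))" for C L
  proof (induction L)
    case (Cons s L)
    have "sz (map (\<lambda>s. l_best N C s) (s # L)) = Suc (sz (l_best N C s) + sz (map (\<lambda>s. l_best N C s) L))" by simp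
    also have "\<dots> \<le> Suc ((1 + N * (2 * N + 2)) + (1 + length L * (2 + N * (2 * N + 2))))"
      using Cons sz_l_best[of N C s] by linarith
    finally show ?case by simp
  qed simp
  then show ?thesis by (simp add: l_round_def)
qed

lemma ptime_l_match [ptime_intros]:
  assumes "ptime N" "ptime es" shows "ptime (\<lambda>x. l_match (N x) (es x))"
  unfolding l_match_def
proof (rule ptime_funpow[where B = "\<lambda>x. sz [[0..<N x]] + (1 + sz (length (tuples (N x))) * (2 + sz (N x) * (2 * sz (N x) + 2)))"])
  show "pb sz (\<lambda>x. sz [[0..<N x]] + (1 + sz (length (tuples (N x))) * (2 + sz (N x) * (2 * sz (N x) + 2))))"
    by (intro pb_add pb_mult pb_const ptime_sz ptime_intros assms)
  fix x i
  show "sz ((l_round (N x) (es x) ^^ i) [[0..<N x]])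
    \<le> sz [[0..<N x]] + (1 + sz (length (tuples (N x))) * (2 + sz (N x) * (2 * sz (N x) + 2)))"
  proof (cases i)
    case (Suc j)
    have "sz ((l_round (N x) (es x) ^^ i) [[0..<N x]]) \<le> 1 + length (tuples (N x)) * (2 + N x * (2 * N x + 2))"
      unfolding Suc using sz_l_round by simp
    also have "\<dots> \<le> 1 + sz (length (tuples (N x))) * (2 + sz (N x) * (2 * sz (N x) + 2))"
      by (intro add_mono mult_mono) (auto simp: sz_nat)
    finally show ?thesis by linarith
  qed simp
qed (intro ptime_intros assms assms[THEN ptime_comp])+

section \<open>Decoding the input\<close>

text \<open>Decodes a sequence of unary numbers, each ended by \<open>False\<close>. When it is
  applied to the whole input only the first entry is meaningful, because the adjacency matrix
  follows.\<close>

definition runs :: "bool list \<Rightarrow> nat list" where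
  "runs bs = rev (snd (foldl (\<lambda>s b. if b then (Suc (fst s), snd s) else (0, fst s # snd s)) (0, []) bs))"

text \<open>The first component of the state holds the half of a pair that still waits for its
  partner.\<close>

definition pair_up :: "nat list \<Rightarrow> (nat \<times> nat) list" where
  "pair_up xs = rev (snd (foldl (\<lambda>s c. case fst s of [] \<Rightarrow> ([c], snd s) | h # r \<Rightarrow> ([], (h, c) # snd s)) ([], []) xs))"

definition d_n :: "bool list \<Rightarrow> nat" where
  "d_n bs = entry (runs bs) 0"

text \<open>The offset skips the code of \<open>n\<close>, which has \<open>n + 1\<close> symbols,
  and the \<open>u\<close> rows before row \<open>u\<close>.\<close>

definition d_E :: "bool list \<Rightarrow> nat \<Rightarrow> nat \<Rightarrow> bool" where
  "d_E bs u v = (case drop (Suc (d_n bs) + u * d_n bs + v) bs of [] \<Rightarrow> False | b # r \<Rightarrow> b)"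

text \<open>Beyond the code of \<open>n\<close> and the matrix, one more symbol is skipped for the
  separator behind the matrix.\<close>

definition d_ts :: "bool list \<Rightarrow> (nat \<times> nat) list" where
  "d_ts bs = pair_up (runs (drop (Suc (Suc (d_n bs) + d_n bs * d_n bs)) bs))"

definition edge_list :: "nat \<Rightarrow> (nat \<Rightarrow> nat \<Rightarrow> bool) \<Rightarrow> (nat \<times> nat) list \<Rightarrow> (nat \<times> nat) list" where
  "edge_list n E ts = filter (\<lambda>e. hedge n E ts (fst e) (snd e)) (concat (map (\<lambda>u. map (\<lambda>v. (u, v)) [0..<n]) [0..<n]))"

definition dp_alg :: "nat \<Rightarrow> (nat \<Rightarrow> nat \<Rightarrow> bool) \<Rightarrow> (nat \<times> nat) list \<Rightarrow> bool" where
  "dp_alg n E ts = list_ex (\<lambda>X. length (nonadj E ts) \<le> l_msz (Suc n) X) (l_match (Suc n) (edge_list n E ts))"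

definition decide :: "bool list \<Rightarrow> bool" where
  "decide bs = dp_alg (d_n bs) (d_E bs) (d_ts bs)"

lemma ptime_runs [ptime_intros]: assumes "ptime l" shows "ptime (\<lambda>x. runs (l x))"
proof -
  have "ptime (\<lambda>x. foldl (\<lambda>s b. if b then (Suc (fst s), snd s) else (0, fst s # snd s)) (0, []) (l x))"
    by (rule ptime_foldl[where G = "\<lambda>_. 2"]) ((intro ptime_intros assms pb_const)+, auto)
  then show ?thesis unfolding runs_def by (intro ptime_rev ptime_snd)
qed

lemma ptime_pair_up [ptime_intros]: assumes "ptime l" shows "ptime (\<lambda>x. pair_up (l x))"
proof -
  have "ptime (\<lambda>x. foldl (\<lambda>s c. case fst s of [] \<Rightarrow> ([c], snd s) | h # r \<Rightarrow> ([], (h, c) # snd s)) ([], []) (l x))"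
  proof (rule ptime_foldl[where G = "\<lambda>x. sz (l x) + 2"])
    show "sz (case fst s of [] \<Rightarrow> ([c], snd s) | h # r \<Rightarrow> ([], (h, c) # snd s)) \<le> sz s + (sz (l x) + 2)"
      if "c \<in> set (l x)" for x c and s :: "nat list \<times> (nat \<times> nat) list"
      using sz_mem[OF that] by (cases s) (auto split: list.splits)
  qed (intro ptime_intros assms pb_add pb_const ptime_sz)+
  then show ?thesis unfolding pair_up_def by (intro ptime_rev ptime_snd)
qed

lemma ptime_d_n [ptime_intros]: "ptime l \<Longrightarrow> ptime (\<lambda>x. d_n (l x))"
  unfolding d_n_def by (intro ptime_intros)

lemma ptime_d_E [ptime_intros]: "ptime l \<Longrightarrow> ptime u \<Longrightarrow> ptime v \<Longrightarrow> ptime (\<lambda>x. d_E (l x) (u x) (v x))"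
  unfolding d_E_def by (intro ptime_intros)

lemma ptime_d_ts [ptime_intros]: "ptime l \<Longrightarrow> ptime (\<lambda>x. d_ts (l x))"
  unfolding d_ts_def by (intro ptime_intros)

lemma ptime_terms [ptime_intros]: "ptime ts \<Longrightarrow> ptime (\<lambda>x. terms (ts x))"
  unfolding terms_def by (intro ptime_intros)

lemma ptime_nonadj [ptime_intros]:
  assumes "ptime l" "ptime ts" shows "ptime (\<lambda>x. nonadj (d_E (l x)) (ts x))"
  unfolding nonadj_def by (intro ptime_intros assms assms[THEN ptime_comp])

lemma ptime_mem [ptime_intros]: assumes "ptime u" "ptime l" shows "ptime (\<lambda>x. (u x :: nat) \<in> set (l x))"
proof -
  have "ptime (\<lambda>x. list_ex (\<lambda>y. y = u x) (l x))" by (intro ptime_intros assms assms[THEN ptime_comp])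
  then show ?thesis by (rule ptime_cong) (auto simp: list_ex_iff)
qed

lemma ptime_hedge [ptime_intros]:
  assumes "ptime n" "ptime l" "ptime ts" "ptime u" "ptime v"
  shows "ptime (\<lambda>x. hedge (n x) (d_E (l x)) (ts x) (u x) (v x))"
  unfolding hedge_def hfree_def hterm_def list_all_iff[symmetric] list_ex_iff[symmetric]
  by (intro ptime_intros assms assms[THEN ptime_comp])

lemma ptime_edge_list [ptime_intros]:
  assumes "ptime n" "ptime l" "ptime ts" shows "ptime (\<lambda>x. edge_list (n x) (d_E (l x)) (ts x))"
  unfolding edge_list_def by (intro ptime_intros assms assms[THEN ptime_comp])

lemma ptime_decide: "ptime decide"
  unfolding decide_def[abs_def] dp_alg_def by (intro ptime_intros)

section \<open>Correctness of the decoder\<close>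

abbreviation "un m \<equiv> replicate m True @ [False]"

lemma runs_un: "runs (un m @ l) = m # runs l"
proof -
  let ?F = "\<lambda>s b. if b then (Suc (fst s), snd s) else (0, fst s # snd s)"
  have 1: "foldl ?F (c, acc) (replicate m True) = (c + m, acc)" for c :: nat and acc :: "nat list"
    by (induction m arbitrary: c) simp_all
  have 2: "snd (foldl ?F (c, acc) l) = snd (foldl ?F (c, []) l) @ acc" for c :: nat and acc
  proof (induction l arbitrary: c acc)
    case (Cons b l)
    show ?case
      by (cases b) (simp_all add: Cons[of "Suc c" acc] Cons[of 0 "c # acc"] Cons[of 0 "[c]"])
  qed simp
  show ?thesis using 2[of 0 "[m]"] by (simp add: runs_def 1)
qed

lemma runs_Nil: "runs [] = []"
  by (simp add: runs_def)

lemma pair_up_concat: "pair_up (concat (map (\<lambda>p. [fst p, snd p]) ts)) = ts"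
proof -
  let ?F = "\<lambda>s c. case fst s of [] \<Rightarrow> ([c], snd s) | h # r \<Rightarrow> ([], (h, c) # snd s)"
  have "foldl ?F ([], acc) (concat (map (\<lambda>p. [fst p, snd p]) ts)) = ([], rev ts @ acc)" for acc
    by (induction ts arbitrary: acc) simp_all
  then show ?thesis by (simp add: pair_up_def)
qed

lemma map_unary: "map (\<lambda>s. s = One) (unary m) = un m"
  by (simp add: unary_def)

lemma map_row: "map (\<lambda>s. s = One) (map (\<lambda>v. if P v then One else Zero) l) = map P l"
  by (induction l) auto

lemma map_encode:
  "map (\<lambda>s. s = One) (encode_instance n E ts) =
    un n @ concat (map (\<lambda>u. map (E u) [0..<n]) [0..<n]) @ [False] @ concat (map (\<lambda>p. un (fst p) @ un (snd p)) ts)"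
  unfolding encode_instance_def map_append map_unary map_concat map_map comp_def map_row case_prod_beta'
  by simp

lemma length_rows: "length (concat (map (\<lambda>u. map (E u) [0..<n]) us)) = length us * n"
  by (induction us) simp_all

context
  fixes n E ts bs
  assumes bs: "bs = map (\<lambda>s. s = One) (encode_instance n E ts)"
begin

lemma d_n: "d_n bs = n"
  unfolding d_n_def bs map_encode runs_un by (simp add: entry_def)

lemma d_E: assumes "u < n" "v < n" shows "d_E bs u v = E u v"
proof -
  have split: "[0..<n] = [0..<u] @ u # [Suc u..<n]" using assms(1) upt_add_eq_append[of 0 u "n - u"] upt_conv_Cons[of u n] by simp
  let ?f = "\<lambda>u. map (E u) [0..<n]"
  have "concat (map ?f ([0..<u] @ u # [Suc u..<n])) = concat (map ?f [0..<u]) @ ?f u @ concat (map ?f [Suc u..<n])"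
    by simp
  then obtain r where r: "bs = un n @ concat (map ?f [0..<u]) @ ?f u @ r"
    unfolding bs map_encode split[symmetric] by simp
  have "drop (Suc n + u * n + v) bs = drop v (map (E u) [0..<n]) @ r"
    unfolding r using assms(2) by (simp add: length_rows)
  moreover have "drop v (map (E u) [0..<n]) = E u v # drop (Suc v) (map (E u) [0..<n])"
    using assms(2) by (simp add: Cons_nth_drop_Suc[symmetric])
  ultimately show ?thesis by (simp add: d_E_def d_n)
qed

lemma d_ts: "d_ts bs = ts"
proof -
  have "drop (Suc (Suc n + n * n)) bs = concat (map (\<lambda>p. un (fst p) @ un (snd p)) ts)"
    unfolding bs map_encode by (simp add: length_rows)
  moreover have "runs (concat (map (\<lambda>p. un (fst p) @ un (snd p)) ts)) = concat (map (\<lambda>p. [fst p, snd p]) ts)"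
  proof (induction ts)
    case (Cons p ts)
    then show ?case using runs_un[of "fst p"] runs_un[of "snd p"] by simp
  qed (simp add: runs_Nil)
  ultimately show ?thesis by (simp add: d_ts_def d_n pair_up_concat)
qed

end

lemma dp_alg:
  assumes "valid_instance n E ts" "cobipartite n E"
  shows "dp_alg n E ts \<longleftrightarrow> disjoint_paths n E ts"
proof -
  interpret instance_graph n E ts by standard (rule assms)
  interpret matching_alg n "Suc n" "hedge n E ts" "edge_list n E ts"
  proof
    show "e \<in> set (edge_list n E ts) \<longleftrightarrow> hedge n E ts (fst e) (snd e)" for e
      by (cases e) (auto simp: edge_list_def hedge_def image_iff)
    show "u < n \<and> v < n" if "hedge n E ts u v" for u v using that by (simp add: hedge_def)
    show "hedge n E ts v u" if "hedge n E ts u v" for u v by (rule hedge_sym[OF that])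
  qed simp
  show ?thesis unfolding dp_alg_def disjoint_paths_iff_matching[OF assms(2)]
    using l_match[of "length (nonadj E ts)"] by (simp add: list_ex_iff)
qed

text \<open>The decoded edge relation agrees with \<open>E\<close> only below \<open>n\<close>, and
  this is all that the notions involved look at.\<close>

lemma instance_cong:
  assumes EE: "\<And>u v. u < n \<Longrightarrow> v < n \<Longrightarrow> E u v = F u v"
  shows "valid_instance n E ts \<Longrightarrow> valid_instance n F ts" "cobipartite n E \<Longrightarrow> cobipartite n F"
    "disjoint_paths n E ts = disjoint_paths n F ts"
proof -
  show "valid_instance n E ts \<Longrightarrow> valid_instance n F ts"
    using EE by (auto simp: valid_instance_def simple_graph_def)
  have "is_clique E X \<Longrightarrow> is_clique F X" if "X \<subseteq> {0..<n}" for X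
    using that EE unfolding is_clique_def by (metis atLeastLessThan_iff subsetD)
  then show "cobipartite n E \<Longrightarrow> cobipartite n F"
    unfolding cobipartite_def by (metis Diff_subset)
  have "E (p ! i) (p ! Suc i) = F (p ! i) (p ! Suc i)" if "set p \<subseteq> {0..<n}" "Suc i < length p" for p i
    using that EE nth_mem[of i p] nth_mem[of "Suc i" p] by (metis Suc_lessD atLeastLessThan_iff subsetD)
  then have "is_path n E p s t = is_path n F p s t" for p s t
    unfolding is_path_def by blast
  then show "disjoint_paths n E ts = disjoint_paths n F ts"
    unfolding disjoint_paths_def by simp
qed

theorem theorem7p1:
  shows "\<exists>M c d. tm_wf M \<and>
    (\<forall>n E ts. valid_instance n E ts \<and> cobipartite n E \<longrightarrow>
       decides_within M (c * length (encode_instance n E ts) ^ d + c)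
         (encode_instance n E ts) (disjoint_paths n E ts))"
proof -
  obtain M c d where M: "tm_wf M"
    "\<And>x. Blank \<notin> set x \<Longrightarrow> decides_within M (c * length x ^ d + c) x (decide (map (\<lambda>s. s = One) x))"
    using ptime_decidable_by_tm[OF ptime_decide] by blast
  have "decides_within M (c * length (encode_instance n E ts) ^ d + c) (encode_instance n E ts) (disjoint_paths n E ts)"
    if val: "valid_instance n E ts" and cob: "cobipartite n E" for n E ts
  proof -
    let ?x = "encode_instance n E ts"
    let ?F = "d_E (map (\<lambda>s. s = One) ?x)"
    have EF: "E u v = ?F u v" if "u < n" "v < n" for u v using d_E[OF refl that] by simp
    have x: "Blank \<notin> set ?x" by (auto simp: encode_instance_def unary_def)
    have "decide (map (\<lambda>s. s = One) ?x) = disjoint_paths n E ts"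
      using dp_alg[OF instance_cong(1)[of n E ?F, OF EF val] instance_cong(2)[of n E ?F, OF EF cob]]
        instance_cong(3)[of n E ?F, OF EF]
      by (simp add: decide_def d_n[OF refl] d_ts[OF refl])
    then show ?thesis using M(2)[OF x] by (simp only:)
  qed
  then show ?thesis using M(1) by blast
qed

end
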